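(* Let $R$ be a one-dimensional local Noetherian ring with finite residue field $k$. The smallest positive integer $n$ such that every ideal of $R$ has an $n$-generated reduction is $$ n = \left\lceil \: -1 + \log_{|k|}\left(\: |k| + (|k|-1)\cdot |\operatorname{Max}(\overline{R_{red}})|\: \right) \: \right\rceil.$$
   Context: All rings are commutative. For an ideal $I$ of a Noetherian ring $R$, a reduction of $I$ is an ideal $J\subseteq I$ such that $I^{m+1}=JI^m$ for some $m>0$; it is $n$-generated if it can be generated by $n$ elements. $R_{red}=R/\sqrt{0}$ is the quotient of $R$ by its nilradical, $\overline{A}$ denotes the integral closure of a ring $A$ in its total quotient ring, and $\operatorname{Max}(A)$ is the set of maximal ideals of $A$. *)

theory Defs
  imports "HOL-Algebra.Algebra" "HOL-Algebra.Ideal_Product" Complex_Main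
begin

definition noetherian_cring :: "('a, 'b) ring_scheme \<Rightarrow> bool" where
  "noetherian_cring R \<longleftrightarrow> cring R \<and>
     (\<forall>I. ideal I R \<longrightarrow> (\<exists>S. finite S \<and> S \<subseteq> carrier R \<and> I = Idl\<^bsub>R\<^esub> S))"

definition prime_chain :: "('a, 'b) ring_scheme \<Rightarrow> nat \<Rightarrow> bool" where
  "prime_chain R n \<longleftrightarrow> (\<exists>P :: nat \<Rightarrow> 'a set.
      (\<forall>i\<le>n. primeideal (P i) R) \<and> (\<forall>i<n. P i \<subset> P (Suc i)))"

definition krull_dim_eq :: "('a, 'b) ring_scheme \<Rightarrow> nat \<Rightarrow> bool" where
  "krull_dim_eq R n \<longleftrightarrow> prime_chain R n \<and> \<not> prime_chain R (Suc n)"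

fun ideal_pow :: "('a, 'b) ring_scheme \<Rightarrow> 'a set \<Rightarrow> nat \<Rightarrow> 'a set" where
  "ideal_pow R I 0 = carrier R"
| "ideal_pow R I (Suc n) = ideal_prod R I (ideal_pow R I n)"

definition is_reduction :: "('a, 'b) ring_scheme \<Rightarrow> 'a set \<Rightarrow> 'a set \<Rightarrow> bool" where
  "is_reduction R J I \<longleftrightarrow> ideal J R \<and> J \<subseteq> I \<and>
     (\<exists>m>0. ideal_pow R I (Suc m) = ideal_prod R J (ideal_pow R I m))"

definition n_generated :: "('a, 'b) ring_scheme \<Rightarrow> nat \<Rightarrow> 'a set \<Rightarrow> bool" where
  "n_generated R n J \<longleftrightarrow> (\<exists>S. finite S \<and> card S \<le> n \<and> S \<subseteq> carrier R \<and> J = Idl\<^bsub>R\<^esub> S)"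

definition has_n_gen_reduction :: "('a, 'b) ring_scheme \<Rightarrow> nat \<Rightarrow> 'a set \<Rightarrow> bool" where
  "has_n_gen_reduction R n I \<longleftrightarrow> (\<exists>J. is_reduction R J I \<and> n_generated R n J)"

definition nilradical :: "('a, 'b) ring_scheme \<Rightarrow> 'a set" where
  "nilradical R = {a \<in> carrier R. \<exists>n::nat. a [^]\<^bsub>R\<^esub> n = \<zero>\<^bsub>R\<^esub>}"

definition red_ring :: "('a, 'b) ring_scheme \<Rightarrow> 'a set ring" where
  "red_ring R = R Quot (nilradical R)"

definition nonzerodivisors :: "('a, 'b) ring_scheme \<Rightarrow> 'a set" where
  "nonzerodivisors A = {s \<in> carrier A. \<forall>a \<in> carrier A. s \<otimes>\<^bsub>A\<^esub> a = \<zero>\<^bsub>A\<^esub> \<longrightarrow> a = \<zero>\<^bsub>A\<^esub>}"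

definition frac_rel :: "('a, 'b) ring_scheme \<Rightarrow> (('a \<times> 'a) \<times> ('a \<times> 'a)) set" where
  "frac_rel A = {((a, s), (b, t)). a \<in> carrier A \<and> b \<in> carrier A \<and>
      s \<in> nonzerodivisors A \<and> t \<in> nonzerodivisors A \<and> a \<otimes>\<^bsub>A\<^esub> t = b \<otimes>\<^bsub>A\<^esub> s}"

definition frac_class :: "('a, 'b) ring_scheme \<Rightarrow> 'a \<Rightarrow> 'a \<Rightarrow> ('a \<times> 'a) set" where
  "frac_class A a s = frac_rel A `` {(a, s)}"

definition frac_mult :: "('a, 'b) ring_scheme \<Rightarrow> ('a \<times> 'a) set \<Rightarrow> ('a \<times> 'a) set \<Rightarrow> ('a \<times> 'a) set" where
  "frac_mult A U V = {z. \<exists>a s b t. (a, s) \<in> U \<and> (b, t) \<in> V \<and>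
       z \<in> frac_class A (a \<otimes>\<^bsub>A\<^esub> b) (s \<otimes>\<^bsub>A\<^esub> t)}"

definition frac_add :: "('a, 'b) ring_scheme \<Rightarrow> ('a \<times> 'a) set \<Rightarrow> ('a \<times> 'a) set \<Rightarrow> ('a \<times> 'a) set" where
  "frac_add A U V = {z. \<exists>a s b t. (a, s) \<in> U \<and> (b, t) \<in> V \<and>
       z \<in> frac_class A ((a \<otimes>\<^bsub>A\<^esub> t) \<oplus>\<^bsub>A\<^esub> (b \<otimes>\<^bsub>A\<^esub> s)) (s \<otimes>\<^bsub>A\<^esub> t)}"

definition total_quotient_ring :: "('a, 'b) ring_scheme \<Rightarrow> ('a \<times> 'a) set ring" where
  "total_quotient_ring A = \<lparr>
     carrier = (carrier A \<times> nonzerodivisors A) // frac_rel A,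
     monoid.mult = frac_mult A,
     one = frac_class A \<one>\<^bsub>A\<^esub> \<one>\<^bsub>A\<^esub>,
     ring.zero = frac_class A \<zero>\<^bsub>A\<^esub> \<one>\<^bsub>A\<^esub>,
     ring.add = frac_add A \<rparr>"

definition frac_embed :: "('a, 'b) ring_scheme \<Rightarrow> 'a \<Rightarrow> ('a \<times> 'a) set" where
  "frac_embed A a = frac_class A a \<one>\<^bsub>A\<^esub>"

definition integral_over_ring :: "('a, 'b) ring_scheme \<Rightarrow> ('a \<times> 'a) set \<Rightarrow> bool" where
  "integral_over_ring A x \<longleftrightarrow> (let Q = total_quotient_ring A in
     x \<in> carrier Q \<and> (\<exists>(n::nat) (c :: nat \<Rightarrow> 'a). (\<forall>i<n. c i \<in> carrier A) \<and>
       x [^]\<^bsub>Q\<^esub> n \<oplus>\<^bsub>Q\<^esub> finsum Q (\<lambda>i. frac_embed A (c i) \<otimes>\<^bsub>Q\<^esub> x [^]\<^bsub>Q\<^esub> i) {..<n}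
         = \<zero>\<^bsub>Q\<^esub>))"

definition integral_closure :: "('a, 'b) ring_scheme \<Rightarrow> ('a \<times> 'a) set ring" where
  "integral_closure A = (total_quotient_ring A)\<lparr> carrier := {x. integral_over_ring A x} \<rparr>"

definition Max_ideals :: "('a, 'b) ring_scheme \<Rightarrow> 'a set set" where
  "Max_ideals A = {M. maximalideal M A}"

end

theory Submission
  imports Defs
begin

text \<open>
  Let \<open>A\<close> be the reduced ring, \<open>q = |k|\<close>, and let \<open>n\<^sub>1, \<dots>, n\<^sub>M\<close> be the maximal ideals of the
  integral closure \<open>B\<close> of \<open>A\<close>. The formula says that \<open>N\<close> is the least integer with
  \<open>M \<le> q + q\<^sup>2 + \<dots> + q\<^sup>N\<close>.

  Upper bound. Let \<open>I\<close> be an ideal of \<open>A\<close> containing a nonzerodivisor. Counting in the fiber cone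
  shows that some power \<open>I\<^sup>h\<close> has a principal reduction \<open>y\<close>, so that \<open>I\<^sup>h / y \<subseteq> B\<close>. Each \<open>n\<^sub>i\<close> thus
  singles out a proper submodule \<open>W\<^sub>i\<close> of \<open>I\<close> containing \<open>m I\<close>, and an ideal \<open>J \<subseteq> I\<close> contained in
  no \<open>W\<^sub>i\<close> is a reduction of \<open>I\<close>. A counting argument over \<open>k\<close> provides \<open>N\<close> elements not all lying in
  any one of \<open>q + \<dots> + q\<^sup>N\<close> proper subspaces.

  Lower bound. If \<open>M \<ge> 1 + q + \<dots> + q\<^sup>n\<close>, choose by the Chinese remainder theorem \<open>n + 1\<close> elements
  \<open>f\<^sub>j = a\<^sub>j / d\<close> of \<open>B\<close> whose residues at the \<open>n\<^sub>i\<close> run through all points of the projective \<open>n\<close>-space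
  over \<open>k\<close>. Any \<open>n\<close> linear forms over \<open>k\<close> have a common zero there, so an \<open>n\<close>-generated subideal of
  \<open>(a\<^sub>0, \<dots>, a\<^sub>n)\<close> lies in some \<open>d n\<^sub>i\<close> and is not a reduction.

  Because \<open>A\<close> is Noetherian, \<open>x\<close> is integral over \<open>A\<close> iff all powers of \<open>x\<close> have a common
  denominator. Because \<open>k\<close> is finite, \<open>A / t A\<close> is finite for each nonzerodivisor \<open>t\<close>, and cardinalities
  replace lengths throughout.
\<close>

section \<open>Ideal arithmetic and reductions\<close>

text \<open>Over an infinite field a general linear form would give a principal reduction; over a
  small field no linear form need avoid the finitely many bad points. Hence the passage to powers
  and the quadratic form \<open>Y^2 - YZ + Z^2\<close>: over the field with two elements every
  nonzero linear form in two variables vanishes at one of (1:0), (0:1), (1:1), whereas this form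
  takes the value 1 at all three points over every field. The integral closure of a reduced
  one-dimensional local ring need not be a finite module. What replaces finiteness of
  \<open>B\<close> is the bound |R/tR| on the quotients K/tK, uniform over all ideals
  \<open>K\<close> containing a nonzerodivisor. It yields the principal reduction of a power of an
  ideal and also the finiteness of the set of maximal ideals of \<open>B\<close>. The two bounds
  meet exactly because the failure of M \<le> q + ... + q^n is the same as M \<ge> 1 + q + ... +
  q^n, and the latter sum counts the points of projective n-space over k.\<close>

context cring
begin

lemma ideal_prod_subsetI:
  assumes "ideal K R" "\<And>i j. i \<in> I \<Longrightarrow> j \<in> J \<Longrightarrow> i \<otimes> j \<in> K"
  shows "I \<cdot> J \<subseteq> K"
proof
  fix s assume "s \<in> I \<cdot> J"
  then show "s \<in> K"
    by (induct s rule: ideal_prod.induct)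
      (use assms additive_subgroup.a_closed[OF ideal.axioms(1)] in auto)
qed

lemma ideal_prod_mono:
  assumes "I \<subseteq> I'" "J \<subseteq> J'"
  shows "I \<cdot> J \<subseteq> I' \<cdot> J'"
proof
  fix s assume "s \<in> I \<cdot> J"
  then show "s \<in> I' \<cdot> J'"
    by (induct s rule: ideal_prod.induct)
      (use assms in \<open>auto intro: ideal_prod.intros\<close>)
qed

lemma ideal_diff_closed:
  assumes "ideal K R" "a \<in> K" "b \<in> K"
  shows "a \<ominus> b \<in> K"
proof -
  interpret ideal K R by fact
  show ?thesis using assms(2,3) by (simp add: a_minus_def)
qed

lemma ideal_add_closed: "ideal K R \<Longrightarrow> a \<in> K \<Longrightarrow> b \<in> K \<Longrightarrow> a \<oplus> b \<in> K"
  by (simp add: additive_subgroup.a_closed ideal.axioms(1))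

lemma ideal_zero_closed: "ideal K R \<Longrightarrow> \<zero> \<in> K"
  by (simp add: additive_subgroup.zero_closed ideal.axioms(1))

lemma ideal_carrier: "ideal K R \<Longrightarrow> a \<in> K \<Longrightarrow> a \<in> carrier R"
  by (rule ideal.Icarr)

lemma ideal_addE:
  assumes "x \<in> I <+>\<^bsub>R\<^esub> J"
  obtains i j where "i \<in> I" "j \<in> J" "x = i \<oplus> j"
  using assms unfolding set_add_def' by auto

lemma ideal_addI: "i \<in> I \<Longrightarrow> j \<in> J \<Longrightarrow> i \<oplus> j \<in> I <+>\<^bsub>R\<^esub> J"
  unfolding set_add_def' by auto

lemma ideal_add_upper1: "ideal I R \<Longrightarrow> ideal J R \<Longrightarrow> I \<subseteq> I <+>\<^bsub>R\<^esub> J"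
  using ideal_addI[of _ I \<zero> J] ideal_zero_closed ideal_carrier by fastforce

lemma ideal_add_upper2: "ideal I R \<Longrightarrow> ideal J R \<Longrightarrow> J \<subseteq> I <+>\<^bsub>R\<^esub> J"
  using ideal_addI[of \<zero> I _ J] ideal_zero_closed ideal_carrier by fastforce

lemma ideal_add_least:
  "ideal K R \<Longrightarrow> I \<subseteq> K \<Longrightarrow> J \<subseteq> K \<Longrightarrow> I <+>\<^bsub>R\<^esub> J \<subseteq> K"
  by (auto elim!: ideal_addE intro: ideal_add_closed)

lemma ideal_prod_left_commute:
  assumes "ideal I R" "ideal J R" "ideal K R"
  shows "I \<cdot> (J \<cdot> K) = J \<cdot> (I \<cdot> K)"
proof -
  have "I \<cdot> (J \<cdot> K) = (I \<cdot> J) \<cdot> K" using assms by (simp add: ideal_prod_assoc)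
  also have "I \<cdot> J = J \<cdot> I" using assms by (simp add: ideal_prod_commute)
  finally show ?thesis using assms by (simp add: ideal_prod_assoc)
qed

lemma ideal_pow_ideal: "ideal I R \<Longrightarrow> ideal (ideal_pow R I n) R"
  by (induct n) (auto simp: oneideal ideal_prod_is_ideal)

lemma ideal_pow_add:
  assumes "ideal I R"
  shows "ideal_pow R I (a + b) = ideal_pow R I a \<cdot> ideal_pow R I b"
  using assms
  by (induct a) (auto simp: ideal_prod_assoc ideal_pow_ideal oneideal ideal_prod_commute[of "carrier R"] ideal_prod_one)

lemma ideal_pow_one: "ideal I R \<Longrightarrow> ideal_pow R I (Suc 0) = I"
  by (simp add: ideal_prod_one)

lemma ideal_pow_mono:
  assumes "I \<subseteq> J" shows "ideal_pow R I n \<subseteq> ideal_pow R J n"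
  using assms by (induct n) (simp_all add: ideal_prod_mono)

lemma ideal_pow_mult_mem:
  assumes "ideal I R" "a \<in> ideal_pow R I i" "b \<in> ideal_pow R I j" "n = i + j"
  shows "a \<otimes> b \<in> ideal_pow R I n"
  using assms ideal_prod.prod ideal_pow_add by metis

lemma ideal_pow_nat_pow_mem:
  assumes "ideal I R" "a \<in> ideal_pow R I l" "k = l * n"
  shows "a [^] n \<in> ideal_pow R I k"
  unfolding assms(3)
proof (induct n)
  case (Suc n)
  then show ?case using ideal_pow_mult_mem[OF assms(1) Suc assms(2)] by (simp add: algebra_simps)
qed simp

lemma ideal_pow_nat_pow_mem1:
  assumes "ideal I R" "a \<in> I"
  shows "a [^] n \<in> ideal_pow R I n"
  using ideal_pow_nat_pow_mem[of I a 1 n n] assms by (simp add: ideal_prod_one)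

lemma ideal_pow_carrier: "ideal I R \<Longrightarrow> a \<in> ideal_pow R I n \<Longrightarrow> a \<in> carrier R"
  using ideal_pow_ideal ideal_carrier by blast

lemma ideal_pow_decreasing:
  assumes "ideal I R" "i \<le> j" shows "ideal_pow R I j \<subseteq> ideal_pow R I i"
proof -
  obtain k where "j = i + k" using assms(2) le_Suc_ex by blast
  then show ?thesis
    using ideal_pow_add[OF assms(1)] ideal_prod_inter ideal_pow_ideal[OF assms(1)] by blast
qed

text \<open>The binomial expansion of a power of a sum of ideals, in the form of a test on the mixed
  products. The induction keeps \<open>w\<close> factors \<open>V + Y\<close> unexpanded and splits
  off one at a time, so no binomial coefficients appear.\<close>

lemma ideal_prod_add_pow_subset:
  assumes "ideal V R" "ideal Y R" "ideal K R"
    and "\<And>u v. u + v = n \<Longrightarrow> ideal_pow R V u \<cdot> ideal_pow R Y v \<subseteq> K"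
  shows "ideal_pow R (V <+>\<^bsub>R\<^esub> Y) n \<subseteq> K"
proof -
  note I = assms(1-3) add_ideals ideal_pow_ideal ideal_prod_is_ideal
  have "(ideal_pow R V u \<cdot> ideal_pow R Y v) \<cdot> ideal_pow R (V <+>\<^bsub>R\<^esub> Y) w \<subseteq> K" if "u + v + w = n" for u v w
    using that
  proof (induct w arbitrary: u v)
    case 0
    then show ?case using assms(4)[of u v] by (simp add: ideal_prod_one I)
  next
    case (Suc w)
    let ?P = "ideal_pow R (V <+>\<^bsub>R\<^esub> Y) w"
    have "(ideal_pow R V u \<cdot> ideal_pow R Y v) \<cdot> ideal_pow R (V <+>\<^bsub>R\<^esub> Y) (Suc w)
      = (ideal_pow R V u \<cdot> ideal_pow R Y v) \<cdot> (V \<cdot> ?P <+>\<^bsub>R\<^esub> Y \<cdot> ?P)"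
      by (simp add: ideal_prod_distr I)
    also have "\<dots> = (ideal_pow R V u \<cdot> ideal_pow R Y v) \<cdot> (V \<cdot> ?P) <+>\<^bsub>R\<^esub> (ideal_pow R V u \<cdot> ideal_pow R Y v) \<cdot> (Y \<cdot> ?P)"
      by (simp add: ideal_prod_distr I)
    also have "(ideal_pow R V u \<cdot> ideal_pow R Y v) \<cdot> (V \<cdot> ?P) = (ideal_pow R V (Suc u) \<cdot> ideal_pow R Y v) \<cdot> ?P"
    proof -
      have "(ideal_pow R V u \<cdot> ideal_pow R Y v) \<cdot> (V \<cdot> ?P) = ((ideal_pow R V u \<cdot> ideal_pow R Y v) \<cdot> V) \<cdot> ?P"
        by (simp add: ideal_prod_assoc I)
      also have "(ideal_pow R V u \<cdot> ideal_pow R Y v) \<cdot> V = V \<cdot> (ideal_pow R V u \<cdot> ideal_pow R Y v)"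
        by (simp add: ideal_prod_commute I)
      finally show ?thesis by (simp add: ideal_prod_assoc I)
    qed
    also have "(ideal_pow R V u \<cdot> ideal_pow R Y v) \<cdot> (Y \<cdot> ?P) = (ideal_pow R V u \<cdot> ideal_pow R Y (Suc v)) \<cdot> ?P"
    proof -
      have "(ideal_pow R V u \<cdot> ideal_pow R Y v) \<cdot> (Y \<cdot> ?P) = (ideal_pow R V u \<cdot> (ideal_pow R Y v \<cdot> Y)) \<cdot> ?P"
        by (simp add: ideal_prod_assoc I)
      also have "ideal_pow R Y v \<cdot> Y = Y \<cdot> ideal_pow R Y v"
        by (simp add: ideal_prod_commute I)
      finally show ?thesis by simp
    qed
    finally show ?case
      using Suc.hyps[of "Suc u" v] Suc.hyps[of u "Suc v"] Suc.prems
      by (simp add: ideal_add_least I)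
  qed
  from this[of 0 0 n] show ?thesis
    by (simp add: ideal_prod_one ideal_prod_commute[of "carrier R"] I oneideal)
qed

lemma Idl_insert:
  assumes "a \<in> carrier R" "S \<subseteq> carrier R"
  shows "Idl (insert a S) = Idl S <+>\<^bsub>R\<^esub> PIdl a"
proof -
  have "Idl (S \<union> {a}) = Idl (Idl S \<union> Idl {a})"
  proof (rule subset_antisym)
    show "Idl (S \<union> {a}) \<subseteq> Idl (Idl S \<union> Idl {a})"
    proof -
      have c: "Idl S \<union> Idl {a} \<subseteq> carrier R"
        using ideal_carrier[OF genideal_ideal] assms by blast
      have "S \<union> {a} \<subseteq> Idl (Idl S \<union> Idl {a})"
        using genideal_self[of S] genideal_self[of "{a}"] genideal_self[OF c] assms by blast
      then show ?thesis by (rule genideal_minimal[OF genideal_ideal[OF c]])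
    qed
    show "Idl (Idl S \<union> Idl {a}) \<subseteq> Idl (S \<union> {a})"
      using assms subset_Idl_subset[of "S \<union> {a}" S] subset_Idl_subset[of "S \<union> {a}" "{a}"]
      by (intro genideal_minimal genideal_ideal) auto
  qed
  then show ?thesis
    using assms by (simp add: union_genideal genideal_ideal cgenideal_eq_genideal)
qed

lemma PIdl_pow_subset:
  assumes "a \<in> carrier R" "ideal K R" "a [^] n \<in> K"
  shows "ideal_pow R (PIdl a) n \<subseteq> K"
proof -
  have "ideal_pow R (PIdl a) n = PIdl (a [^] n)"
  proof (induct n)
    case 0
    then show ?case using genideal_one cgenideal_eq_genideal by simp
  next
    case (Suc n)
    have "(PIdl a) \<cdot> (PIdl (a [^] n)) = Idl (PIdl (a \<otimes> a [^] n))"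
      using assms(1) by (simp add: ideal_prod_eq_genideal cgenideal_ideal cgenideal_prod)
    also have "\<dots> = PIdl (a \<otimes> a [^] n)"
      using assms(1) cgenideal_ideal[of "a \<otimes> a [^] n"] ideal_carrier
      by (intro subset_antisym genideal_minimal genideal_self) auto
    finally show ?case using Suc assms(1) by (simp add: m_comm)
  qed
  then show ?thesis using assms cgenideal_minimal by simp
qed

text \<open>A graded version of the fact that an ideal generated by finitely many nilpotent elements
  is nilpotent. The ideals \<open>G d\<close> behave like the degree-\<open>d\<close> parts of an
  ideal of the Rees algebra of \<open>I\<close>, with the elements of \<open>S\<close> in degree
  one. The bound \<open>N\<close> lets a caller ask for a degree in which a piecewise definition of
  \<open>G\<close> takes its generic form.\<close>

lemma Idl_pow_subset_graded:
  assumes S: "finite S" "S \<subseteq> I" and I: "ideal I R" and G: "\<And>d. ideal (G d) R"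
    and IG: "\<And>d a b. a \<in> I \<Longrightarrow> b \<in> G d \<Longrightarrow> a \<otimes> b \<in> G (Suc d)"
    and pow: "\<And>a. a \<in> S \<Longrightarrow> \<exists>n. a [^] n \<in> G (n::nat)"
  shows "\<exists>n\<ge>N. ideal_pow R (Idl S) n \<subseteq> G n"
proof -
  have IG': "a \<otimes> b \<in> G (k + d)" if "a \<in> ideal_pow R I k" "b \<in> G d" for a b k d
    using that
  proof (induct k arbitrary: a b)
    case 0
    then show ?case using G by (simp add: ideal.I_l_closed)
  next
    case (Suc k)
    have "I \<cdot> ideal_pow R I k \<subseteq> {a \<in> carrier R. \<forall>b\<in>G d. a \<otimes> b \<in> G (Suc k + d)}"
    proof
      fix s assume "s \<in> I \<cdot> ideal_pow R I k"
      then show "s \<in> {a \<in> carrier R. \<forall>b\<in>G d. a \<otimes> b \<in> G (Suc k + d)}"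
      proof (induct s rule: ideal_prod.induct)
        case (prod i j)
        then show ?case
          using Suc.hyps IG ideal_carrier[OF G] ideal_carrier[OF I] ideal_pow_carrier[OF I]
          by (auto simp: m_assoc)
      next
        case (sum s1 s2)
        then show ?case
          using ideal_carrier[OF G] ideal_add_closed[OF G] by (auto simp: l_distr)
      qed
    qed
    then show ?case using Suc.prems by auto
  qed
  have "\<exists>n>0. ideal_pow R (Idl S) n \<subseteq> G n"
    using S pow
  proof (induct S rule: finite_induct)
    case empty
    have "ideal_pow R (Idl {}) 1 \<subseteq> G 1"
      by (simp add: ideal_prod_one genideal_ideal genideal_minimal G)
    then show ?case by blast
  next
    case (insert a S)
    then obtain p where p: "p > 0" "ideal_pow R (Idl S) p \<subseteq> G p" by auto
    obtain r where r: "a [^] r \<in> G r" using insert.prems(2) by blast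
    have aI: "a \<in> I" "S \<subseteq> I" and ac: "a \<in> carrier R" "S \<subseteq> carrier R"
      using insert.prems ideal_carrier[OF I] by auto
    have SI: "Idl S \<subseteq> I" "PIdl a \<subseteq> I" using aI I by (simp_all add: genideal_minimal cgenideal_minimal)
    have id: "ideal (Idl S) R" "ideal (PIdl a) R" using ac by (auto intro: genideal_ideal cgenideal_ideal)
    have pa: "ideal_pow R (PIdl a) r \<subseteq> G r" using PIdl_pow_subset ac r G by blast
    \<comment> \<open>From \<open>u + v = p + r\<close> follows \<open>u \<ge> p\<close> or
      \<open>v \<ge> r\<close>, so one of the two factors already lies in \<open>G\<close>; the
      other one lifts it to degree \<open>p + r\<close> by \<open>IG'\<close>.\<close>
    have "ideal_pow R (Idl (insert a S)) (p + r) \<subseteq> G (p + r)"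
      unfolding Idl_insert[OF ac]
    proof (rule ideal_prod_add_pow_subset[OF id G])
      fix u v assume uv: "u + v = p + r"
      show "ideal_pow R (Idl S) u \<cdot> ideal_pow R (PIdl a) v \<subseteq> G (p + r)"
      proof (rule ideal_prod_subsetI[OF G])
        fix i j assume ij: "i \<in> ideal_pow R (Idl S) u" "j \<in> ideal_pow R (PIdl a) v"
        have c: "i \<in> carrier R" "j \<in> carrier R" using ij ideal_pow_carrier id by blast+
        have *: "x \<in> G (u' + u0)" if "x \<in> ideal_pow R V (u' + u0)" "ideal V R" "V \<subseteq> I" "ideal_pow R V u0 \<subseteq> G u0"
          for x V u' u0
        proof -
          have "ideal_pow R V u' \<cdot> ideal_pow R V u0 \<subseteq> G (u' + u0)"
            using that ideal_pow_mono[of V I] by (intro ideal_prod_subsetI[OF G] IG') auto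
          then show ?thesis using that ideal_pow_add by auto
        qed
        consider "u \<ge> p" | "v \<ge> r" using uv by linarith
        then show "i \<otimes> j \<in> G (p + r)"
        proof cases
          case 1
          then have "i \<in> G u" using *[of i "Idl S" "u - p" p] ij id SI p by simp
          then have "j \<otimes> i \<in> G (v + u)" using IG' ij SI ideal_pow_mono by blast
          then show ?thesis using uv c by (simp add: m_comm add.commute)
        next
          case 2
          then have "j \<in> G v" using *[of j "PIdl a" "v - r" r] ij id SI pa by simp
          then have "i \<otimes> j \<in> G (u + v)" using IG' ij SI ideal_pow_mono by blast
          then show ?thesis using uv by simp
        qed
      qed
    qed
    then show ?case using p(1) by (metis add_gr_0)
  qed
  then obtain n where n: "ideal_pow R (Idl S) n \<subseteq> G n" by blast
  have SI: "Idl S \<subseteq> I" using S I by (simp add: genideal_minimal)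
  have id: "ideal (Idl S) R" using S ideal_carrier[OF I] by (intro genideal_ideal) auto
  have "ideal_pow R (Idl S) N \<cdot> ideal_pow R (Idl S) n \<subseteq> G (N + n)"
    using IG' n ideal_pow_mono[OF SI] by (intro ideal_prod_subsetI[OF G]) blast
  then have "ideal_pow R (Idl S) (N + n) \<subseteq> G (N + n)"
    by (simp add: ideal_pow_add[OF id])
  then show ?thesis using le_add1 by blast
qed

text \<open>For \<open>n = 1\<close> the given inclusion has exponent zero on the right, which
  \<open>is_reduction\<close> excludes. Multiplying it once by \<open>I\<close> makes the exponent
  \<open>n > 0\<close>; the reverse inclusion comes from \<open>J \<subseteq> I\<close>.\<close>

lemma is_reductionI:
  assumes I: "ideal I R" and J: "ideal J R" "J \<subseteq> I" and n: "n > 0"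
    and sub: "ideal_pow R I n \<subseteq> J \<cdot> ideal_pow R I (n - 1)"
  shows "is_reduction R J I"
proof -
  have "ideal_pow R I (Suc n) = I \<cdot> ideal_pow R I n" by simp
  also have "\<dots> \<subseteq> I \<cdot> (J \<cdot> ideal_pow R I (n - 1))" by (rule ideal_prod_mono) (use sub in auto)
  also have "\<dots> = J \<cdot> (I \<cdot> ideal_pow R I (n - 1))"
    by (rule ideal_prod_left_commute[OF I J(1) ideal_pow_ideal[OF I]])
  also have "\<dots> = J \<cdot> ideal_pow R I n" using n by (cases n) auto
  finally have "ideal_pow R I (Suc n) \<subseteq> J \<cdot> ideal_pow R I n" .
  moreover have "J \<cdot> ideal_pow R I n \<subseteq> ideal_pow R I (Suc n)"
    using J(2) by (simp add: ideal_prod_mono)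
  ultimately show ?thesis unfolding is_reduction_def using J n by blast
qed

text \<open>An equation of integral dependence of degree \<open>n\<close> of \<open>a\<close> on
  \<open>J\<close> puts \<open>a^n\<close> into \<open>J I^(n-1)\<close>. This condition is
  therefore only asked of the generators, and the graded lemma combines them.\<close>

lemma is_reductionI_elementwise:
  assumes I: "ideal I R" and J: "ideal J R" "J \<subseteq> I" and S: "finite S" "I = Idl S" "S \<subseteq> carrier R"
    and pow: "\<And>a. a \<in> S \<Longrightarrow> \<exists>n>0. a [^] n \<in> J \<cdot> ideal_pow R I (n - 1)"
  shows "is_reduction R J I"
proof -
  \<comment> \<open>The ideal of the Rees algebra of \<open>I\<close> generated by \<open>J\<close>
    in degree one; its component in degree zero is zero.\<close>
  define G where "G d = (if d = 0 then {\<zero>} else J \<cdot> ideal_pow R I (d - 1))" for d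
  have "\<exists>n\<ge>1. ideal_pow R (Idl S) n \<subseteq> G n"
  proof (rule Idl_pow_subset_graded[OF S(1) _ I])
    show "S \<subseteq> I" using S genideal_self by simp
    show id: "ideal (G d) R" for d unfolding G_def using I J by (auto simp: zeroideal ideal_prod_is_ideal ideal_pow_ideal)
    show "\<exists>n. a [^] n \<in> G n" if "a \<in> S" for a using pow[OF that] unfolding G_def by (metis less_numeral_extra(3))
    fix d a b assume ab: "a \<in> I" "b \<in> G d"
    show "a \<otimes> b \<in> G (Suc d)"
    proof (cases d)
      case 0
      then have "b = \<zero>" using ab by (simp add: G_def)
      then show ?thesis using id ideal_zero_closed ideal_carrier[OF I] ab by auto
    next
      case (Suc k)
      have "a \<otimes> b \<in> I \<cdot> (J \<cdot> ideal_pow R I k)" using ab Suc by (auto simp: G_def intro: ideal_prod.prod)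
      also have "\<dots> = J \<cdot> (I \<cdot> ideal_pow R I k)"
        by (rule ideal_prod_left_commute[OF I J(1) ideal_pow_ideal[OF I]])
      finally show ?thesis using Suc by (simp add: G_def)
    qed
  qed
  then obtain n where n: "n \<ge> 1" "ideal_pow R (Idl S) n \<subseteq> G n" by blast
  then have "ideal_pow R I n \<subseteq> J \<cdot> ideal_pow R I (n - 1)" using S(2) by (simp add: G_def)
  then show ?thesis using n(1) by (intro is_reductionI[OF I J, of n]) auto
qed

end

section \<open>Maximal elements among ideals, and inverses modulo a maximal ideal\<close>

lemma noetherian_cring_imp_noetherian_ring: "noetherian_cring R \<Longrightarrow> noetherian_ring R"
  unfolding noetherian_cring_def noetherian_ring_def noetherian_ring_axioms_def
  by (meson cring.axioms(1))

lemma (in noetherian_ring) ideal_maximal_element: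
  assumes "\<C> \<noteq> {}" "\<And>I. I \<in> \<C> \<Longrightarrow> ideal I R"
  obtains K where "K \<in> \<C>" "\<And>I. I \<in> \<C> \<Longrightarrow> K \<subseteq> I \<Longrightarrow> I = K"
proof -
  have "\<exists>M\<in>\<C>. \<forall>V\<in>\<C>. M \<subseteq> V \<longrightarrow> V = M"
  proof (rule subset_Zorn_nonempty)
    fix C assume C: "C \<noteq> {}" "subset.chain \<C> C"
    have "subset.chain {I. ideal I R} C"
      using C assms(2) by (auto simp: subset.chain_def)
    from ideal_chain_is_trivial[OF C(1) this] show "\<Union>C \<in> \<C>"
      using C by (auto simp: subset.chain_def)
  qed (fact assms(1))
  then show thesis using that by blast
qed

lemma (in cring) exists_maximalideal_superset:
  assumes "ideal I R" "\<one> \<notin> I"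
  obtains M where "maximalideal M R" "I \<subseteq> M"
proof -
  let ?C = "{J. ideal J R \<and> I \<subseteq> J \<and> \<one> \<notin> J}"
  have "\<exists>M\<in>?C. \<forall>V\<in>?C. M \<subseteq> V \<longrightarrow> V = M"
  proof (rule subset_Zorn_nonempty)
    fix C assume C: "C \<noteq> {}" "subset.chain ?C C"
    then have sub: "C \<subseteq> ?C" and ch: "\<And>V Y. V \<in> C \<Longrightarrow> Y \<in> C \<Longrightarrow> V \<subseteq> Y \<or> Y \<subseteq> V"
      by (auto simp: subset.chain_def)
    have id: "ideal V R" if "V \<in> C" for V using that sub by auto
    have "ideal (\<Union>C) R"
    proof (rule idealI[OF ring_axioms])
      show "subgroup (\<Union>C) (add_monoid R)"
      proof (rule add.subgroupI)
        show "\<Union>C \<subseteq> carrier R" using id ideal_carrier by blast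
        show "\<Union>C \<noteq> {}" using C(1) id ideal_zero_closed by blast
        show "\<ominus> a \<in> \<Union>C" if "a \<in> \<Union>C" for a
          using that id by (meson UnionE UnionI additive_subgroup.a_inv_closed ideal.axioms(1))
        show "a \<oplus> b \<in> \<Union>C" if ab: "a \<in> \<Union>C" "b \<in> \<Union>C" for a b
        proof -
          obtain V Y where XY: "V \<in> C" "a \<in> V" "Y \<in> C" "b \<in> Y" using ab by blast
          then have "\<exists>Z\<in>C. a \<in> Z \<and> b \<in> Z" using ch[OF XY(1,3)] by blast
          then show ?thesis using id ideal_add_closed by blast
        qed
      qed
      show "x \<otimes> a \<in> \<Union>C" if "a \<in> \<Union>C" "x \<in> carrier R" for a x
        using that id ideal.I_l_closed by (metis UnionE UnionI)
      show "a \<otimes> x \<in> \<Union>C" if "a \<in> \<Union>C" "x \<in> carrier R" for a x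
        using that id ideal.I_r_closed by (metis UnionE UnionI)
    qed
    then show "\<Union>C \<in> ?C" using C(1) sub by blast
  qed (use assms in blast)
  then obtain M where "M \<in> ?C" and *: "\<forall>V\<in>?C. M \<subseteq> V \<longrightarrow> V = M" ..
  then have M: "ideal M R" "I \<subseteq> M" "\<one> \<notin> M" by auto
  have mx: "V = M" if "ideal V R" "I \<subseteq> V" "\<one> \<notin> V" "M \<subseteq> V" for V
    using that bspec[OF *, of V] by simp
  have "maximalideal M R"
  proof (rule maximalidealI)
    show "carrier R \<noteq> M" using M(3) by auto
    show "J = M \<or> J = carrier R" if "ideal J R" "M \<subseteq> J" "J \<subseteq> carrier R" for J
    proof (cases "\<one> \<in> J")
      case True
      then show ?thesis using ideal.one_imp_carrier that by metis
    next
      case False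
      then show ?thesis using mx[of J] that M(2) by auto
    qed
  qed (fact M)
  then show thesis using that M(2) by blast
qed

lemma (in cring) maximalideal_one_notin: "maximalideal M R \<Longrightarrow> \<one> \<notin> M"
  using ideal.one_imp_carrier maximalideal.I_notcarr maximalideal.axioms(1) by blast

lemma (in cring) maximalideal_inverse_mod:
  assumes M: "maximalideal M R" and x: "x \<in> carrier R" "x \<notin> M"
  obtains z where "z \<in> carrier R" "x \<otimes> z \<ominus> \<one> \<in> M"
proof -
  have id: "ideal M R" using M by (rule maximalideal.axioms(1))
  have "ideal (M <+>\<^bsub>R\<^esub> PIdl x) R" using id x by (simp add: add_ideals cgenideal_ideal)
  moreover have "M \<subseteq> M <+>\<^bsub>R\<^esub> PIdl x" "PIdl x \<subseteq> M <+>\<^bsub>R\<^esub> PIdl x"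
    using ideal_add_upper1 ideal_add_upper2 id x(1) cgenideal_ideal by blast+
  ultimately have "M <+>\<^bsub>R\<^esub> PIdl x = carrier R"
    using maximalideal.I_maximal[OF M, of "M <+>\<^bsub>R\<^esub> PIdl x"] x cgenideal_self[OF x(1)] additive_subgroup.a_subset[OF ideal.axioms(1)] by (metis subsetD)
  then obtain u z where uz: "u \<in> M" "z \<in> carrier R" "\<one> = u \<oplus> z \<otimes> x"
  proof -
    have "\<one> \<in> M <+>\<^bsub>R\<^esub> PIdl x" using \<open>M <+>\<^bsub>R\<^esub> PIdl x = carrier R\<close> by simp
    then show thesis using that by (elim ideal_addE) (auto simp: cgenideal_def)
  qed
  have u: "u \<in> carrier R" using uz id ideal_carrier by blast
  have "x \<otimes> z \<ominus> (u \<oplus> z \<otimes> x) = \<ominus> u" using u uz(2) x(1) by algebra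
  then have "x \<otimes> z \<ominus> \<one> = \<ominus> u" using uz(3) by simp
  then show thesis using that uz id by (metis additive_subgroup.a_inv_closed ideal.axioms(1))
qed

section \<open>Arithmetic of nonzerodivisors\<close>

context cring
begin

lemma nzd_carrier: "t \<in> nonzerodivisors R \<Longrightarrow> t \<in> carrier R" by (simp add: nonzerodivisors_def)

lemma nzd_cancel:
  assumes "t \<in> nonzerodivisors R" "a \<in> carrier R" "t \<otimes> a = \<zero>" shows "a = \<zero>"
  using assms by (auto simp: nonzerodivisors_def)

lemma nzd_mult:
  assumes "s \<in> nonzerodivisors R" "t \<in> nonzerodivisors R" shows "s \<otimes> t \<in> nonzerodivisors R"
proof -
  have c: "s \<in> carrier R" "t \<in> carrier R" using assms nzd_carrier by auto
  have "a = \<zero>" if a: "a \<in> carrier R" "s \<otimes> t \<otimes> a = \<zero>" for a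
  proof -
    have "s \<otimes> (t \<otimes> a) = \<zero>" using a c by (simp add: m_assoc)
    then have "t \<otimes> a = \<zero>" using nzd_cancel[OF assms(1)] a c by blast
    then show ?thesis using nzd_cancel[OF assms(2)] a by blast
  qed
  then show ?thesis using c by (simp add: nonzerodivisors_def)
qed

lemma nzd_one: "\<one> \<in> nonzerodivisors R" by (auto simp: nonzerodivisors_def)

lemma nzd_pow: "t \<in> nonzerodivisors R \<Longrightarrow> t [^] (n::nat) \<in> nonzerodivisors R"
  by (induct n) (auto simp: nzd_one nzd_mult)

lemma nzd_divisor:
  assumes "s \<otimes> t \<in> nonzerodivisors R" "s \<in> carrier R" "t \<in> carrier R"
  shows "s \<in> nonzerodivisors R"
proof -
  have "a = \<zero>" if "a \<in> carrier R" "s \<otimes> a = \<zero>" for a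
  proof (rule nzd_cancel[OF assms(1) that(1)])
    have "s \<otimes> t \<otimes> a = t \<otimes> (s \<otimes> a)" using assms that(1) by algebra
    then show "s \<otimes> t \<otimes> a = \<zero>" using that assms by simp
  qed
  then show ?thesis using assms(2) by (simp add: nonzerodivisors_def)
qed

end

section \<open>Nonzerodivisors and finite quotients\<close>

text \<open>Finiteness of R/K is expressed by representatives, so that counting arguments become
  injections between finite sets built from ring elements and no quotient ring has to be
  formed.\<close>

definition finite_cover :: "('a, 'b) ring_scheme \<Rightarrow> 'a set \<Rightarrow> bool" where
  "finite_cover R K \<longleftrightarrow> (\<exists>F. finite F \<and> F \<subseteq> carrier R \<and> (\<forall>a\<in>carrier R. \<exists>f\<in>F. a \<ominus>\<^bsub>R\<^esub> f \<in> K))"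

definition transversal :: "('a, 'b) ring_scheme \<Rightarrow> 'a set \<Rightarrow> 'a set \<Rightarrow> bool" where
  "transversal R K E \<longleftrightarrow> finite E \<and> E \<subseteq> carrier R \<and> (\<forall>a\<in>carrier R. \<exists>e\<in>E. a \<ominus>\<^bsub>R\<^esub> e \<in> K) \<and>
     (\<forall>e\<in>E. \<forall>e'\<in>E. e \<ominus>\<^bsub>R\<^esub> e' \<in> K \<longrightarrow> e = e')"

lemma transversalI:
  assumes "finite E" "E \<subseteq> carrier R" "\<And>a. a \<in> carrier R \<Longrightarrow> \<exists>e\<in>E. a \<ominus>\<^bsub>R\<^esub> e \<in> K"
    "\<And>e e'. e \<in> E \<Longrightarrow> e' \<in> E \<Longrightarrow> e \<ominus>\<^bsub>R\<^esub> e' \<in> K \<Longrightarrow> e = e'"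
  shows "transversal R K E"
  using assms unfolding transversal_def by blast

lemma transversalD:
  assumes "transversal R K E"
  shows "finite E" "E \<subseteq> carrier R" "\<And>a. a \<in> carrier R \<Longrightarrow> \<exists>e\<in>E. a \<ominus>\<^bsub>R\<^esub> e \<in> K"
    "\<And>e e'. e \<in> E \<Longrightarrow> e' \<in> E \<Longrightarrow> e \<ominus>\<^bsub>R\<^esub> e' \<in> K \<Longrightarrow> e = e'"
  using assms unfolding transversal_def by simp_all

text \<open>Dimension one is split into two conditions: no chain of three primes, and
  \<open>m\<close> nonzero, which for a reduced local ring says that it is not a field. Finiteness
  of the residue field enters as a cover; its exact size enters later through a transversal of
  \<open>m\<close>.\<close>

locale reduced_local_ring = cring R for R (structure) +
  fixes m :: "'a set"
  assumes noeth: "noetherian_ring R"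
    and max_m: "maximalideal m R"
    and local: "\<And>m'. maximalideal m' R \<Longrightarrow> m' = m"
    and reduced: "\<And>x. x \<in> carrier R \<Longrightarrow> x \<otimes> x = \<zero> \<Longrightarrow> x = \<zero>"
    and no_chain: "\<not> prime_chain R (Suc 1)"
    and m_nonzero: "m \<noteq> {\<zero>}"
    and residue_cover: "finite_cover R m"
begin

lemma ideal_m: "ideal m R" using max_m by (rule maximalideal.axioms(1))

lemma m_carrier: "x \<in> m \<Longrightarrow> x \<in> carrier R" using ideal_m ideal_carrier by blast

lemma one_notin_m: "\<one> \<notin> m" using max_m maximalideal_one_notin by blast

lemma one_not_zero: "\<one> \<noteq> \<zero>"
  using one_notin_m ideal_zero_closed[OF ideal_m] by metis

lemma not_in_m_Unit:
  assumes "x \<in> carrier R" "x \<notin> m"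
  shows "x \<in> Units R"
proof (rule ccontr)
  assume n: "x \<notin> Units R"
  have "\<one> \<notin> PIdl x"
  proof
    assume "\<one> \<in> PIdl x"
    then obtain y where "y \<in> carrier R" "\<one> = y \<otimes> x" by (auto simp: cgenideal_def)
    then have "x \<in> Units R" using assms(1) unfolding Units_def by (metis (mono_tags, lifting) m_comm mem_Collect_eq)
    with n show False by simp
  qed
  then obtain M where "maximalideal M R" "PIdl x \<subseteq> M"
    using exists_maximalideal_superset cgenideal_ideal assms(1) by metis
  then show False using local assms cgenideal_self by blast
qed

lemma one_minus_m_Unit:
  assumes "x \<in> m" shows "\<one> \<ominus> x \<in> Units R"
proof (rule not_in_m_Unit)
  have x: "x \<in> carrier R" using assms m_carrier by simp
  show "\<one> \<ominus> x \<in> carrier R" using x by simp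
  show "\<one> \<ominus> x \<notin> m"
  proof
    assume "\<one> \<ominus> x \<in> m"
    then have "(\<one> \<ominus> x) \<oplus> x \<in> m" using assms ideal_m ideal_add_closed by simp
    moreover have "(\<one> \<ominus> x) \<oplus> x = \<one>" using x by algebra
    ultimately show False using one_notin_m by simp
  qed
qed

text \<open>\<open>H\<close> is enlarged to an ideal \<open>H'\<close> maximal among those not
  containing \<open>K\<close>. For \<open>x\<close> in \<open>K\<close> outside \<open>H'\<close>,
  maximality gives K \<subseteq> H' + (x), and the hypothesis becomes x = h + \<mu> x with
  \<open>h\<close> in \<open>H'\<close> and \<open>\<mu>\<close> in \<open>m\<close>. As 1 - \<mu>
  is a unit, \<open>x\<close> would lie in \<open>H'\<close>.\<close>

lemma nakayama:
  assumes K: "ideal K R" and H: "ideal H R" and sub: "K \<subseteq> H <+>\<^bsub>R\<^esub> (m \<cdot> K)"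
  shows "K \<subseteq> H"
proof (rule ccontr)
  assume n: "\<not> K \<subseteq> H"
  let ?C = "{I. ideal I R \<and> H \<subseteq> I \<and> \<not> K \<subseteq> I}"
  obtain H' where H': "H' \<in> ?C" and mx: "\<And>I. I \<in> ?C \<Longrightarrow> H' \<subseteq> I \<Longrightarrow> I = H'"
    by (rule noetherian_ring.ideal_maximal_element[OF noeth, of ?C]) (use n H in auto)
  have id: "ideal H' R" "H \<subseteq> H'" using H' by auto
  obtain x where x: "x \<in> K" "x \<notin> H'" using H' by auto
  have xc: "x \<in> carrier R" using x K ideal_carrier by blast
  let ?I = "H' <+>\<^bsub>R\<^esub> PIdl x"
  have idI: "ideal ?I R" using id xc by (simp add: add_ideals cgenideal_ideal)
  have up: "H' \<subseteq> ?I" "PIdl x \<subseteq> ?I"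
    using ideal_add_upper1 ideal_add_upper2 id xc cgenideal_ideal by auto
  have "x \<in> ?I" using up cgenideal_self xc by blast
  then have "?I \<noteq> H'" using x by auto
  then have KI: "K \<subseteq> ?I" using mx[of ?I] idI up id(2) by blast
  let ?B = "H' <+>\<^bsub>R\<^esub> (m \<cdot> (PIdl x))"
  have mx_id: "ideal (m \<cdot> (PIdl x)) R" using ideal_m xc by (simp add: ideal_prod_is_ideal cgenideal_ideal)
  have idB: "ideal ?B R" using id mx_id by (simp add: add_ideals)
  have "m \<cdot> K \<subseteq> ?B"
  proof -
    have "m \<cdot> K \<subseteq> m \<cdot> ?I" using KI by (simp add: ideal_prod_mono)
    also have "\<dots> = m \<cdot> H' <+>\<^bsub>R\<^esub> (m \<cdot> (PIdl x))"
      using ideal_m id xc by (simp add: ideal_prod_distr cgenideal_ideal)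
    also have "\<dots> \<subseteq> ?B"
    proof (rule ideal_add_least[OF idB])
      have "m \<cdot> H' \<subseteq> H'" using ideal_prod_inter[OF ideal_m id(1)] by simp
      then show "m \<cdot> H' \<subseteq> ?B" using ideal_add_upper1[OF id(1) mx_id] by simp
      show "m \<cdot> (PIdl x) \<subseteq> ?B" using ideal_add_upper2[OF id(1) mx_id] by simp
    qed
    finally show ?thesis .
  qed
  moreover have "H \<subseteq> ?B" using id ideal_add_upper1[OF id(1) mx_id] by simp
  ultimately have "H <+>\<^bsub>R\<^esub> (m \<cdot> K) \<subseteq> ?B" by (intro ideal_add_least[OF idB])
  then have "x \<in> ?B" using sub x by blast
  then obtain h w where hw: "h \<in> H'" "w \<in> m \<cdot> (PIdl x)" "x = h \<oplus> w" by (elim ideal_addE)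
  have "m \<cdot> (PIdl x) \<subseteq> {\<mu> \<otimes> x |\<mu>. \<mu> \<in> m}"
  proof
    fix s assume "s \<in> m \<cdot> (PIdl x)"
    then show "s \<in> {\<mu> \<otimes> x |\<mu>. \<mu> \<in> m}"
    proof (induct s rule: ideal_prod.induct)
      case (prod i j)
      then obtain r where r: "r \<in> carrier R" "j = r \<otimes> x" by (auto simp: cgenideal_def)
      then have "i \<otimes> j = (i \<otimes> r) \<otimes> x" using prod m_carrier xc by (simp add: m_assoc)
      moreover have "i \<otimes> r \<in> m" using prod r ideal_m by (simp add: ideal.I_r_closed)
      ultimately show ?case by blast
    next
      case (sum s1 s2)
      then obtain u v where uv: "u \<in> m" "v \<in> m" "s1 = u \<otimes> x" "s2 = v \<otimes> x" by blast
      then have "s1 \<oplus> s2 = (u \<oplus> v) \<otimes> x" using m_carrier xc by (simp add: l_distr)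
      moreover have "u \<oplus> v \<in> m" using uv ideal_m ideal_add_closed by blast
      ultimately show ?case by blast
    qed
  qed
  then obtain \<mu> where mu: "\<mu> \<in> m" "w = \<mu> \<otimes> x" using hw by blast
  have muc: "\<mu> \<in> carrier R" and hc: "h \<in> carrier R" using mu m_carrier hw id ideal_carrier by blast+
  have "(\<one> \<ominus> \<mu>) \<otimes> x = x \<ominus> \<mu> \<otimes> x" using muc xc by algebra
  also have "\<dots> = (h \<oplus> \<mu> \<otimes> x) \<ominus> \<mu> \<otimes> x" using hw(3) mu(2) by simp
  also have "\<dots> = h" using muc xc hc by algebra
  finally have eq: "(\<one> \<ominus> \<mu>) \<otimes> x = h" .
  have U: "\<one> \<ominus> \<mu> \<in> Units R" using one_minus_m_Unit mu by simp
  then have "inv (\<one> \<ominus> \<mu>) \<otimes> h = x"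
    using eq xc muc by (metis Units_closed Units_inv_closed Units_l_inv l_one m_assoc)
  moreover have "inv (\<one> \<ominus> \<mu>) \<otimes> h \<in> H'" using hw(1) id(1) U by (simp add: ideal.I_l_closed)
  ultimately show False using x(2) by simp
qed

definition ann :: "'a set \<Rightarrow> 'a set" where
  "ann V = {x \<in> carrier R. \<forall>v\<in>V. x \<otimes> v = \<zero>}"

lemma ann_ideal:
  assumes "V \<subseteq> carrier R" shows "ideal (ann V) R"
proof (rule idealI[OF ring_axioms])
  show "subgroup (ann V) (add_monoid R)"
  proof (rule add.subgroupI)
    have "\<zero> \<in> ann V" using assms by (auto simp: ann_def)
    then show "ann V \<noteq> {}" by blast
  qed (use assms in \<open>auto simp: ann_def l_distr l_minus\<close>)
  show "x \<otimes> a \<in> ann V" "a \<otimes> x \<in> ann V" if "a \<in> ann V" "x \<in> carrier R" for a x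
    using that assms by (auto simp: ann_def m_assoc m_comm[of a x])
qed

text \<open>Choose \<open>a\<close> with \<open>ann (ann a)\<close> maximal; a nonzero \<open>b\<close> in \<open>I\<close> killed by \<open>a\<close> would make
  \<open>ann (ann (a + b))\<close> larger.\<close>

lemma exists_nonzerodivisor:
  assumes I: "ideal I R" and ann0: "\<And>x. x \<in> carrier R \<Longrightarrow> (\<And>i. i \<in> I \<Longrightarrow> x \<otimes> i = \<zero>) \<Longrightarrow> x = \<zero>"
  shows "\<exists>a\<in>I. a \<in> nonzerodivisors R"
proof -
  have Ic: "i \<in> carrier R" if "i \<in> I" for i using that I ideal_carrier by blast
  have ac: "ann V \<subseteq> carrier R" for V by (auto simp: ann_def)
  let ?C = "{ann (ann {a}) |a. a \<in> I}"
  obtain K where K: "K \<in> ?C" and mx: "\<And>J. J \<in> ?C \<Longrightarrow> K \<subseteq> J \<Longrightarrow> J = K"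
  proof (rule noetherian_ring.ideal_maximal_element[OF noeth, of ?C])
    show "?C \<noteq> {}" using ideal_zero_closed[OF I] by blast
    show "ideal J R" if "J \<in> ?C" for J using that ann_ideal[OF ac] by blast
  qed auto
  then obtain a where a: "a \<in> I" "K = ann (ann {a})" by blast
  have "a \<in> nonzerodivisors R"
  proof (rule ccontr)
    assume "a \<notin> nonzerodivisors R"
    then obtain c where c: "c \<in> carrier R" "a \<otimes> c = \<zero>" "c \<noteq> \<zero>"
      using Ic[OF a(1)] by (auto simp: nonzerodivisors_def)
    then obtain i where i: "i \<in> I" "c \<otimes> i \<noteq> \<zero>" using ann0[of c] by blast
    define b where "b = c \<otimes> i"
    have b: "b \<in> I" "b \<noteq> \<zero>" using i c I by (auto simp: b_def ideal.I_l_closed)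
    note car = Ic[OF a(1)] Ic[OF b(1)] Ic[OF i(1)] c(1)
    have ab: "a \<otimes> b = \<zero>" unfolding b_def using car c(2) by (simp add: m_assoc[symmetric])
    \<comment> \<open>Because a b = 0, multiplying x (a + b) = 0 by x a leaves the square of x a,
      which reducedness makes zero; the same works for x b.\<close>
    have annab: "ann {a \<oplus> b} \<subseteq> ann {a} \<inter> ann {b}"
    proof
      fix x assume "x \<in> ann {a \<oplus> b}"
      then have x: "x \<in> carrier R" "x \<otimes> (a \<oplus> b) = \<zero>" by (auto simp: ann_def)
      have "(x \<otimes> a) \<otimes> (x \<otimes> a) = x \<otimes> a \<otimes> (x \<otimes> (a \<oplus> b)) \<ominus> x \<otimes> x \<otimes> (a \<otimes> b)" using x(1) car by algebra
      also have "\<dots> = \<zero>" using x ab car by (simp add: a_minus_def)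
      finally have 1: "x \<otimes> a = \<zero>" by (rule reduced[rotated]) (simp add: x car)
      have "(x \<otimes> b) \<otimes> (x \<otimes> b) = x \<otimes> b \<otimes> (x \<otimes> (a \<oplus> b)) \<ominus> x \<otimes> x \<otimes> (a \<otimes> b)" using x(1) car by algebra
      also have "\<dots> = \<zero>" using x ab car by (simp add: a_minus_def)
      finally have 2: "x \<otimes> b = \<zero>" by (rule reduced[rotated]) (simp add: x car)
      show "x \<in> ann {a} \<inter> ann {b}" using 1 2 x by (auto simp: ann_def)
    qed
    have "ann (ann {a \<oplus> b}) \<in> ?C" using a b I ideal_add_closed by blast
    moreover have "K \<subseteq> ann (ann {a \<oplus> b})" using annab a(2) by (auto simp: ann_def)
    ultimately have eq: "ann (ann {a \<oplus> b}) = K" using mx by blast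
    \<comment> \<open>By maximality \<open>b\<close> lies in \<open>ann (ann {a})\<close>, and it
      lies in \<open>ann {a}\<close> since a b = 0. Hence \<open>b\<close> kills itself.\<close>
    have "b \<in> ann (ann {a \<oplus> b})"
      using annab car by (auto simp: ann_def m_comm[of b])
    then have "b \<in> ann (ann {a})" using eq a(2) by simp
    moreover have "b \<in> ann {a}" using ab car by (simp add: ann_def m_comm)
    ultimately have "b \<otimes> b = \<zero>" by (auto simp: ann_def)
    then show False using reduced b car by blast
  qed
  then show ?thesis using a(1) by blast
qed

text \<open>An element killing \<open>m\<close> is either a unit, which would make \<open>m\<close>
  zero, or lies in \<open>m\<close> and then has square zero.\<close>

lemma m_has_nonzerodivisor: "\<exists>t\<in>m. t \<in> nonzerodivisors R"
proof (rule exists_nonzerodivisor[OF ideal_m])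
  fix x assume x: "x \<in> carrier R" "\<And>i. i \<in> m \<Longrightarrow> x \<otimes> i = \<zero>"
  have "x \<in> m"
  proof (rule ccontr)
    assume "x \<notin> m"
    then have U: "x \<in> Units R" using not_in_m_Unit x by simp
    have "i = \<zero>" if "i \<in> m" for i
    proof -
      have ic: "i \<in> carrier R" using that m_carrier by simp
      have "inv x \<otimes> (x \<otimes> i) = i" using U ic x(1) by (simp add: m_assoc[symmetric])
      then show ?thesis using x(2)[OF that] U by simp
    qed
    then show False using m_nonzero ideal_zero_closed[OF ideal_m] by blast
  qed
  then show "x = \<zero>" using x reduced by blast
qed

text \<open>An element killing \<open>I\<close> and \<open>ann I\<close> belongs to
  \<open>ann I\<close>, so it kills itself and is zero. This completes an arbitrary ideal to one
  containing a nonzerodivisor.\<close>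

lemma add_ann_has_nonzerodivisor:
  assumes I: "ideal I R" shows "\<exists>a\<in>I <+>\<^bsub>R\<^esub> ann I. a \<in> nonzerodivisors R"
proof (rule exists_nonzerodivisor)
  have Ic: "I \<subseteq> carrier R" using I ideal_carrier by blast
  show "ideal (I <+>\<^bsub>R\<^esub> ann I) R" using I ann_ideal[OF Ic] add_ideals by blast
  fix x assume x: "x \<in> carrier R" "\<And>i. i \<in> I <+>\<^bsub>R\<^esub> ann I \<Longrightarrow> x \<otimes> i = \<zero>"
  have "x \<in> ann I" using x ideal_add_upper1[OF I ann_ideal[OF Ic]] by (auto simp: ann_def)
  then have "x \<otimes> x = \<zero>" using x ideal_add_upper2[OF I ann_ideal[OF Ic]] by blast
  then show "x = \<zero>" using reduced x by blast
qed

text \<open>An ideal maximal among those avoiding the multiplicative set \<open>{t\<^sup>i y | y \<notin> P}\<close> is a prime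
  strictly below \<open>P\<close>.\<close>

lemma prime_containing_nzd:
  assumes P: "primeideal P R" and t: "t \<in> P" "t \<in> nonzerodivisors R"
  shows "P = m"
proof (rule ccontr)
  assume nm: "P \<noteq> m"
  have idP: "ideal P R" using P primeideal.axioms(1) by blast
  have oneP: "\<one> \<notin> P" using P idP ideal.one_imp_carrier primeideal.I_notcarr by blast
  define S where "S = {t [^] i \<otimes> y |(i::nat) y. y \<in> carrier R \<and> y \<notin> P}"
  note tc = nzd_carrier[OF t(2)]
  have S0: "\<zero> \<notin> S"
  proof
    assume "\<zero> \<in> S"
    then obtain i :: nat and y where iy: "\<zero> = t [^] i \<otimes> y" "y \<in> carrier R" "y \<notin> P" by (auto simp: S_def)
    then have "y = \<zero>" using nzd_cancel[OF nzd_pow[OF t(2)]] by metis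
    then show False using iy ideal_zero_closed[OF idP] by simp
  qed
  have Smult: "u \<otimes> v \<in> S" if uv: "u \<in> S" "v \<in> S" for u v
  proof -
    obtain i y j z where h: "u = t [^] (i::nat) \<otimes> y" "y \<in> carrier R" "y \<notin> P"
      "v = t [^] (j::nat) \<otimes> z" "z \<in> carrier R" "z \<notin> P" using uv unfolding S_def by blast
    have "u \<otimes> v = t [^] (i + j) \<otimes> (y \<otimes> z)"
      using h tc by (simp add: nat_pow_mult[symmetric]) (simp add: m_ac)
    moreover have "y \<otimes> z \<notin> P" using primeideal.I_prime[OF P] h by blast
    ultimately show ?thesis using h unfolding S_def by blast
  qed
  have S1: "y \<in> S" if "y \<in> carrier R" "y \<notin> P" for y
  proof -
    have "y = t [^] (0::nat) \<otimes> y" using that by simp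
    then show ?thesis using that unfolding S_def by blast
  qed
  have tS: "t \<in> S"
  proof -
    have "t = t [^] (1::nat) \<otimes> \<one>" using tc by simp
    then show ?thesis using oneP unfolding S_def by blast
  qed
  let ?C = "{I. ideal I R \<and> I \<inter> S = {}}"
  obtain P0 where P0: "P0 \<in> ?C" and mx: "\<And>I. I \<in> ?C \<Longrightarrow> P0 \<subseteq> I \<Longrightarrow> I = P0"
    by (rule noetherian_ring.ideal_maximal_element[OF noeth, of ?C]) (use S0 zeroideal in auto)
  have id0: "ideal P0 R" and dis: "P0 \<inter> S = {}" using P0 by auto
  have meet: "\<exists>p r. p \<in> P0 \<and> r \<in> carrier R \<and> p \<oplus> r \<otimes> x \<in> S" if x: "x \<in> carrier R" "x \<notin> P0" for x
  proof -
    let ?I = "P0 <+>\<^bsub>R\<^esub> PIdl x"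
    have "ideal ?I R" using id0 x by (simp add: add_ideals cgenideal_ideal)
    moreover have up: "P0 \<subseteq> ?I" "PIdl x \<subseteq> ?I"
      using ideal_add_upper1 ideal_add_upper2 id0 x(1) cgenideal_ideal by auto
    moreover have "x \<in> ?I" using up cgenideal_self x by blast
    ultimately have "?I \<inter> S \<noteq> {}" using mx[of ?I] x by auto
    then obtain s where "s \<in> ?I" "s \<in> S" by blast
    then show ?thesis by (elim ideal_addE) (auto simp: cgenideal_def)
  qed
  have "primeideal P0 R"
  proof (rule primeidealI[OF id0 is_cring])
    show "carrier R \<noteq> P0" using tS tc dis by auto
    fix x y assume xy: "x \<in> carrier R" "y \<in> carrier R" "x \<otimes> y \<in> P0"
    show "x \<in> P0 \<or> y \<in> P0"
    proof (rule ccontr)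
      assume "\<not> (x \<in> P0 \<or> y \<in> P0)"
      then obtain p r p' r' where h: "p \<in> P0" "r \<in> carrier R" "p \<oplus> r \<otimes> x \<in> S"
        "p' \<in> P0" "r' \<in> carrier R" "p' \<oplus> r' \<otimes> y \<in> S" using meet xy by metis
      have c: "p \<in> carrier R" "p' \<in> carrier R" using h id0 ideal_carrier by blast+
      have "(p \<oplus> r \<otimes> x) \<otimes> (p' \<oplus> r' \<otimes> y) = p \<otimes> (p' \<oplus> r' \<otimes> y) \<oplus> ((r \<otimes> x) \<otimes> p' \<oplus> (r \<otimes> r') \<otimes> (x \<otimes> y))"
        using c h(2,5) xy(1,2) by algebra
      moreover have "\<dots> \<in> P0"
        using h xy c id0 by (intro ideal_add_closed[OF id0]) (auto simp: ideal.I_l_closed ideal.I_r_closed)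
      ultimately show False using Smult[OF h(3,6)] dis by auto
    qed
  qed
  \<comment> \<open>Elements outside \<open>P\<close> lie in \<open>S\<close> with exponent zero, so
    \<open>P0\<close> is contained in \<open>P\<close>; it misses \<open>t\<close>, which lies in
    both \<open>P\<close> and \<open>S\<close>.\<close>
  moreover have "P0 \<subset> P"
  proof -
    have "P0 \<subseteq> P" using S1 dis ideal_carrier[OF id0] by blast
    then show ?thesis using t(1) tS dis by blast
  qed
  moreover have "P \<subset> m"
  proof -
    obtain M where "maximalideal M R" "P \<subseteq> M" using exists_maximalideal_superset idP oneP by metis
    then show ?thesis using local nm by blast
  qed
  moreover have "primeideal m R" using max_m maximalideal_prime by blast
  ultimately have "prime_chain R (Suc 1)"
    using P unfolding prime_chain_def
    by (intro exI[of _ "\<lambda>i. if i = 0 then P0 else if i = 1 then P else m"]) (auto simp: less_Suc_eq)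
  then show False using no_chain by simp
qed

text \<open>Noetherian induction: an ideal maximal among the counterexamples containing
  \<open>t\<close> is prime. A prime containing a nonzerodivisor is \<open>m\<close>, whose residue
  field is finite.\<close>

lemma finite_cover_of_nzd:
  assumes K: "ideal K R" and t: "t \<in> K" "t \<in> nonzerodivisors R"
  shows "finite_cover R K"
proof (rule ccontr)
  assume n: "\<not> finite_cover R K"
  let ?C = "{I. ideal I R \<and> t \<in> I \<and> \<not> finite_cover R I}"
  obtain H where H: "H \<in> ?C" and mx: "\<And>I. I \<in> ?C \<Longrightarrow> H \<subseteq> I \<Longrightarrow> I = H"
    by (rule noetherian_ring.ideal_maximal_element[OF noeth, of ?C]) (use n K t in auto)
  have idH: "ideal H R" and tH: "t \<in> H" and nH: "\<not> finite_cover R H" using H by auto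
  have up: "finite_cover R (H <+>\<^bsub>R\<^esub> PIdl x)" if x: "x \<in> carrier R" "x \<notin> H" for x
  proof (rule ccontr)
    let ?I = "H <+>\<^bsub>R\<^esub> PIdl x"
    assume nc: "\<not> finite_cover R ?I"
    have "ideal ?I R" using idH x by (simp add: add_ideals cgenideal_ideal)
    moreover have up: "H \<subseteq> ?I" "PIdl x \<subseteq> ?I"
      using ideal_add_upper1 ideal_add_upper2 idH x(1) cgenideal_ideal by auto
    moreover have "x \<in> ?I" using up cgenideal_self x by blast
    ultimately show False using mx[of ?I] x tH nc by auto
  qed
  have "primeideal H R"
  proof (rule primeidealI[OF idH is_cring])
    show "carrier R \<noteq> H"
    proof
      assume "carrier R = H"
      then have "finite_cover R H"
        unfolding finite_cover_def by (intro exI[of _ "{\<zero>}"]) auto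
      then show False using nH by simp
    qed
    fix x y assume xy: "x \<in> carrier R" "y \<in> carrier R" "x \<otimes> y \<in> H"
    show "x \<in> H \<or> y \<in> H"
    proof (rule ccontr)
      assume "\<not> (x \<in> H \<or> y \<in> H)"
      then have "finite_cover R (H <+>\<^bsub>R\<^esub> PIdl x)" "finite_cover R (H <+>\<^bsub>R\<^esub> PIdl y)" using up xy by auto
      then obtain F1 F2 where F: "finite F1" "F1 \<subseteq> carrier R" "\<And>a. a \<in> carrier R \<Longrightarrow> \<exists>f\<in>F1. a \<ominus> f \<in> H <+>\<^bsub>R\<^esub> PIdl x"
        "finite F2" "F2 \<subseteq> carrier R" "\<And>a. a \<in> carrier R \<Longrightarrow> \<exists>f\<in>F2. a \<ominus> f \<in> H <+>\<^bsub>R\<^esub> PIdl y"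
        unfolding finite_cover_def by metis
      \<comment> \<open>Write a = f + r x modulo \<open>H\<close>. Since x y lies in
        \<open>H\<close>, only the class of \<open>r\<close> modulo H + (y) matters, and
        \<open>r\<close> may be replaced by its representative \<open>g\<close>.\<close>
      let ?F = "(\<lambda>(f, g). f \<oplus> x \<otimes> g) ` (F1 \<times> F2)"
      have "\<exists>f\<in>?F. a \<ominus> f \<in> H" if a: "a \<in> carrier R" for a
      proof -
        obtain f h r where f: "f \<in> F1" "h \<in> H" "r \<in> carrier R" "a \<ominus> f = h \<oplus> r \<otimes> x"
          using F(3)[OF a] by (auto elim!: ideal_addE simp: cgenideal_def)
        obtain g h' r' where g: "g \<in> F2" "h' \<in> H" "r' \<in> carrier R" "r \<ominus> g = h' \<oplus> r' \<otimes> y"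
          using F(6)[OF f(3)] by (auto elim!: ideal_addE simp: cgenideal_def)
        have c: "f \<in> carrier R" "g \<in> carrier R" "h \<in> carrier R" "h' \<in> carrier R"
          using f g F idH ideal_carrier by blast+
        have "a \<ominus> (f \<oplus> x \<otimes> g) = (a \<ominus> f) \<ominus> r \<otimes> x \<oplus> x \<otimes> (r \<ominus> g)" using a c f(3) xy(1) by algebra
        also have "\<dots> = h \<oplus> x \<otimes> (h' \<oplus> r' \<otimes> y)"
        proof -
          have "h \<oplus> r \<otimes> x \<ominus> r \<otimes> x = h" using c f(3) xy(1) by algebra
          then show ?thesis by (simp add: f(4) g(4))
        qed
        also have "\<dots> = h \<oplus> (x \<otimes> h' \<oplus> r' \<otimes> (x \<otimes> y))" using c g(3) xy(1,2) by algebra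
        also have "\<dots> \<in> H"
          using f g xy c idH by (intro ideal_add_closed[OF idH]) (auto simp: ideal.I_l_closed)
        finally show ?thesis using f(1) g(1) by auto
      qed
      moreover have "finite ?F" "?F \<subseteq> carrier R" using F(1,2,4,5) xy(1) by auto
      ultimately have "finite_cover R H" unfolding finite_cover_def by blast
      then show False using nH by simp
    qed
  qed
  then have "H = m" using prime_containing_nzd tH t by blast
  then show False using nH residue_cover by simp
qed

end

lemma (in cring) finite_cover_transversal:
  assumes K: "ideal K R" and "finite_cover R K"
  obtains E where "transversal R K E"
proof -
  obtain F where F: "finite F" "F \<subseteq> carrier R" "\<And>a. a \<in> carrier R \<Longrightarrow> \<exists>f\<in>F. a \<ominus> f \<in> K"
    using assms(2) unfolding finite_cover_def by metis
  \<comment> \<open>The predicate under \<open>SOME\<close> depends only on the class of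
    \<open>a\<close>, so congruent elements receive the very same representative.\<close>
  define rep where "rep a = (SOME x. x \<in> carrier R \<and> a \<ominus> x \<in> K)" for a
  have rep: "rep a \<in> carrier R \<and> a \<ominus> rep a \<in> K" if "a \<in> carrier R" for a
  proof -
    have "a \<in> carrier R \<and> a \<ominus> a \<in> K" using that ideal_zero_closed[OF K] by (simp add: a_minus_def r_neg)
    then show ?thesis unfolding rep_def by (rule someI)
  qed
  have trans: "a \<ominus> c \<in> K" if "a \<ominus> b \<in> K" "b \<ominus> c \<in> K" "a \<in> carrier R" "b \<in> carrier R" "c \<in> carrier R" for a b c
  proof -
    have "a \<ominus> c = (a \<ominus> b) \<oplus> (b \<ominus> c)" using that(3-5) by algebra
    then show ?thesis using ideal_add_closed[OF K that(1,2)] by simp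
  qed
  have sym: "b \<ominus> a \<in> K" if "a \<ominus> b \<in> K" "a \<in> carrier R" "b \<in> carrier R" for a b
  proof -
    have "b \<ominus> a = \<ominus> (a \<ominus> b)" using that(2,3) by algebra
    then show ?thesis using K that(1) by (simp add: additive_subgroup.a_inv_closed ideal.axioms(1))
  qed
  have rep_eq: "rep a = rep b" if ab: "a \<ominus> b \<in> K" "a \<in> carrier R" "b \<in> carrier R" for a b
  proof -
    have "(x \<in> carrier R \<and> a \<ominus> x \<in> K) = (x \<in> carrier R \<and> b \<ominus> x \<in> K)" for x
      using trans[of a b x] trans[of b a x] sym[of a b] ab by blast
    then show ?thesis unfolding rep_def by presburger
  qed
  show thesis
  proof (rule that[of "rep ` F"], rule transversalI)
    show "finite (rep ` F)" "rep ` F \<subseteq> carrier R" using F rep by auto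
    show "\<exists>e\<in>rep ` F. a \<ominus> e \<in> K" if a: "a \<in> carrier R" for a
    proof -
      obtain f where "f \<in> F" "a \<ominus> f \<in> K" using F(3) a by blast
      then show ?thesis using rep_eq[of a f] rep[OF a] F(2) a by (metis image_eqI subsetD)
    qed
    show "e = e'" if h: "e \<in> rep ` F" "e' \<in> rep ` F" "e \<ominus> e' \<in> K" for e e'
    proof -
      obtain f f' where f: "f \<in> F" "f' \<in> F" "e = rep f" "e' = rep f'" using h by blast
      then have c: "f \<in> carrier R" "f' \<in> carrier R" using F by auto
      have "f \<ominus> rep f' \<in> K" using trans[of f "rep f" "rep f'"] rep c f h(3) by auto
      then have "f \<ominus> f' \<in> K" using trans[of f "rep f'" f'] sym[of f' "rep f'"] rep c by auto
      then show ?thesis using rep_eq c f by simp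
    qed
  qed
qed

context reduced_local_ring
begin

text \<open>\<open>|K / t K| = |R / t R|\<close> because \<open>|R / t K| = |R / K| |K / t K| = |R / t R| |t R / t K|\<close>;
  the proof injects transversals instead of computing indices.\<close>

lemma nzd_pigeonhole:
  assumes t: "t \<in> nonzerodivisors R"
  obtains D :: nat where "\<And>K f. ideal K R \<Longrightarrow> (\<exists>s\<in>K. s \<in> nonzerodivisors R) \<Longrightarrow> (\<And>i. i \<le> D \<Longrightarrow> f i \<in> K) \<Longrightarrow>
    \<exists>i j k. i < j \<and> j \<le> D \<and> k \<in> K \<and> f i \<ominus> f j = t \<otimes> k"
proof -
  note tc = nzd_carrier[OF t]
  have "finite_cover R (PIdl t)"
    using finite_cover_of_nzd[OF cgenideal_ideal[OF tc] cgenideal_self[OF tc] t] .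
  then obtain F where F: "finite F" "F \<subseteq> carrier R" "\<And>a. a \<in> carrier R \<Longrightarrow> \<exists>f\<in>F. a \<ominus> f \<in> PIdl t"
    unfolding finite_cover_def by metis
  show thesis
  proof (rule that[of "card F"])
    fix K :: "'a set" and f assume K: "ideal K R" and s: "\<exists>s\<in>K. s \<in> nonzerodivisors R"
      and f: "\<And>i. i \<le> card F \<Longrightarrow> f i \<in> K"
    have Kc: "x \<in> carrier R" if "x \<in> K" for x using that K ideal_carrier by blast
    obtain E where tE: "transversal R K E"
      using finite_cover_transversal[OF K] finite_cover_of_nzd[OF K] s by blast
    have E: "finite E" "E \<noteq> {}" "E \<subseteq> carrier R" "\<And>a. a \<in> carrier R \<Longrightarrow> \<exists>e\<in>E. a \<ominus> e \<in> K"
      "\<And>e e'. e \<in> E \<Longrightarrow> e' \<in> E \<Longrightarrow> e \<ominus> e' \<in> K \<Longrightarrow> e = e'"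
      using transversalD[OF tE] zero_closed by blast+
    \<comment> \<open>Every ring element is x + t (e + k) with \<open>x\<close> in \<open>F\<close>,
      \<open>e\<close> in \<open>E\<close> and \<open>k\<close> in \<open>K\<close>. The pair
      \<open>(x, e)\<close> determines its class modulo t K, so there are at most |F| |E|
      classes.\<close>
    have "\<exists>g. g \<in> F \<times> E \<and> (\<exists>k\<in>K. a = fst g \<oplus> t \<otimes> (snd g \<oplus> k))" if a: "a \<in> carrier R" for a
    proof -
      obtain x r where x: "x \<in> F" "r \<in> carrier R" "a \<ominus> x = r \<otimes> t" using F(3)[OF a] by (auto simp: cgenideal_def)
      obtain e where e: "e \<in> E" "r \<ominus> e \<in> K" using E(4) x by blast
      have c: "x \<in> carrier R" "e \<in> carrier R" using x e F E by auto
      have "a = x \<oplus> (a \<ominus> x)" using a c by algebra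
      also have "\<dots> = x \<oplus> r \<otimes> t" by (simp add: x)
      also have "\<dots> = x \<oplus> t \<otimes> (e \<oplus> (r \<ominus> e))" using c x(2) tc by algebra
      finally show ?thesis using x e by (intro exI[of _ "(x, e)"]) auto
    qed
    then obtain g where g: "\<And>a. a \<in> carrier R \<Longrightarrow> g a \<in> F \<times> E"
      "\<And>a. a \<in> carrier R \<Longrightarrow> \<exists>k\<in>K. a = fst (g a) \<oplus> t \<otimes> (snd (g a) \<oplus> k)" by metis
    let ?h = "\<lambda>(e, i). g (e \<oplus> f i)"
    have hc: "e \<oplus> f i \<in> carrier R" if "e \<in> E" "i \<le> card F" for e i using that E f Kc by auto
    \<comment> \<open>There are |E| (|F| + 1) pairs \<open>(e, i)\<close> but only |F| |E| values.
      In a collision e - e' lies in \<open>K\<close>, which forces \<open>e = e'\<close>; so the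
      collision is between two of the \<open>f i\<close>.\<close>
    have "\<not> inj_on ?h (E \<times> {..card F})"
    proof
      assume "inj_on ?h (E \<times> {..card F})"
      moreover have "?h p \<in> F \<times> E" if "p \<in> E \<times> {..card F}" for p
        using that g(1)[OF hc[of "fst p" "snd p"]] by (cases p) simp
      then have "?h ` (E \<times> {..card F}) \<subseteq> F \<times> E" by blast
      ultimately have "card (E \<times> {..card F}) \<le> card (F \<times> E)" using F E by (intro card_inj_on_le) auto
      then have "card E * Suc (card F) \<le> card F * card E" by (simp add: card_cartesian_product)
      then show False using E by (simp add: mult.commute card_gt_0_iff)
    qed
    then obtain e i e' i' where h: "e \<in> E" "i \<le> card F" "e' \<in> E" "i' \<le> card F" "(e, i) \<noteq> (e', i')"
      "g (e \<oplus> f i) = g (e' \<oplus> f i')" unfolding inj_on_def by auto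
    obtain k k' where k: "k \<in> K" "e \<oplus> f i = fst (g (e \<oplus> f i)) \<oplus> t \<otimes> (snd (g (e \<oplus> f i)) \<oplus> k)"
      "k' \<in> K" "e' \<oplus> f i' = fst (g (e \<oplus> f i)) \<oplus> t \<otimes> (snd (g (e \<oplus> f i)) \<oplus> k')"
      using g(2)[OF hc] h by metis
    obtain x y where xy: "g (e \<oplus> f i) = (x, y)" by fastforce
    have c: "x \<in> carrier R" "y \<in> carrier R" "k \<in> carrier R" "k' \<in> carrier R"
      "e \<in> carrier R" "e' \<in> carrier R" "f i \<in> carrier R" "f i' \<in> carrier R"
      using g(1)[OF hc[OF h(1,2)]] xy subsetD[OF F(2)] subsetD[OF E(3)] h(1-4) k(1,3) Kc f by simp_all
    have "(e \<oplus> f i) \<ominus> (e' \<oplus> f i') = (x \<oplus> t \<otimes> (y \<oplus> k)) \<ominus> (x \<oplus> t \<otimes> (y \<oplus> k'))" using k xy by simp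
    also have "\<dots> = t \<otimes> (k \<ominus> k')" using c tc by algebra
    finally have eq: "(e \<oplus> f i) \<ominus> (e' \<oplus> f i') = t \<otimes> (k \<ominus> k')" .
    have kk: "k \<ominus> k' \<in> K" using k K ideal_diff_closed by blast
    have "e \<ominus> e' = ((e \<oplus> f i) \<ominus> (e' \<oplus> f i')) \<oplus> (f i' \<ominus> f i)" using c by algebra
    also have "\<dots> = t \<otimes> (k \<ominus> k') \<oplus> (f i' \<ominus> f i)" by (simp add: eq)
    also have "\<dots> \<in> K" using kk tc K f h ideal_diff_closed[OF K] by (intro ideal_add_closed[OF K]) (auto simp: ideal.I_l_closed)
    finally have ee: "e = e'" using E(5) h by blast
    then have ii: "i \<noteq> i'" using h by simp
    have "f i \<ominus> f i' = (e \<oplus> f i) \<ominus> (e \<oplus> f i')" using c by algebra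
    also have "\<dots> = t \<otimes> (k \<ominus> k')" using eq ee by simp
    finally have d: "f i \<ominus> f i' = t \<otimes> (k \<ominus> k')" .
    have "f i' \<ominus> f i = \<ominus> (f i \<ominus> f i')" using c by algebra
    also have "\<dots> = \<ominus> (t \<otimes> (k \<ominus> k'))" by (simp add: d)
    also have "\<dots> = t \<otimes> (k' \<ominus> k)" using c tc by algebra
    finally have d': "f i' \<ominus> f i = t \<otimes> (k' \<ominus> k)" .
    have kk': "k' \<ominus> k \<in> K" using k K ideal_diff_closed by blast
    show "\<exists>i j k. i < j \<and> j \<le> card F \<and> k \<in> K \<and> f i \<ominus> f j = t \<otimes> k"
      using d d' kk kk' h(2,4) ii by (metis nat_neq_iff)
  qed
qed

end

section \<open>Principal reductions of powers\<close>

context reduced_local_ring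
begin

lemma m_pow_ideal: "ideal I R \<Longrightarrow> ideal (m \<cdot> ideal_pow R I d) R"
  by (simp add: ideal_prod_is_ideal ideal_m ideal_pow_ideal)

lemma m_pow_mult:
  assumes I: "ideal I R" and "v \<in> m \<cdot> ideal_pow R I d" "u \<in> ideal_pow R I e" "k = d + e"
  shows "v \<otimes> u \<in> m \<cdot> ideal_pow R I k"
proof -
  have "v \<otimes> u \<in> (m \<cdot> ideal_pow R I d) \<cdot> ideal_pow R I e" using assms by (simp add: ideal_prod.prod)
  also have "\<dots> = m \<cdot> ideal_pow R I k"
    by (simp add: assms(4) ideal_pow_add[OF I] ideal_prod_assoc ideal_m ideal_pow_ideal[OF I])
  finally show ?thesis .
qed

text \<open>Powers are well defined in the fiber cone, the graded ring with components I^d / m I^d.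
  That ring is never built: elements of I^d with explicit degrees stand for its forms.\<close>

lemma pow_cong_m_pow:
  assumes I: "ideal I R" and x: "x \<in> ideal_pow R I d" and y: "y \<in> ideal_pow R I d"
    and xy: "x \<ominus> y \<in> m \<cdot> ideal_pow R I d"
  shows "x [^] k \<ominus> y [^] k \<in> m \<cdot> ideal_pow R I (d * k)"
proof (induct k)
  case 0
  show ?case using ideal_zero_closed[OF m_pow_ideal[OF I, of 0]] by (simp add: a_minus_def r_neg)
next
  case (Suc k)
  have c: "x \<in> carrier R" "y \<in> carrier R" "x [^] k \<in> carrier R" "y [^] k \<in> carrier R"
    using x y ideal_pow_carrier[OF I] by auto
  have "x [^] Suc k \<ominus> y [^] Suc k = x [^] k \<otimes> x \<ominus> y [^] k \<otimes> y" by simp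
  also have "\<dots> = (x [^] k \<ominus> y [^] k) \<otimes> x \<oplus> (x \<ominus> y) \<otimes> y [^] k"
    using c by algebra
  also have "\<dots> \<in> m \<cdot> ideal_pow R I (d * Suc k)"
  proof (rule ideal_add_closed[OF m_pow_ideal[OF I]])
    show "(x [^] k \<ominus> y [^] k) \<otimes> x \<in> m \<cdot> ideal_pow R I (d * Suc k)"
      by (rule m_pow_mult[OF I Suc x]) simp
    show "(x \<ominus> y) \<otimes> y [^] k \<in> m \<cdot> ideal_pow R I (d * Suc k)"
      by (rule m_pow_mult[OF I xy ideal_pow_nat_pow_mem[OF I y refl]]) simp
  qed
  finally show ?case .
qed

text \<open>In the fiber cone of \<open>I\<close>: some power of the degree-\<open>l\<close> form \<open>c\<close> is a multiple of
  the degree-\<open>g\<close> form \<open>L\<close>.\<close>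

definition dominated :: "'a set \<Rightarrow> 'a \<Rightarrow> nat \<Rightarrow> 'a \<Rightarrow> nat \<Rightarrow> bool" where
  "dominated I L g c l \<longleftrightarrow> (\<exists>n u v. n > 0 \<and> g \<le> l * n \<and> u \<in> ideal_pow R I (l * n - g) \<and>
     v \<in> m \<cdot> ideal_pow R I (l * n) \<and> c [^] n = L \<otimes> u \<oplus> v)"

text \<open>Raise the relation for \<open>b\<close> to the \<open>k\<close>-th power and substitute
  the relation for L^k. The congruence modulo \<open>m\<close> survives by
  \<open>pow_cong_m_pow\<close>; the rest is bookkeeping of degrees.\<close>

lemma dominated_trans:
  assumes I: "ideal I R" and b: "b \<in> ideal_pow R I l" and L: "L \<in> ideal_pow R I g" and L': "L' \<in> carrier R"
    and d1: "dominated I L g b l" and d2: "dominated I L' g' L g"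
  shows "dominated I L' g' b l"
proof -
  obtain n u v where n: "n > 0" "g \<le> l * n" "u \<in> ideal_pow R I (l * n - g)"
    "v \<in> m \<cdot> ideal_pow R I (l * n)" "b [^] n = L \<otimes> u \<oplus> v" using d1 unfolding dominated_def by blast
  obtain k u' v' where k: "k > 0" "g' \<le> g * k" "u' \<in> ideal_pow R I (g * k - g')"
    "v' \<in> m \<cdot> ideal_pow R I (g * k)" "L [^] k = L' \<otimes> u' \<oplus> v'" using d2 unfolding dominated_def by blast
  note car = ideal_pow_carrier[OF I] ideal_carrier[OF m_pow_ideal[OF I]]
  have c: "b \<in> carrier R" "L \<in> carrier R" "u \<in> carrier R" "v \<in> carrier R" "u' \<in> carrier R" "v' \<in> carrier R"
    using b L n k car by blast+
  have Lu: "L \<otimes> u \<in> ideal_pow R I (l * n)"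
    by (rule ideal_pow_mult_mem[OF I L n(3)]) (use n in simp)
  have "L \<otimes> u \<oplus> v \<ominus> L \<otimes> u = v" using c by algebra
  then have "b [^] n \<ominus> L \<otimes> u \<in> m \<cdot> ideal_pow R I (l * n)" using n by simp
  then have w: "(b [^] n) [^] k \<ominus> (L \<otimes> u) [^] k \<in> m \<cdot> ideal_pow R I (l * n * k)"
    by (rule pow_cong_m_pow[OF I ideal_pow_nat_pow_mem[OF I b refl] Lu])
  define w where "w = (b [^] n) [^] k \<ominus> (L \<otimes> u) [^] k"
  have wc: "w \<in> carrier R" using w car w_def by blast
  have uk: "u [^] k \<in> ideal_pow R I ((l * n - g) * k)" by (rule ideal_pow_nat_pow_mem[OF I n(3) refl])
  have ukc: "u [^] k \<in> carrier R" using c by simp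
  have gk: "g * k \<le> l * n * k" using n by simp
  have "b [^] (n * k) = (b [^] n) [^] k" using c by (simp add: nat_pow_pow)
  also have "\<dots> = (L \<otimes> u) [^] k \<oplus> w"
  proof -
    have "p = q \<oplus> (p \<ominus> q)" if "p \<in> carrier R" "q \<in> carrier R" for p q using that by algebra
    then show ?thesis using c by (simp add: w_def)
  qed
  also have "(L \<otimes> u) [^] k = L [^] k \<otimes> u [^] k" using c by (simp add: nat_pow_distrib)
  also have "\<dots> = (L' \<otimes> u' \<oplus> v') \<otimes> u [^] k" by (simp add: k)
  also have "(L' \<otimes> u' \<oplus> v') \<otimes> u [^] k \<oplus> w = L' \<otimes> (u' \<otimes> u [^] k) \<oplus> (v' \<otimes> u [^] k \<oplus> w)"
    using c wc ukc L' by algebra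
  finally have eq: "b [^] (n * k) = L' \<otimes> (u' \<otimes> u [^] k) \<oplus> (v' \<otimes> u [^] k \<oplus> w)" .
  show ?thesis unfolding dominated_def
  proof (intro exI conjI)
    show "0 < n * k" using n k by simp
    show "g' \<le> l * (n * k)" using order_trans[OF k(2) gk] by (simp only: mult.assoc)
    show "u' \<otimes> u [^] k \<in> ideal_pow R I (l * (n * k) - g')"
      by (rule ideal_pow_mult_mem[OF I k(3) uk]) (use gk k(2) in \<open>simp add: diff_mult_distrib mult.assoc\<close>)
    show "v' \<otimes> u [^] k \<oplus> w \<in> m \<cdot> ideal_pow R I (l * (n * k))"
    proof (rule ideal_add_closed[OF m_pow_ideal[OF I]])
      show "v' \<otimes> u [^] k \<in> m \<cdot> ideal_pow R I (l * (n * k))"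
        by (rule m_pow_mult[OF I k(4) uk]) (use gk in \<open>simp add: diff_mult_distrib mult.assoc\<close>)
      show "w \<in> m \<cdot> ideal_pow R I (l * (n * k))" using w by (simp add: w_def mult.assoc)
    qed
    show "b [^] (n * k) = L' \<otimes> (u' \<otimes> u [^] k) \<oplus> (v' \<otimes> u [^] k \<oplus> w)" by (rule eq)
  qed
qed

text \<open>The norm form \<open>Y\<^sup>2 - YZ + Z\<^sup>2\<close> does not vanish where \<open>Y = 0\<close>, \<open>Z = 0\<close> or \<open>Y = Z\<close>,
  and the relation \<open>rel\<close> confines the fiber cone to these three loci.\<close>

lemma norm_form_dominates:
  assumes I: "ideal I R" and Y: "Y \<in> ideal_pow R I d" and Z: "Z \<in> ideal_pow R I d"
    and rel: "Y [^] p \<otimes> Z [^] p \<otimes> (Y \<ominus> Z) \<in> m \<cdot> ideal_pow R I (d * (2 * p + 1))"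
  shows "\<exists>u v. u \<in> ideal_pow R I (d * (3 * p + 2) - 2 * d) \<and> v \<in> m \<cdot> ideal_pow R I (d * (3 * p + 2)) \<and>
    Y [^] (3 * p + 2) = (Y \<otimes> Y \<ominus> Y \<otimes> Z \<oplus> Z \<otimes> Z) \<otimes> u \<oplus> v"
proof -
  note car = ideal_pow_carrier[OF I] ideal_carrier[OF m_pow_ideal[OF I]]
  have c: "Y \<in> carrier R" "Z \<in> carrier R" using Y Z car by blast+
  define L where "L = Y \<otimes> Y \<ominus> Y \<otimes> Z \<oplus> Z \<otimes> Z"
  \<comment> \<open>With P = L + W, each power of P = Y^2 is a multiple of \<open>L\<close> up to
    the same power of \<open>W\<close>, and the cofactor is a form of the expected degree.\<close>
  define P where "P = Y \<otimes> Y"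
  define W where "W = Z \<otimes> (Y \<ominus> Z)"
  have Lc: "L \<in> carrier R" "P \<in> carrier R" "W \<in> carrier R" using c by (auto simp: L_def P_def W_def)
  have PW: "P = L \<oplus> W" unfolding L_def P_def W_def using c by algebra
  have Pm: "P \<in> ideal_pow R I (2 * d)" unfolding P_def by (rule ideal_pow_mult_mem[OF I Y Y]) simp
  have YZm: "Y \<ominus> Z \<in> ideal_pow R I d" using ideal_diff_closed[OF ideal_pow_ideal[OF I] Y Z] .
  have Wm: "W \<in> ideal_pow R I (2 * d)" unfolding W_def
    by (rule ideal_pow_mult_mem[OF I Z YZm]) simp
  have "\<exists>u\<in>ideal_pow R I (2 * d * n). P [^] Suc n = L \<otimes> u \<oplus> W [^] Suc n" for n
  proof (induct n)
    case 0
    show ?case using Lc PW by (intro bexI[of _ \<one>]) auto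
  next
    case (Suc n)
    then obtain u where u: "u \<in> ideal_pow R I (2 * d * n)" "P [^] Suc n = L \<otimes> u \<oplus> W [^] Suc n" by blast
    have uc: "u \<in> carrier R" "W [^] Suc n \<in> carrier R" using u car Lc by auto
    have "P [^] Suc (Suc n) = (L \<otimes> u \<oplus> W [^] Suc n) \<otimes> P"
      by (subst nat_pow_Suc) (simp only: u)
    also have "\<dots> = L \<otimes> u \<otimes> P \<oplus> W [^] Suc n \<otimes> (L \<oplus> W)" unfolding PW[symmetric] using uc Lc by algebra
    also have "\<dots> = L \<otimes> (u \<otimes> P \<oplus> W [^] Suc n) \<oplus> W [^] Suc n \<otimes> W" using uc Lc by algebra
    finally have "P [^] Suc (Suc n) = L \<otimes> (u \<otimes> P \<oplus> W [^] Suc n) \<oplus> W [^] Suc (Suc n)"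
      by (subst (2) nat_pow_Suc)
    moreover have "u \<otimes> P \<oplus> W [^] Suc n \<in> ideal_pow R I (2 * d * Suc n)"
    proof (rule ideal_add_closed[OF ideal_pow_ideal[OF I]])
      show "u \<otimes> P \<in> ideal_pow R I (2 * d * Suc n)" by (rule ideal_pow_mult_mem[OF I u(1) Pm]) simp
      show "W [^] Suc n \<in> ideal_pow R I (2 * d * Suc n)" by (rule ideal_pow_nat_pow_mem[OF I Wm refl])
    qed
    ultimately show ?case by blast
  qed
  then obtain u where u: "u \<in> ideal_pow R I (2 * d * p)" "P [^] Suc p = L \<otimes> u \<oplus> W [^] Suc p" by blast
  have uc: "u \<in> carrier R" using u car by blast
  \<comment> \<open>The exponent is 3p + 2 = 2(p + 1) + p. The first part gives P^(p+1); the
    remaining Y^p meets W^(p+1) = Z^(p+1) (Y - Z)^(p+1) and completes the product \<open>T\<close>,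
    which vanishes in the fiber cone by \<open>rel\<close>.\<close>
  define T where "T = Y [^] p \<otimes> Z [^] p \<otimes> (Y \<ominus> Z)"
  define w where "w = Z \<otimes> (Y \<ominus> Z) [^] p"
  have wm: "w \<in> ideal_pow R I (d * (p + 1))" unfolding w_def
    by (rule ideal_pow_mult_mem[OF I Z ideal_pow_nat_pow_mem[OF I YZm refl]]) simp
  have "Y [^] (3 * p + 2) = Y [^] (Suc p + Suc p + p)" by (simp add: algebra_simps numeral_3_eq_3)
  also have "\<dots> = Y [^] Suc p \<otimes> Y [^] Suc p \<otimes> Y [^] p" using c by (simp only: nat_pow_mult)
  also have "\<dots> = P [^] Suc p \<otimes> Y [^] p" unfolding P_def using c by (simp only: nat_pow_distrib)
  also have "\<dots> = (L \<otimes> u \<oplus> W [^] Suc p) \<otimes> Y [^] p" by (simp only: u(2))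
  also have "\<dots> = L \<otimes> (u \<otimes> Y [^] p) \<oplus> W [^] Suc p \<otimes> Y [^] p" using c uc Lc by (simp add: l_distr m_assoc)
  also have "W [^] Suc p \<otimes> Y [^] p = T \<otimes> w"
    unfolding W_def T_def w_def using c by (simp add: nat_pow_distrib m_ac)
  finally have "Y [^] (3 * p + 2) = L \<otimes> (u \<otimes> Y [^] p) \<oplus> T \<otimes> w" .
  moreover have "u \<otimes> Y [^] p \<in> ideal_pow R I (d * (3 * p + 2) - 2 * d)"
    by (rule ideal_pow_mult_mem[OF I u(1) ideal_pow_nat_pow_mem[OF I Y refl]]) (simp add: algebra_simps)
  moreover have "T \<otimes> w \<in> m \<cdot> ideal_pow R I (d * (3 * p + 2))"
    by (rule m_pow_mult[OF I rel[folded T_def] wm]) (simp add: algebra_simps)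
  ultimately show ?thesis unfolding L_def by blast
qed

text \<open>Since \<open>I\<^sup>n / t I\<^sup>n\<close> has at most \<open>|R / t R|\<close> elements for every \<open>n\<close>, two distinct monomials
  of large degree in \<open>y\<close> and \<open>z\<close> agree modulo \<open>m\<close>.\<close>

lemma two_forms_dominated:
  assumes I: "ideal I R" and s: "s \<in> I" "s \<in> nonzerodivisors R"
    and y: "y \<in> ideal_pow R I l" and z: "z \<in> ideal_pow R I l"
  shows "\<exists>e>0. let Y = y [^] (e::nat); Z = z [^] e; L = Y \<otimes> Y \<ominus> Y \<otimes> Z \<oplus> Z \<otimes> Z in
    dominated I L (2 * (l * e)) y l \<and> dominated I L (2 * (l * e)) z l"
proof -
  note car = ideal_pow_carrier[OF I] ideal_carrier[OF m_pow_ideal[OF I]]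
  have c: "y \<in> carrier R" "z \<in> carrier R" using y z car by blast+
  obtain t where t: "t \<in> m" "t \<in> nonzerodivisors R" using m_has_nonzerodivisor by blast
  obtain D :: nat where D: "\<And>K f. ideal K R \<Longrightarrow> (\<exists>s\<in>K. s \<in> nonzerodivisors R) \<Longrightarrow> (\<And>i. i \<le> D \<Longrightarrow> f i \<in> K) \<Longrightarrow>
    \<exists>i j k. i < j \<and> j \<le> D \<and> k \<in> K \<and> f i \<ominus> f j = t \<otimes> k" using nzd_pigeonhole[OF t(2)] by metis
  \<comment> \<open>The \<open>D + 1\<close> monomials of degree \<open>D\<close> in
    \<open>y\<close> and \<open>z\<close>, as many as the pigeonhole bound asks for.\<close>
  define f where "f i = y [^] (D - i) \<otimes> z [^] i" for i
  have "\<exists>i j k. i < j \<and> j \<le> D \<and> k \<in> ideal_pow R I (l * D) \<and> f i \<ominus> f j = t \<otimes> k"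
  proof (rule D[OF ideal_pow_ideal[OF I]])
    show "\<exists>s\<in>ideal_pow R I (l * D). s \<in> nonzerodivisors R"
      using ideal_pow_nat_pow_mem1[OF I s(1)] nzd_pow[OF s(2)] by blast
    fix i assume "i \<le> D"
    then show "f i \<in> ideal_pow R I (l * D)" unfolding f_def
      by (intro ideal_pow_mult_mem[OF I ideal_pow_nat_pow_mem[OF I y refl] ideal_pow_nat_pow_mem[OF I z refl]])
        (metis add_mult_distrib2 le_add_diff_inverse2)
  qed
  then obtain i j k where ij: "i < j" "j \<le> D" and k: "k \<in> ideal_pow R I (l * D)" "f i \<ominus> f j = t \<otimes> k" by blast
  have kc: "k \<in> carrier R" using k car by blast
  \<comment> \<open>The two colliding monomials share the factor y^(D-j) z^i; what remains of them
    is y^e and z^e.\<close>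
  define e where "e = j - i"
  have e: "e > 0" "j = i + e" using ij by (auto simp: e_def)
  define Y where "Y = y [^] e"
  define Z where "Z = z [^] e"
  have Yc: "Y \<in> carrier R" "Z \<in> carrier R" using c by (auto simp: Y_def Z_def)
  have eD: "e * D \<ge> D" using e by simp
  have le: "D - j \<le> e * D" "i \<le> e * D" using eD ij by linarith+
  \<comment> \<open>\<open>M\<close> fills the shared factor up to Y^D Z^D, which is possible since
    e \<ge> 1. The relation is then antisymmetric in \<open>Y\<close> and \<open>Z\<close>, so
    \<open>norm_form_dominates\<close> applies in both orders.\<close>
  define M where "M = y [^] (e * D - (D - j)) \<otimes> z [^] (e * D - i)"
  have Mm: "M \<in> ideal_pow R I (l * (e * D - (D - j)) + l * (e * D - i))" unfolding M_def
    by (intro ideal_pow_mult_mem[OF I ideal_pow_nat_pow_mem[OF I y refl] ideal_pow_nat_pow_mem[OF I z refl]]) simp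
  have Mc: "M \<in> carrier R" using Mm car by blast
  have fi: "f i = y [^] (D - j) \<otimes> z [^] i \<otimes> Y"
  proof -
    have "y [^] (D - i) = y [^] (D - j) \<otimes> y [^] e"
      using c ij e by (simp add: nat_pow_mult)
    then show ?thesis unfolding f_def Y_def using c by (simp add: m_ac)
  qed
  have fj: "f j = y [^] (D - j) \<otimes> z [^] i \<otimes> Z"
    unfolding f_def Z_def using c by (simp add: e(2) nat_pow_mult[symmetric] m_assoc)
  have rel: "Y [^] D \<otimes> Z [^] D \<otimes> (Y \<ominus> Z) = t \<otimes> k \<otimes> M"
  proof -
    define N where "N = y [^] (D - j) \<otimes> z [^] i"
    have Nc: "N \<in> carrier R" using c by (simp add: N_def)
    have "Y [^] D = y [^] (e * D - (D - j)) \<otimes> y [^] (D - j)"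
      unfolding Y_def using c le by (simp add: nat_pow_pow nat_pow_mult)
    moreover have "Z [^] D = z [^] (e * D - i) \<otimes> z [^] i"
      unfolding Z_def using c le by (simp add: nat_pow_pow nat_pow_mult)
    ultimately have "Y [^] D \<otimes> Z [^] D = M \<otimes> N" unfolding M_def N_def using c by (simp add: m_ac)
    then have "Y [^] D \<otimes> Z [^] D \<otimes> (Y \<ominus> Z) = M \<otimes> N \<otimes> (Y \<ominus> Z)" by simp
    also have "\<dots> = M \<otimes> (N \<otimes> Y \<ominus> N \<otimes> Z)" using Mc Nc Yc by algebra
    also have "N \<otimes> Y \<ominus> N \<otimes> Z = t \<otimes> k" using k fi fj by (simp add: N_def)
    finally show ?thesis using Mc kc m_carrier[OF t(1)] by (simp add: m_comm)
  qed
  define d where "d = l * e"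
  have Ym: "Y \<in> ideal_pow R I d" "Z \<in> ideal_pow R I d"
    unfolding Y_def Z_def d_def using ideal_pow_nat_pow_mem[OF I] y z by blast+
  have relm: "Y [^] D \<otimes> Z [^] D \<otimes> (Y \<ominus> Z) \<in> m \<cdot> ideal_pow R I (d * (2 * D + 1))"
    unfolding rel
  proof (rule m_pow_mult[OF I _ Mm])
    show "t \<otimes> k \<in> m \<cdot> ideal_pow R I (l * D)" using t k by (simp add: ideal_prod.prod)
    have "e * D - (D - j) + (e * D - i) + D = e * (2 * D + 1)" using le ij e(2) eD by (simp add: algebra_simps)
    then have "l * (e * D - (D - j) + (e * D - i) + D) = d * (2 * D + 1)" by (simp only: d_def mult.assoc)
    then show "d * (2 * D + 1) = l * D + (l * (e * D - (D - j)) + l * (e * D - i))"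
      by (simp add: distrib_left)
  qed
  have relm': "Z [^] D \<otimes> Y [^] D \<otimes> (Z \<ominus> Y) \<in> m \<cdot> ideal_pow R I (d * (2 * D + 1))"
  proof -
    have "Z [^] D \<otimes> Y [^] D \<otimes> (Z \<ominus> Y) = \<ominus> (Y [^] D \<otimes> Z [^] D \<otimes> (Y \<ominus> Z))"
    proof -
      have "Y [^] D \<in> carrier R" "Z [^] D \<in> carrier R" using Yc by auto
      then show ?thesis using Yc by algebra
    qed
    then show ?thesis using relm m_pow_ideal[OF I]
      by (metis additive_subgroup.a_inv_closed ideal.axioms(1))
  qed
  define L where "L = Y \<otimes> Y \<ominus> Y \<otimes> Z \<oplus> Z \<otimes> Z"
  have Lsym: "Z \<otimes> Z \<ominus> Z \<otimes> Y \<oplus> Y \<otimes> Y = L" unfolding L_def using Yc by algebra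
  define n where "n = e * (3 * D + 2)"
  have ar: "l * n = d * (3 * D + 2)" by (simp only: n_def d_def mult.assoc)
  have n: "n > 0" "2 * d \<le> l * n" using e by (auto simp: n_def d_def)
  have "dominated I L (2 * d) y l"
  proof -
    obtain u v where uv: "u \<in> ideal_pow R I (d * (3 * D + 2) - 2 * d)" "v \<in> m \<cdot> ideal_pow R I (d * (3 * D + 2))"
      "Y [^] (3 * D + 2) = L \<otimes> u \<oplus> v"
      using norm_form_dominates[OF I Ym relm] unfolding L_def by blast
    have "y [^] n = L \<otimes> u \<oplus> v" using uv(3) c by (simp only: Y_def nat_pow_pow n_def)
    then show ?thesis unfolding dominated_def using uv(1,2) n unfolding ar[symmetric] by blast
  qed
  moreover have "dominated I L (2 * d) z l"
  proof -
    obtain u v where uv: "u \<in> ideal_pow R I (d * (3 * D + 2) - 2 * d)" "v \<in> m \<cdot> ideal_pow R I (d * (3 * D + 2))"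
      "Z [^] (3 * D + 2) = L \<otimes> u \<oplus> v"
      using norm_form_dominates[OF I Ym(2,1) relm'] unfolding Lsym by blast
    have "z [^] n = L \<otimes> u \<oplus> v" using uv(3) c by (simp only: Z_def nat_pow_pow n_def)
    then show ?thesis unfolding dominated_def using uv(1,2) n unfolding ar[symmetric] by blast
  qed
  ultimately show ?thesis
    using e(1) unfolding L_def Y_def Z_def d_def Let_def by blast
qed

text \<open>Generators are absorbed one at a time: the norm form of powers of equal degree of the
  current form and of the new generator dominates both, and domination is transitive.
  \<open>L\<close> is kept in a power of \<open>Idl S\<close> and not merely of \<open>I\<close>;
  this makes it usable when \<open>S\<close> generates a subideal whose reduction property is in
  question.\<close>

lemma dominating_form:
  assumes I: "ideal I R" and s: "s \<in> I" "s \<in> nonzerodivisors R" and S: "finite S" "S \<subseteq> I"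
  shows "\<exists>g>0. \<exists>L\<in>ideal_pow R (Idl S) g. \<forall>b\<in>S. dominated I L g b 1"
  using S
proof (induct S rule: finite_induct)
  case empty
  \<comment> \<open>Nothing has to be dominated yet; the zero form is placed in degree 1 because
    \<open>g\<close> must be positive.\<close>
  have "\<zero> \<in> ideal_pow R (Idl {}) 1" by (intro ideal_zero_closed ideal_pow_ideal genideal_ideal) simp
  then show ?case by (intro exI[of _ 1]) auto
next
  case (insert a S)
  then obtain g L where g: "g > 0" and L: "L \<in> ideal_pow R (Idl S) g" and dom: "\<And>b. b \<in> S \<Longrightarrow> dominated I L g b 1"
    by auto
  let ?K = "Idl (insert a S)"
  have sub: "insert a S \<subseteq> carrier R" using insert.prems ideal_carrier[OF I] by blast
  have K: "ideal ?K R" using sub by (rule genideal_ideal)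
  have KI: "?K \<subseteq> I" using genideal_minimal[OF I insert.prems] .
  have KS: "insert a S \<subseteq> ?K" using genideal_self[OF sub] .
  have SK: "Idl S \<subseteq> ?K" using KS by (intro genideal_minimal[OF K]) simp
  have LK: "L \<in> ideal_pow R ?K g" using L ideal_pow_mono[OF SK] by blast
  \<comment> \<open>a^g has the same degree as \<open>L\<close>, as
    \<open>two_forms_dominated\<close> requires.\<close>
  have aK: "a [^] g \<in> ideal_pow R ?K g" using KS by (intro ideal_pow_nat_pow_mem1[OF K]) simp
  have LI: "L \<in> ideal_pow R I g" "a [^] g \<in> ideal_pow R I g" using LK aK ideal_pow_mono[OF KI] by blast+
  have ac: "a \<in> carrier R" using sub by simp
  obtain e :: nat where e: "e > 0" and
    D: "let Y = L [^] e; Z = (a [^] g) [^] e; L' = Y \<otimes> Y \<ominus> Y \<otimes> Z \<oplus> Z \<otimes> Z in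
    dominated I L' (2 * (g * e)) L g \<and> dominated I L' (2 * (g * e)) (a [^] g) g"
    using two_forms_dominated[OF I s LI] by blast
  define Y where "Y = L [^] e"
  define Z where "Z = (a [^] g) [^] e"
  define L' where "L' = Y \<otimes> Y \<ominus> Y \<otimes> Z \<oplus> Z \<otimes> Z"
  have D1: "dominated I L' (2 * (g * e)) L g" and D2: "dominated I L' (2 * (g * e)) (a [^] g) g"
    using D unfolding Let_def L'_def Y_def Z_def by auto
  have YK: "Y \<in> ideal_pow R ?K (g * e)" "Z \<in> ideal_pow R ?K (g * e)"
    unfolding Y_def Z_def using ideal_pow_nat_pow_mem[OF K] LK aK by blast+
  have L'K: "L' \<in> ideal_pow R ?K (2 * (g * e))"
  proof -
    have "Y \<otimes> Y \<in> ideal_pow R ?K (2 * (g * e))" "Y \<otimes> Z \<in> ideal_pow R ?K (2 * (g * e))"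
      "Z \<otimes> Z \<in> ideal_pow R ?K (2 * (g * e))"
      by (rule ideal_pow_mult_mem[OF K YK(1) YK(1)], simp, rule ideal_pow_mult_mem[OF K YK(1) YK(2)], simp,
          rule ideal_pow_mult_mem[OF K YK(2) YK(2)], simp)
    then show ?thesis unfolding L'_def
      using ideal_pow_ideal[OF K] ideal_add_closed ideal_diff_closed by blast
  qed
  have L'c: "L' \<in> carrier R" using L'K ideal_pow_carrier[OF K] by blast
  have "dominated I L' (2 * (g * e)) b 1" if "b \<in> insert a S" for b
  proof (cases "b = a")
    case True
    obtain n u v where n: "n > 0" "2 * (g * e) \<le> g * n" "u \<in> ideal_pow R I (g * n - 2 * (g * e))"
      "v \<in> m \<cdot> ideal_pow R I (g * n)" "(a [^] g) [^] n = L' \<otimes> u \<oplus> v" using D2 unfolding dominated_def by blast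
    have "a [^] (g * n) = L' \<otimes> u \<oplus> v" using n(5) ac by (simp add: nat_pow_pow)
    then show ?thesis unfolding dominated_def using n g True
      by (intro exI[of _ "g * n"] exI[of _ u] exI[of _ v]) simp
  next
    case False
    then have b: "b \<in> S" using that by simp
    then have "b \<in> ideal_pow R I 1" using insert.prems ideal_pow_one[OF I] by auto
    then show ?thesis using dominated_trans[OF I _ LI(1) L'c dom[OF b] D1] by blast
  qed
  then show ?case using L'K g e by (intro exI[of _ "2 * (g * e)"]) auto
qed

lemma PIdl_prodE:
  assumes "L \<in> carrier R" "ideal K R" "x \<in> (PIdl L) \<cdot> K"
  obtains u where "u \<in> K" "x = L \<otimes> u"
proof -
  have Kc: "a \<in> carrier R" if "a \<in> K" for a using that assms(2) ideal_carrier by blast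
  have "\<exists>u\<in>K. x = L \<otimes> u" using assms(3)
  proof (induct x rule: ideal_prod.induct)
    case (prod i j)
    then obtain r where r: "r \<in> carrier R" "i = r \<otimes> L" by (auto simp: cgenideal_def)
    then have "i \<otimes> j = L \<otimes> (r \<otimes> j)" using assms(1) Kc[OF prod(2)] by (simp add: m_ac)
    moreover have "r \<otimes> j \<in> K" using r prod assms(2) by (simp add: ideal.I_l_closed)
    ultimately show ?case by blast
  next
    case (sum s1 s2)
    then obtain u v where uv: "u \<in> K" "v \<in> K" "s1 = L \<otimes> u" "s2 = L \<otimes> v" by blast
    then have "s1 \<oplus> s2 = L \<otimes> (u \<oplus> v)" using assms(1) Kc by (simp add: r_distr)
    moreover have "u \<oplus> v \<in> K" using uv assms(2) ideal_add_closed by blast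
    ultimately show ?case by blast
  qed
  then show thesis using that by blast
qed

text \<open>A form \<open>L\<close> of degree \<open>g\<close> dominating all generators of
  \<open>I\<close> gives I^n \<subseteq> L I^(n-g) + m I^n for some \<open>n\<close>, and Nakayama
  removes the error term. \<open>L\<close> is a nonzerodivisor because it divides the nonzerodivisor
  s^n.\<close>

lemma principal_power:
  assumes I: "ideal I R" and s: "s \<in> I" "s \<in> nonzerodivisors R"
  obtains h n y where "h > 0" "h \<le> n" "y \<in> ideal_pow R I h" "y \<in> nonzerodivisors R"
    "\<And>c. c \<in> ideal_pow R I n \<Longrightarrow> \<exists>u\<in>ideal_pow R I (n - h). c = y \<otimes> u"
proof -
  obtain S where S: "S \<subseteq> carrier R" "finite S" "I = Idl S"
    using noetherian_ring.finetely_gen[OF noeth I] by blast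
  have SI: "S \<subseteq> I" using S genideal_self by simp
  obtain g L where g: "g > 0" and L: "L \<in> ideal_pow R I g" and dom: "\<And>b. b \<in> S \<Longrightarrow> dominated I L g b 1"
    using dominating_form[OF I s S(2) SI] S(3) by blast
  have Lc: "L \<in> carrier R" using L ideal_pow_carrier[OF I] by blast
  note PL = cgenideal_ideal[OF Lc]
  \<comment> \<open>The ideal of the Rees algebra generated by \<open>m\<close> in degree zero and
    by \<open>L\<close> in degree \<open>g\<close>. Below degree \<open>g\<close> only
    \<open>m\<close> contributes; the case distinction keeps the truncated subtraction
    \<open>d - g\<close> from adding spurious multiples of \<open>L\<close>.\<close>
  define G where "G d = (if d < g then m \<cdot> ideal_pow R I d else
    (PIdl L) \<cdot> ideal_pow R I (d - g) <+>\<^bsub>R\<^esub> m \<cdot> ideal_pow R I d)" for d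
  have PI: "ideal ((PIdl L) \<cdot> ideal_pow R I k) R" for k using PL ideal_pow_ideal[OF I] ideal_prod_is_ideal by blast
  have G: "ideal (G d) R" for d unfolding G_def using m_pow_ideal[OF I] PI add_ideals by auto
  have mG: "m \<cdot> ideal_pow R I d \<subseteq> G d" for d
    unfolding G_def using ideal_add_upper2[OF PI m_pow_ideal[OF I]] by simp
  have LG: "L \<otimes> u \<in> G d" if "g \<le> d" "u \<in> ideal_pow R I (d - g)" for d u
  proof -
    have "L \<otimes> u \<in> (PIdl L) \<cdot> ideal_pow R I (d - g)" using that cgenideal_self[OF Lc] by (simp add: ideal_prod.prod)
    then show ?thesis unfolding G_def using that ideal_add_upper1[OF PI m_pow_ideal[OF I]] by auto
  qed
  have IG: "a \<otimes> b \<in> G (Suc d)" if ab: "a \<in> I" "b \<in> G d" for a b d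
  proof -
    have ac: "a \<in> carrier R" using ab ideal_carrier[OF I] by blast
    have a1: "a \<in> ideal_pow R I 1" using ab ideal_pow_one[OF I] by simp
    have 1: "a \<otimes> v \<in> G (Suc d)" if v: "v \<in> m \<cdot> ideal_pow R I d" for v
    proof -
      have "v \<otimes> a \<in> m \<cdot> ideal_pow R I (Suc d)" by (rule m_pow_mult[OF I v a1]) simp
      then have "v \<otimes> a \<in> G (Suc d)" using mG by blast
      then show ?thesis using ac ideal_carrier[OF m_pow_ideal[OF I] v] by (simp add: m_comm)
    qed
    show ?thesis
    proof (cases "d < g")
      case True
      then show ?thesis using 1 ab by (simp add: G_def)
    next
      case False
      then obtain p v where pv: "p \<in> (PIdl L) \<cdot> ideal_pow R I (d - g)" "v \<in> m \<cdot> ideal_pow R I d" "b = p \<oplus> v"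
        using ab by (auto simp: G_def elim: ideal_addE)
      obtain u where u: "u \<in> ideal_pow R I (d - g)" "p = L \<otimes> u"
        using PIdl_prodE[OF Lc ideal_pow_ideal[OF I] pv(1)] by blast
      have c: "u \<in> carrier R" "v \<in> carrier R" using u pv ideal_pow_carrier[OF I] ideal_carrier[OF m_pow_ideal[OF I]] by blast+
      have "a \<otimes> u \<in> ideal_pow R I (Suc d - g)"
        by (rule ideal_pow_mult_mem[OF I a1 u(1)]) (use False in simp)
      then have "L \<otimes> (a \<otimes> u) \<in> G (Suc d)" using LG[of "Suc d"] False by simp
      moreover have "a \<otimes> b = L \<otimes> (a \<otimes> u) \<oplus> a \<otimes> v" unfolding pv(3) u(2) using c ac Lc by algebra
      ultimately show ?thesis using 1[OF pv(2)] G ideal_add_closed by metis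
    qed
  qed
  \<comment> \<open>Asking for n \<ge> g selects the branch of \<open>G\<close> in which
    \<open>L\<close> is present.\<close>
  have "\<exists>n\<ge>g. ideal_pow R (Idl S) n \<subseteq> G n"
  proof (rule Idl_pow_subset_graded[OF S(2) SI I, where G = G])
    show "ideal (G d) R" for d by (rule G)
    show "a \<otimes> b \<in> G (Suc d)" if "a \<in> I" "b \<in> G d" for a b d using that by (rule IG)
    fix a assume "a \<in> S"
    then obtain n u v where n: "g \<le> n" "u \<in> ideal_pow R I (n - g)"
      "v \<in> m \<cdot> ideal_pow R I n" "a [^] n = L \<otimes> u \<oplus> v" using dom unfolding dominated_def by (metis mult_1)
    then show "\<exists>n. a [^] n \<in> G n" using LG[OF n(1,2)] mG G ideal_add_closed by (metis subsetD)
  qed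
  then obtain n where n: "n \<ge> g" "ideal_pow R I n \<subseteq> G n" using S(3) by blast
  then have "ideal_pow R I n \<subseteq> (PIdl L) \<cdot> ideal_pow R I (n - g) <+>\<^bsub>R\<^esub> m \<cdot> ideal_pow R I n"
    by (simp add: G_def)
  then have sub: "ideal_pow R I n \<subseteq> (PIdl L) \<cdot> ideal_pow R I (n - g)"
    by (rule nakayama[OF ideal_pow_ideal[OF I] PI])
  have fin: "\<exists>u\<in>ideal_pow R I (n - g). c = L \<otimes> u" if "c \<in> ideal_pow R I n" for c
    using PIdl_prodE[OF Lc ideal_pow_ideal[OF I] subsetD[OF sub that]] by blast
  obtain u where u: "u \<in> ideal_pow R I (n - g)" "s [^] n = L \<otimes> u"
    using fin[OF ideal_pow_nat_pow_mem1[OF I s(1)]] by blast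
  have "L \<in> nonzerodivisors R"
    using nzd_divisor[of L u] nzd_pow[OF s(2), of n] u Lc ideal_pow_carrier[OF I u(1)] by simp
  then show thesis using that[OF g n(1) L _ fin] by blast
qed

end

section \<open>The total quotient ring and integrality\<close>

lemma (in cring) frac_rel_equiv: "equiv (carrier R \<times> nonzerodivisors R) (frac_rel R)"
proof (rule equivI)
  show "refl_on (carrier R \<times> nonzerodivisors R) (frac_rel R)"
    by (auto simp: refl_on_def frac_rel_def)
  show "frac_rel R \<subseteq> (carrier R \<times> nonzerodivisors R) \<times> (carrier R \<times> nonzerodivisors R)"
    by (auto simp: frac_rel_def)
  show "sym (frac_rel R)" by (auto simp: sym_def frac_rel_def)
  show "trans (frac_rel R)"
  proof (rule transI)
    fix x y z assume xy: "(x, y) \<in> frac_rel R" and yz: "(y, z) \<in> frac_rel R"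
    obtain a s b t c u where x: "x = (a, s)" "y = (b, t)" "z = (c, u)" by (metis surj_pair)
    have h: "a \<in> carrier R" "b \<in> carrier R" "c \<in> carrier R" "s \<in> nonzerodivisors R" "t \<in> nonzerodivisors R"
      "u \<in> nonzerodivisors R" "a \<otimes> t = b \<otimes> s" "b \<otimes> u = c \<otimes> t"
      using xy yz unfolding x frac_rel_def by auto
    note c = h(1-3) nzd_carrier[OF h(4)] nzd_carrier[OF h(5)] nzd_carrier[OF h(6)]
    have "t \<otimes> (a \<otimes> u \<ominus> c \<otimes> s) = (a \<otimes> t) \<otimes> u \<ominus> (c \<otimes> t) \<otimes> s" using c by algebra
    also have "\<dots> = (b \<otimes> s) \<otimes> u \<ominus> (b \<otimes> u) \<otimes> s" by (simp only: h)
    also have "\<dots> = \<zero>" using c by algebra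
    finally have "a \<otimes> u \<ominus> c \<otimes> s = \<zero>" using nzd_cancel[OF h(5)] c by simp
    then have "a \<otimes> u = c \<otimes> s" using c by simp
    then show "(x, z) \<in> frac_rel R" unfolding x frac_rel_def using h by auto
  qed
qed

locale total_quotient = cring R for R (structure)
begin

abbreviation Q where "Q \<equiv> total_quotient_ring R"
abbreviation emb where "emb \<equiv> frac_embed R"
abbreviation frac where "frac \<equiv> frac_class R"
abbreviation NZD where "NZD \<equiv> nonzerodivisors R"

lemma frac_eq_iff:
  assumes "a \<in> carrier R" "s \<in> NZD" "b \<in> carrier R" "t \<in> NZD"
  shows "frac a s = frac b t \<longleftrightarrow> a \<otimes> t = b \<otimes> s"
  unfolding frac_class_def
  by (subst eq_equiv_class_iff[OF frac_rel_equiv]) (use assms in \<open>auto simp: frac_rel_def\<close>)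

lemma frac_carrier:
  assumes "a \<in> carrier R" "s \<in> NZD" shows "frac a s \<in> carrier Q"
  using assms by (simp add: total_quotient_ring_def frac_class_def quotientI)

lemma carrier_QE:
  assumes "x \<in> carrier Q"
  obtains a s where "a \<in> carrier R" "s \<in> NZD" "x = frac a s"
  using assms by (auto simp: total_quotient_ring_def frac_class_def elim!: quotientE)

lemma frac_mem_iff:
  assumes "a \<in> carrier R" "s \<in> NZD"
  shows "(b, t) \<in> frac a s \<longleftrightarrow> b \<in> carrier R \<and> t \<in> NZD \<and> frac b t = frac a s"
proof -
  have "(b, t) \<in> frac a s \<longleftrightarrow> b \<in> carrier R \<and> t \<in> NZD \<and> a \<otimes> t = b \<otimes> s"
    using assms by (auto simp: frac_class_def frac_rel_def)
  then show ?thesis using frac_eq_iff[OF _ _ assms] assms frac_eq_iff by metis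
qed

text \<open>\<open>frac_mult\<close> is a union over all representatives of both classes, so the
  content is that all of them yield the same class.\<close>

lemma frac_mult:
  assumes "a \<in> carrier R" "s \<in> NZD" "b \<in> carrier R" "t \<in> NZD"
  shows "frac a s \<otimes>\<^bsub>Q\<^esub> frac b t = frac (a \<otimes> b) (s \<otimes> t)"
proof -
  have *: "frac (a' \<otimes> b') (s' \<otimes> t') = frac (a \<otimes> b) (s \<otimes> t)"
    if h: "(a', s') \<in> frac a s" "(b', t') \<in> frac b t" for a' s' b' t'
  proof -
    have h': "a' \<in> carrier R" "s' \<in> NZD" "b' \<in> carrier R" "t' \<in> NZD" "a' \<otimes> s = a \<otimes> s'" "b' \<otimes> t = b \<otimes> t'"
      using h frac_mem_iff frac_eq_iff assms by auto
    note c = h'(1,3) assms(1,3) nzd_carrier[OF h'(2)] nzd_carrier[OF h'(4)] nzd_carrier[OF assms(2)] nzd_carrier[OF assms(4)]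
    have "(a' \<otimes> b') \<otimes> (s \<otimes> t) = (a' \<otimes> s) \<otimes> (b' \<otimes> t)" using c by algebra
    also have "\<dots> = (a \<otimes> s') \<otimes> (b \<otimes> t')" by (simp only: h')
    also have "\<dots> = (a \<otimes> b) \<otimes> (s' \<otimes> t')" using c by algebra
    finally show ?thesis using frac_eq_iff nzd_mult h' assms by (meson m_closed)
  qed
  have self: "(a, s) \<in> frac a s" "(b, t) \<in> frac b t" using frac_mem_iff assms by auto
  have "frac_mult R (frac a s) (frac b t) = frac (a \<otimes> b) (s \<otimes> t)"
  proof (intro subset_antisym subsetI)
    fix z
    show "z \<in> frac (a \<otimes> b) (s \<otimes> t)" if "z \<in> frac_mult R (frac a s) (frac b t)"
      using that * unfolding frac_mult_def by blast
    show "z \<in> frac_mult R (frac a s) (frac b t)" if "z \<in> frac (a \<otimes> b) (s \<otimes> t)"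
      using that self unfolding frac_mult_def by blast
  qed
  then show ?thesis by (simp add: total_quotient_ring_def)
qed

lemma frac_add:
  assumes "a \<in> carrier R" "s \<in> NZD" "b \<in> carrier R" "t \<in> NZD"
  shows "frac a s \<oplus>\<^bsub>Q\<^esub> frac b t = frac (a \<otimes> t \<oplus> b \<otimes> s) (s \<otimes> t)"
proof -
  have *: "frac (a' \<otimes> t' \<oplus> b' \<otimes> s') (s' \<otimes> t') = frac (a \<otimes> t \<oplus> b \<otimes> s) (s \<otimes> t)"
    if h: "(a', s') \<in> frac a s" "(b', t') \<in> frac b t" for a' s' b' t'
  proof -
    have h': "a' \<in> carrier R" "s' \<in> NZD" "b' \<in> carrier R" "t' \<in> NZD" "a' \<otimes> s = a \<otimes> s'" "b' \<otimes> t = b \<otimes> t'"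
      using h frac_mem_iff frac_eq_iff assms by auto
    note n = nzd_carrier[OF h'(2)] nzd_carrier[OF h'(4)] nzd_carrier[OF assms(2)] nzd_carrier[OF assms(4)]
    note c = h'(1,3) assms(1,3) n
    have "(a' \<otimes> t' \<oplus> b' \<otimes> s') \<otimes> (s \<otimes> t) = (a' \<otimes> s) \<otimes> (t' \<otimes> t) \<oplus> (b' \<otimes> t) \<otimes> (s' \<otimes> s)" using c by algebra
    also have "\<dots> = (a \<otimes> s') \<otimes> (t' \<otimes> t) \<oplus> (b \<otimes> t') \<otimes> (s' \<otimes> s)" by (simp only: h')
    also have "\<dots> = (a \<otimes> t \<oplus> b \<otimes> s) \<otimes> (s' \<otimes> t')" using c by algebra
    finally show ?thesis using frac_eq_iff nzd_mult h' assms n by (meson m_closed a_closed)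
  qed
  have self: "(a, s) \<in> frac a s" "(b, t) \<in> frac b t" using frac_mem_iff assms by auto
  have "frac_add R (frac a s) (frac b t) = frac (a \<otimes> t \<oplus> b \<otimes> s) (s \<otimes> t)"
  proof (intro subset_antisym subsetI)
    fix z
    show "z \<in> frac (a \<otimes> t \<oplus> b \<otimes> s) (s \<otimes> t)" if "z \<in> frac_add R (frac a s) (frac b t)"
      using that * unfolding frac_add_def by blast
    show "z \<in> frac_add R (frac a s) (frac b t)" if "z \<in> frac (a \<otimes> t \<oplus> b \<otimes> s) (s \<otimes> t)"
      using that self unfolding frac_add_def by blast
  qed
  then show ?thesis by (simp add: total_quotient_ring_def)
qed

lemma frac_one: "\<one>\<^bsub>Q\<^esub> = frac \<one> \<one>" and frac_zero: "\<zero>\<^bsub>Q\<^esub> = frac \<zero> \<one>"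
  by (auto simp: total_quotient_ring_def)

lemma Q_cring: "cring Q"
proof (rule cringI)
  show "abelian_group Q"
  proof (rule abelian_groupI)
    show "\<zero>\<^bsub>Q\<^esub> \<in> carrier Q" by (simp add: frac_zero frac_carrier nzd_one)
    fix x assume "x \<in> carrier Q"
    then obtain a s where x: "a \<in> carrier R" "s \<in> NZD" "x = frac a s" by (rule carrier_QE)
    note sc = nzd_carrier[OF x(2)]
    show "\<zero>\<^bsub>Q\<^esub> \<oplus>\<^bsub>Q\<^esub> x = x"
      unfolding x(3) frac_zero using x(1,2) sc by (simp add: frac_add nzd_one)
    have "frac (\<ominus> a) s \<oplus>\<^bsub>Q\<^esub> x = \<zero>\<^bsub>Q\<^esub>"
    proof -
      have "\<ominus> a \<otimes> s \<oplus> a \<otimes> s = \<zero>" using x(1) sc by algebra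
      then show ?thesis unfolding x(3) frac_zero using x(1,2) sc
        by (simp add: frac_add nzd_one frac_eq_iff nzd_mult)
    qed
    then show "\<exists>y\<in>carrier Q. y \<oplus>\<^bsub>Q\<^esub> x = \<zero>\<^bsub>Q\<^esub>" using x frac_carrier by (meson a_inv_closed)
    fix y assume "y \<in> carrier Q"
    then obtain b t where y: "b \<in> carrier R" "t \<in> NZD" "y = frac b t" by (rule carrier_QE)
    note tc = nzd_carrier[OF y(2)]
    show "x \<oplus>\<^bsub>Q\<^esub> y \<in> carrier Q" unfolding x(3) y(3) using x(1,2) y(1,2) sc tc
      by (simp add: frac_add frac_carrier nzd_mult)
    show "x \<oplus>\<^bsub>Q\<^esub> y = y \<oplus>\<^bsub>Q\<^esub> x" unfolding x(3) y(3) using x(1,2) y(1,2) sc tc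
      by (simp add: frac_add m_comm[of t s] a_comm)
    fix z assume "z \<in> carrier Q"
    then obtain c u where z: "c \<in> carrier R" "u \<in> NZD" "z = frac c u" by (rule carrier_QE)
    note uc = nzd_carrier[OF z(2)]
    have "(a \<otimes> t \<oplus> b \<otimes> s) \<otimes> u \<oplus> c \<otimes> (s \<otimes> t) = a \<otimes> (t \<otimes> u) \<oplus> (b \<otimes> u \<oplus> c \<otimes> t) \<otimes> s"
      using x(1) y(1) z(1) sc tc uc by algebra
    moreover have "s \<otimes> t \<otimes> u = s \<otimes> (t \<otimes> u)" using sc tc uc by (rule m_assoc)
    ultimately show "x \<oplus>\<^bsub>Q\<^esub> y \<oplus>\<^bsub>Q\<^esub> z = x \<oplus>\<^bsub>Q\<^esub> (y \<oplus>\<^bsub>Q\<^esub> z)" unfolding x(3) y(3) z(3) using x(1,2) y(1,2) z(1,2) sc tc uc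
      by (simp add: frac_add nzd_mult)
  qed
  show "Group.comm_monoid Q"
  proof (rule comm_monoidI)
    show "\<one>\<^bsub>Q\<^esub> \<in> carrier Q" by (simp add: frac_one frac_carrier nzd_one)
    fix x assume "x \<in> carrier Q"
    then obtain a s where x: "a \<in> carrier R" "s \<in> NZD" "x = frac a s" by (rule carrier_QE)
    note sc = nzd_carrier[OF x(2)]
    show "\<one>\<^bsub>Q\<^esub> \<otimes>\<^bsub>Q\<^esub> x = x"
      unfolding x(3) frac_one using x(1,2) sc by (simp add: frac_mult nzd_one)
    fix y assume "y \<in> carrier Q"
    then obtain b t where y: "b \<in> carrier R" "t \<in> NZD" "y = frac b t" by (rule carrier_QE)
    note tc = nzd_carrier[OF y(2)]
    show "x \<otimes>\<^bsub>Q\<^esub> y \<in> carrier Q" unfolding x(3) y(3) using x(1,2) y(1,2) sc tc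
      by (simp add: frac_mult frac_carrier nzd_mult)
    show "x \<otimes>\<^bsub>Q\<^esub> y = y \<otimes>\<^bsub>Q\<^esub> x" unfolding x(3) y(3) using x(1,2) y(1,2) sc tc
      by (simp add: frac_mult m_comm)
    fix z assume "z \<in> carrier Q"
    then obtain c u where z: "c \<in> carrier R" "u \<in> NZD" "z = frac c u" by (rule carrier_QE)
    note uc = nzd_carrier[OF z(2)]
    show "x \<otimes>\<^bsub>Q\<^esub> y \<otimes>\<^bsub>Q\<^esub> z = x \<otimes>\<^bsub>Q\<^esub> (y \<otimes>\<^bsub>Q\<^esub> z)" unfolding x(3) y(3) z(3) using x(1,2) y(1,2) z(1,2) sc tc uc
      by (simp add: frac_mult nzd_mult m_assoc)
  qed
  fix x y z assume "x \<in> carrier Q" "y \<in> carrier Q" "z \<in> carrier Q"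
  then obtain a s b t c u where h: "a \<in> carrier R" "s \<in> NZD" "x = frac a s"
    "b \<in> carrier R" "t \<in> NZD" "y = frac b t" "c \<in> carrier R" "u \<in> NZD" "z = frac c u" by (metis carrier_QE)
  note n = nzd_carrier[OF h(2)] nzd_carrier[OF h(5)] nzd_carrier[OF h(8)]
  have "((a \<otimes> t \<oplus> b \<otimes> s) \<otimes> c) \<otimes> ((s \<otimes> u) \<otimes> (t \<otimes> u)) = ((a \<otimes> c) \<otimes> (t \<otimes> u) \<oplus> (b \<otimes> c) \<otimes> (s \<otimes> u)) \<otimes> ((s \<otimes> t) \<otimes> u)"
    using h(1,4,7) n by algebra
  then show "(x \<oplus>\<^bsub>Q\<^esub> y) \<otimes>\<^bsub>Q\<^esub> z = x \<otimes>\<^bsub>Q\<^esub> z \<oplus>\<^bsub>Q\<^esub> y \<otimes>\<^bsub>Q\<^esub> z"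
    unfolding h(3,6,9) using h(1,2,4,5,7,8) n by (simp add: frac_add frac_mult nzd_mult frac_eq_iff)
qed

lemma emb_ring_hom: "emb \<in> ring_hom R Q"
  by (rule ring_hom_memI)
    (auto simp: frac_embed_def frac_carrier nzd_one frac_mult frac_add frac_one)

end

sublocale total_quotient \<subseteq> Q: cring "total_quotient_ring R" by (rule Q_cring)

sublocale total_quotient \<subseteq> emb: ring_hom_cring R "total_quotient_ring R" "frac_embed R"
  by unfold_locales (rule emb_ring_hom)

context total_quotient
begin

lemma emb_inj:
  assumes "a \<in> carrier R" "b \<in> carrier R" "emb a = emb b" shows "a = b"
  using assms by (simp add: frac_embed_def frac_eq_iff nzd_one)

lemma frac_emb: "a \<in> carrier R \<Longrightarrow> s \<in> NZD \<Longrightarrow> frac a s \<otimes>\<^bsub>Q\<^esub> emb s = emb a"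
  using nzd_carrier[of s]
  by (simp add: frac_embed_def frac_mult frac_eq_iff nzd_one m_comm)

lemma emb_Unit: assumes "s \<in> NZD" shows "emb s \<in> Units Q"
proof -
  have "frac \<one> s \<otimes>\<^bsub>Q\<^esub> emb s = \<one>\<^bsub>Q\<^esub>" using frac_emb[of \<one> s] assms by simp
  then show ?thesis using assms frac_carrier[of \<one> s] nzd_carrier[OF assms] emb.hom_closed
    by (metis Q.Units_l_cancel Q.unit_factor Q.Units_one_closed Q.m_comm one_closed)
qed

lemma emb_cancel:
  assumes "s \<in> NZD" "x \<in> carrier Q" "y \<in> carrier Q" "emb s \<otimes>\<^bsub>Q\<^esub> x = emb s \<otimes>\<^bsub>Q\<^esub> y"
  shows "x = y"
  using Q.Units_l_cancel[OF emb_Unit[OF assms(1)] assms(2,3)] assms(4) by simp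

lemma carrier_Q_denominator:
  assumes "x \<in> carrier Q"
  obtains a s where "a \<in> carrier R" "s \<in> NZD" "emb s \<otimes>\<^bsub>Q\<^esub> x = emb a"
proof -
  obtain a s where h: "a \<in> carrier R" "s \<in> NZD" "x = frac a s" using assms by (rule carrier_QE)
  then have "emb s \<otimes>\<^bsub>Q\<^esub> x = emb a" using frac_emb[OF h(1,2)] assms nzd_carrier[OF h(2)] by (simp add: Q.m_comm)
  then show thesis using that h by blast
qed

section \<open>Integral elements and common denominators\<close>

abbreviation A0 where "A0 \<equiv> emb ` carrier R"

lemma A0_carrier: "x \<in> A0 \<Longrightarrow> x \<in> carrier Q" by auto

lemma A0_add: "x \<in> A0 \<Longrightarrow> y \<in> A0 \<Longrightarrow> x \<oplus>\<^bsub>Q\<^esub> y \<in> A0"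
  by (elim imageE) (auto simp: emb.hom_add[symmetric] simp del: emb.hom_add)

lemma A0_mult: "x \<in> A0 \<Longrightarrow> y \<in> A0 \<Longrightarrow> x \<otimes>\<^bsub>Q\<^esub> y \<in> A0"
  by (elim imageE) (auto simp: emb.hom_mult[symmetric] simp del: emb.hom_mult)

lemma A0_neg: "x \<in> A0 \<Longrightarrow> \<ominus>\<^bsub>Q\<^esub> x \<in> A0"
  by (elim imageE) (auto simp: emb.hom_a_inv[symmetric] simp del: emb.hom_a_inv)

lemma A0_finsum:
  assumes "finite F" "\<And>i. i \<in> F \<Longrightarrow> f i \<in> A0"
  shows "finsum Q f F \<in> A0"
  using assms
proof (induct F rule: finite_induct)
  case empty
  have "emb \<zero> \<in> A0" by (rule imageI) simp
  then show ?case by simp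
next
  case (insert x F)
  then have "finsum Q f (insert x F) = f x \<oplus>\<^bsub>Q\<^esub> finsum Q f F"
    using A0_carrier by (intro Q.finsum_insert) auto
  then show ?case using insert A0_add by simp
qed

text \<open>In this form closure under products and sums only requires multiplying two denominators;
  no determinant or finite module is involved.\<close>

definition almost_integral :: "('a \<times> 'a) set \<Rightarrow> bool" where
  "almost_integral x \<longleftrightarrow> x \<in> carrier Q \<and> (\<exists>d\<in>NZD. \<forall>j::nat. emb d \<otimes>\<^bsub>Q\<^esub> x [^]\<^bsub>Q\<^esub> j \<in> A0)"

lemma integral_imp_almost:
  assumes "integral_over_ring R x"
  shows "almost_integral x"
proof -
  obtain n c where xc: "x \<in> carrier Q" and c: "\<And>i. i < (n::nat) \<Longrightarrow> c i \<in> carrier R"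
    and eq: "x [^]\<^bsub>Q\<^esub> n \<oplus>\<^bsub>Q\<^esub> finsum Q (\<lambda>i. emb (c i) \<otimes>\<^bsub>Q\<^esub> x [^]\<^bsub>Q\<^esub> i) {..<n} = \<zero>\<^bsub>Q\<^esub>"
    using assms unfolding integral_over_ring_def Let_def by blast
  obtain a s where as: "a \<in> carrier R" "s \<in> NZD" "emb s \<otimes>\<^bsub>Q\<^esub> x = emb a"
    using carrier_Q_denominator[OF xc] by blast
  have sc: "s \<in> carrier R" using nzd_carrier as by blast
  \<comment> \<open>s^n clears the denominators of x^j for j < n, and the equation expresses higher
    powers through lower ones, so the same \<open>d\<close> serves for every exponent.\<close>
  define d where "d = s [^] n"
  have d: "d \<in> NZD" "d \<in> carrier R" using nzd_pow as sc by (auto simp: d_def)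
  have "emb d \<otimes>\<^bsub>Q\<^esub> x [^]\<^bsub>Q\<^esub> j \<in> A0" for j :: nat
  proof (induct j rule: less_induct)
    case (less j)
    show ?case
    proof (cases "j < n")
      case True
      have "emb d = emb (s [^] (n - j)) \<otimes>\<^bsub>Q\<^esub> emb s [^]\<^bsub>Q\<^esub> j"
      proof -
        have "d = s [^] (n - j) \<otimes> s [^] j" unfolding d_def using True sc by (simp add: nat_pow_mult)
        then show ?thesis using sc by (simp add: emb.ring.hom_nat_pow)
      qed
      then have "emb d \<otimes>\<^bsub>Q\<^esub> x [^]\<^bsub>Q\<^esub> j = emb (s [^] (n - j)) \<otimes>\<^bsub>Q\<^esub> (emb s \<otimes>\<^bsub>Q\<^esub> x) [^]\<^bsub>Q\<^esub> j"
        using sc xc by (simp add: Q.nat_pow_distrib Q.m_assoc)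
      also have "\<dots> = emb (s [^] (n - j) \<otimes> a [^] j)"
        using as sc by (simp add: emb.ring.hom_nat_pow)
      finally show ?thesis using imageI[of "s [^] (n - j) \<otimes> a [^] j" "carrier R" emb] as(1) sc by (simp del: emb.hom_mult)
    next
      case False
      let ?S = "finsum Q (\<lambda>i. emb (c i) \<otimes>\<^bsub>Q\<^esub> x [^]\<^bsub>Q\<^esub> i) {..<n}"
      define e where "e = emb d \<otimes>\<^bsub>Q\<^esub> x [^]\<^bsub>Q\<^esub> (j - n)"
      have ec: "e \<in> carrier Q" using d xc by (simp add: e_def)
      have Sc: "?S \<in> carrier Q" using c xc by (intro Q.finsum_closed) auto
      have xn: "x [^]\<^bsub>Q\<^esub> n = \<ominus>\<^bsub>Q\<^esub> ?S" using eq Sc xc by (simp add: Q.add.inv_equality Q.minus_equality)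
      have "emb d \<otimes>\<^bsub>Q\<^esub> x [^]\<^bsub>Q\<^esub> j = e \<otimes>\<^bsub>Q\<^esub> x [^]\<^bsub>Q\<^esub> n"
        unfolding e_def using False d xc by (simp add: Q.m_assoc Q.nat_pow_mult)
      also have "\<dots> = \<ominus>\<^bsub>Q\<^esub> (e \<otimes>\<^bsub>Q\<^esub> ?S)" using ec Sc by (simp add: xn Q.r_minus)
      also have "e \<otimes>\<^bsub>Q\<^esub> ?S = finsum Q (\<lambda>i. e \<otimes>\<^bsub>Q\<^esub> (emb (c i) \<otimes>\<^bsub>Q\<^esub> x [^]\<^bsub>Q\<^esub> i)) {..<n}"
        using c xc ec by (intro Q.finsum_rdistr) auto
      also have "\<ominus>\<^bsub>Q\<^esub> \<dots> \<in> A0"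
      proof (intro A0_neg A0_finsum)
        fix i assume i: "i \<in> {..<n}"
        have ci: "c i \<in> carrier R" using c i by simp
        have "emb d \<otimes>\<^bsub>Q\<^esub> x [^]\<^bsub>Q\<^esub> (j - n + i) \<in> A0" using less[of "j - n + i"] False i by auto
        then have "emb (c i) \<otimes>\<^bsub>Q\<^esub> (emb d \<otimes>\<^bsub>Q\<^esub> x [^]\<^bsub>Q\<^esub> (j - n + i)) \<in> A0" by (rule A0_mult[OF imageI[OF ci]])
        moreover have "emb (c i) \<otimes>\<^bsub>Q\<^esub> (emb d \<otimes>\<^bsub>Q\<^esub> x [^]\<^bsub>Q\<^esub> (j - n + i)) = e \<otimes>\<^bsub>Q\<^esub> (emb (c i) \<otimes>\<^bsub>Q\<^esub> x [^]\<^bsub>Q\<^esub> i)"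
          unfolding e_def using ci xc d by (simp add: Q.nat_pow_mult[symmetric] Q.m_ac)
        ultimately show "e \<otimes>\<^bsub>Q\<^esub> (emb (c i) \<otimes>\<^bsub>Q\<^esub> x [^]\<^bsub>Q\<^esub> i) \<in> A0" by simp
      qed simp
      finally show ?thesis .
    qed
  qed
  then show ?thesis unfolding almost_integral_def using xc d by blast
qed

end

lemma (in cring) Idl_image_finsum:
  assumes a: "\<And>i::nat. i < k \<Longrightarrow> a i \<in> carrier R" and x: "x \<in> Idl (a ` {..<k})"
  obtains c where "\<And>i. c i \<in> carrier R" "x = finsum R (\<lambda>i. c i \<otimes> a i) {..<k}"
proof -
  have "\<exists>c. (\<forall>i. c i \<in> carrier R) \<and> x = finsum R (\<lambda>i. c i \<otimes> a i) {..<k}"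
    using a x
  proof (induct k arbitrary: x)
    case 0
    have "Idl (a ` {..<0}) \<subseteq> {\<zero>}" by (intro genideal_minimal zeroideal) simp
    then show ?case using 0 by (intro exI[of _ "\<lambda>_. \<zero>"]) auto
  next
    case (Suc k)
    have ak: "a k \<in> carrier R" "\<And>i. i < k \<Longrightarrow> a i \<in> carrier R" using Suc.prems by auto
    have sub: "a ` {..<k} \<subseteq> carrier R" using ak by auto
    have "Idl (a ` {..<Suc k}) = Idl (a ` {..<k}) <+>\<^bsub>R\<^esub> PIdl (a k)"
      unfolding lessThan_Suc image_insert by (rule Idl_insert[OF ak(1) sub])
    then obtain y r where y: "y \<in> Idl (a ` {..<k})" "r \<in> carrier R" "x = y \<oplus> r \<otimes> a k"
      using Suc.prems(2) by (auto elim!: ideal_addE simp: cgenideal_def)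
    then obtain c where c: "\<And>i. c i \<in> carrier R" "y = finsum R (\<lambda>i. c i \<otimes> a i) {..<k}"
      using Suc.hyps[OF ak(2)] by blast
    let ?c = "c(k := r)"
    have "finsum R (\<lambda>i. ?c i \<otimes> a i) {..<Suc k} = ?c k \<otimes> a k \<oplus> finsum R (\<lambda>i. ?c i \<otimes> a i) {..<k}"
      unfolding lessThan_Suc using c y ak by (intro finsum_insert) auto
    also have "finsum R (\<lambda>i. ?c i \<otimes> a i) {..<k} = y"
      unfolding c(2) using c ak by (intro finsum_cong') auto
    finally have "x = finsum R (\<lambda>i. ?c i \<otimes> a i) {..<Suc k}"
      using y ak ideal_carrier[OF genideal_ideal[OF sub] y(1)] by (simp add: a_comm)
    then show ?case using c y by (intro exI[of _ ?c]) auto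
  qed
  then show thesis using that by blast
qed

text \<open>The ideals generated by the initial segments of the sequence become stationary. For
  numerators a_j = d x^j the resulting dependence turns into an integral equation for
  \<open>x\<close> once \<open>d\<close> is cancelled.\<close>

lemma (in cring) noetherian_sequence_dependent:
  assumes noeth: "noetherian_ring R" and a: "\<And>i::nat. a i \<in> carrier R"
  shows "\<exists>n c. (\<forall>i. c i \<in> carrier R) \<and> a n = finsum R (\<lambda>i. c i \<otimes> a i) {..<n}"
proof -
  define E where "E n = Idl (a ` {..<n})" for n
  have E: "ideal (E n) R" for n unfolding E_def using a by (intro genideal_ideal) auto
  have mono: "E i \<subseteq> E j" if "i \<le> j" for i j
  proof -
    have "a ` {..<i} \<subseteq> a ` {..<j}" using that by auto
    then show ?thesis unfolding E_def using a by (intro subset_Idl_subset) auto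
  qed
  obtain K where K: "K \<in> range E" "\<And>I. I \<in> range E \<Longrightarrow> K \<subseteq> I \<Longrightarrow> I = K"
    by (rule noetherian_ring.ideal_maximal_element[OF noeth, of "range E"]) (use E in auto)
  then obtain n where n: "K = E n" by blast
  have "E (Suc n) = E n" using K(2)[of "E (Suc n)"] mono[of n "Suc n"] n by simp
  moreover have "a n \<in> E (Suc n)" unfolding E_def using genideal_self[of "a ` {..<Suc n}"] a by auto
  ultimately have an: "a n \<in> Idl (a ` {..<n})" by (simp add: E_def)
  obtain c where "\<And>i. c i \<in> carrier R" "a n = finsum R (\<lambda>i. c i \<otimes> a i) {..<n}"
    using Idl_image_finsum[OF _ an] a by blast
  then show ?thesis by blast
qed

context total_quotient
begin

lemma almost_imp_integral:
  assumes noeth: "noetherian_ring R" and "almost_integral x"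
  shows "integral_over_ring R x"
proof -
  obtain d where xc: "x \<in> carrier Q" and d: "d \<in> NZD" "\<And>j::nat. emb d \<otimes>\<^bsub>Q\<^esub> x [^]\<^bsub>Q\<^esub> j \<in> A0"
    using assms(2) unfolding almost_integral_def by blast
  have dc: "d \<in> carrier R" using nzd_carrier d by blast
  have "\<forall>j::nat. \<exists>b. b \<in> carrier R \<and> emb d \<otimes>\<^bsub>Q\<^esub> x [^]\<^bsub>Q\<^esub> j = emb b" using d(2) by auto
  then obtain a where a: "\<And>j::nat. a j \<in> carrier R" "\<And>j::nat. emb d \<otimes>\<^bsub>Q\<^esub> x [^]\<^bsub>Q\<^esub> j = emb (a j)" by metis
  obtain n c where c: "\<And>i. c i \<in> carrier R" and an: "a n = finsum R (\<lambda>i. c i \<otimes> a i) {..<n}"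
    using noetherian_sequence_dependent[OF noeth, of a] a(1) by metis
  have emb_sum: "emb (finsum R f F) = finsum Q (\<lambda>i. emb (f i)) F"
    if "finite F" "\<And>i. f i \<in> carrier R" for f :: "nat \<Rightarrow> 'a" and F
    using that
  proof (induct F rule: finite_induct)
    case (insert x F)
    have "finsum R f (insert x F) = f x \<oplus> finsum R f F" using insert by (intro finsum_insert) auto
    moreover have "finsum Q (\<lambda>i. emb (f i)) (insert x F) = emb (f x) \<oplus>\<^bsub>Q\<^esub> finsum Q (\<lambda>i. emb (f i)) F"
      using insert by (intro Q.finsum_insert) auto
    ultimately show ?case using insert by (simp add: finsum_closed)
  qed simp
  let ?S = "finsum Q (\<lambda>i. emb (c i) \<otimes>\<^bsub>Q\<^esub> x [^]\<^bsub>Q\<^esub> i) {..<n}"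
  have Sc: "?S \<in> carrier Q" using c xc by (intro Q.finsum_closed) auto
  have "emb d \<otimes>\<^bsub>Q\<^esub> x [^]\<^bsub>Q\<^esub> n = finsum Q (\<lambda>i. emb (c i \<otimes> a i)) {..<n}"
    unfolding a(2) an using c a by (intro emb_sum) auto
  also have "\<dots> = finsum Q (\<lambda>i. emb d \<otimes>\<^bsub>Q\<^esub> (emb (c i) \<otimes>\<^bsub>Q\<^esub> x [^]\<^bsub>Q\<^esub> i)) {..<n}"
  proof (rule Q.finsum_cong')
    fix i
    have "emb (c i \<otimes> a i) = emb (c i) \<otimes>\<^bsub>Q\<^esub> (emb d \<otimes>\<^bsub>Q\<^esub> x [^]\<^bsub>Q\<^esub> i)" using c a by simp
    then show "emb (c i \<otimes> a i) = emb d \<otimes>\<^bsub>Q\<^esub> (emb (c i) \<otimes>\<^bsub>Q\<^esub> x [^]\<^bsub>Q\<^esub> i)" using c xc dc by (simp add: Q.m_ac)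
  qed (use c xc dc in auto)
  also have "\<dots> = emb d \<otimes>\<^bsub>Q\<^esub> ?S"
    using c xc dc by (intro Q.finsum_rdistr[symmetric]) auto
  finally have xn: "x [^]\<^bsub>Q\<^esub> n = ?S" using emb_cancel[OF d(1)] xc Sc by simp
  let ?m = "\<ominus>\<^bsub>Q\<^esub> \<one>\<^bsub>Q\<^esub>"
  have "finsum Q (\<lambda>i. emb (\<ominus> c i) \<otimes>\<^bsub>Q\<^esub> x [^]\<^bsub>Q\<^esub> i) {..<n}
    = finsum Q (\<lambda>i. ?m \<otimes>\<^bsub>Q\<^esub> (emb (c i) \<otimes>\<^bsub>Q\<^esub> x [^]\<^bsub>Q\<^esub> i)) {..<n}"
    using c xc by (intro Q.finsum_cong') (auto simp: Q.l_minus)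
  also have "\<dots> = ?m \<otimes>\<^bsub>Q\<^esub> ?S" using c xc by (intro Q.finsum_rdistr[symmetric]) auto
  also have "\<dots> = \<ominus>\<^bsub>Q\<^esub> ?S" using Sc by (simp add: Q.l_minus)
  finally have "x [^]\<^bsub>Q\<^esub> n \<oplus>\<^bsub>Q\<^esub> finsum Q (\<lambda>i. emb (\<ominus> c i) \<otimes>\<^bsub>Q\<^esub> x [^]\<^bsub>Q\<^esub> i) {..<n} = \<zero>\<^bsub>Q\<^esub>"
    using Sc xn by (simp add: Q.r_neg)
  then show ?thesis unfolding integral_over_ring_def Let_def using xc c
    by (intro conjI exI[of _ n] exI[of _ "\<lambda>i. \<ominus> c i"]) auto
qed

lemma almost_integral_emb: "a \<in> carrier R \<Longrightarrow> almost_integral (emb a)"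
proof -
  assume a: "a \<in> carrier R"
  have "emb \<one> \<otimes>\<^bsub>Q\<^esub> emb a [^]\<^bsub>Q\<^esub> j = emb (a [^] j)" for j :: nat
    using a by (simp add: emb.ring.hom_nat_pow)
  then have "\<forall>j::nat. emb \<one> \<otimes>\<^bsub>Q\<^esub> emb a [^]\<^bsub>Q\<^esub> j \<in> A0" using a by (metis imageI nat_pow_closed)
  then show ?thesis unfolding almost_integral_def using a nzd_one by blast
qed

lemma almost_integral_mult:
  assumes "almost_integral x" "almost_integral y" shows "almost_integral (x \<otimes>\<^bsub>Q\<^esub> y)"
proof -
  obtain d e where h: "x \<in> carrier Q" "y \<in> carrier Q" "d \<in> NZD" "e \<in> NZD"
    "\<And>j::nat. emb d \<otimes>\<^bsub>Q\<^esub> x [^]\<^bsub>Q\<^esub> j \<in> A0" "\<And>j::nat. emb e \<otimes>\<^bsub>Q\<^esub> y [^]\<^bsub>Q\<^esub> j \<in> A0"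
    using assms unfolding almost_integral_def by blast
  have c: "d \<in> carrier R" "e \<in> carrier R" using nzd_carrier h by auto
  have "emb (d \<otimes> e) \<otimes>\<^bsub>Q\<^esub> (x \<otimes>\<^bsub>Q\<^esub> y) [^]\<^bsub>Q\<^esub> j = (emb d \<otimes>\<^bsub>Q\<^esub> x [^]\<^bsub>Q\<^esub> j) \<otimes>\<^bsub>Q\<^esub> (emb e \<otimes>\<^bsub>Q\<^esub> y [^]\<^bsub>Q\<^esub> j)" for j :: nat
    using h(1,2) c by (simp add: Q.nat_pow_distrib Q.m_ac)
  then show ?thesis unfolding almost_integral_def using h A0_mult nzd_mult
    by (intro conjI bexI[of _ "d \<otimes> e"]) auto
qed

lemma almost_integral_add:
  assumes "almost_integral x" "almost_integral y" shows "almost_integral (x \<oplus>\<^bsub>Q\<^esub> y)"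
proof -
  obtain d e where h: "x \<in> carrier Q" "y \<in> carrier Q" "d \<in> NZD" "e \<in> NZD"
    "\<And>j::nat. emb d \<otimes>\<^bsub>Q\<^esub> x [^]\<^bsub>Q\<^esub> j \<in> A0" "\<And>j::nat. emb e \<otimes>\<^bsub>Q\<^esub> y [^]\<^bsub>Q\<^esub> j \<in> A0"
    using assms unfolding almost_integral_def by blast
  have c: "d \<in> carrier R" "e \<in> carrier R" using nzd_carrier h by auto
  \<comment> \<open>Proving this for all \<open>i\<close> and \<open>j\<close> lets the induction on
    \<open>n\<close> split off one factor x + y at a time, in place of a binomial expansion.\<close>
  have *: "(emb d \<otimes>\<^bsub>Q\<^esub> x [^]\<^bsub>Q\<^esub> i) \<otimes>\<^bsub>Q\<^esub> (emb e \<otimes>\<^bsub>Q\<^esub> y [^]\<^bsub>Q\<^esub> j) \<otimes>\<^bsub>Q\<^esub> (x \<oplus>\<^bsub>Q\<^esub> y) [^]\<^bsub>Q\<^esub> n \<in> A0" for i j n :: nat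
  proof (induct n arbitrary: i j)
    case 0
    then show ?case using A0_mult[OF h(5) h(6)] A0_carrier by simp
  next
    case (Suc n)
    define w where "w = (x \<oplus>\<^bsub>Q\<^esub> y) [^]\<^bsub>Q\<^esub> n"
    define p where "p = x [^]\<^bsub>Q\<^esub> i"
    define q where "q = y [^]\<^bsub>Q\<^esub> j"
    have wc: "w \<in> carrier Q" "p \<in> carrier Q" "q \<in> carrier Q" "emb d \<in> carrier Q" "emb e \<in> carrier Q"
      using h c by (auto simp: w_def p_def q_def)
    have "(emb d \<otimes>\<^bsub>Q\<^esub> p) \<otimes>\<^bsub>Q\<^esub> (emb e \<otimes>\<^bsub>Q\<^esub> q) \<otimes>\<^bsub>Q\<^esub> (w \<otimes>\<^bsub>Q\<^esub> (x \<oplus>\<^bsub>Q\<^esub> y)) =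
      (emb d \<otimes>\<^bsub>Q\<^esub> (p \<otimes>\<^bsub>Q\<^esub> x)) \<otimes>\<^bsub>Q\<^esub> (emb e \<otimes>\<^bsub>Q\<^esub> q) \<otimes>\<^bsub>Q\<^esub> w \<oplus>\<^bsub>Q\<^esub>
      (emb d \<otimes>\<^bsub>Q\<^esub> p) \<otimes>\<^bsub>Q\<^esub> (emb e \<otimes>\<^bsub>Q\<^esub> (q \<otimes>\<^bsub>Q\<^esub> y)) \<otimes>\<^bsub>Q\<^esub> w"
      using wc h(1,2) by (simp add: Q.r_distr Q.m_ac)
    then show ?case using Suc[of "Suc i" j] Suc[of i "Suc j"] A0_add
      by (simp add: w_def p_def q_def)
  qed
  have "emb (d \<otimes> e) \<otimes>\<^bsub>Q\<^esub> (x \<oplus>\<^bsub>Q\<^esub> y) [^]\<^bsub>Q\<^esub> j \<in> A0" for j :: nat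
    using *[of 0 0 j] h(1,2) c by simp
  then show ?thesis unfolding almost_integral_def using h nzd_mult
    by (intro conjI bexI[of _ "d \<otimes> e"]) auto
qed

text \<open>All products x^j s stay in \<open>K\<close>, so \<open>s\<close> itself is a common
  denominator of the powers of \<open>x\<close>.\<close>

lemma almost_integral_stable_ideal:
  assumes x: "x \<in> carrier Q" and K: "K \<subseteq> carrier R" and s: "s \<in> K" "s \<in> NZD"
    and stable: "\<And>k. k \<in> K \<Longrightarrow> x \<otimes>\<^bsub>Q\<^esub> emb k \<in> emb ` K"
  shows "almost_integral x"
proof -
  have sc: "s \<in> carrier R" using s K by auto
  have "x [^]\<^bsub>Q\<^esub> j \<otimes>\<^bsub>Q\<^esub> emb s \<in> emb ` K" for j :: nat
  proof (induct j)
    case 0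
    then show ?case using s sc by simp
  next
    case (Suc j)
    then obtain k where k: "k \<in> K" "x [^]\<^bsub>Q\<^esub> j \<otimes>\<^bsub>Q\<^esub> emb s = emb k" by blast
    have "x [^]\<^bsub>Q\<^esub> Suc j \<otimes>\<^bsub>Q\<^esub> emb s = x \<otimes>\<^bsub>Q\<^esub> (x [^]\<^bsub>Q\<^esub> j \<otimes>\<^bsub>Q\<^esub> emb s)"
      using x sc by (simp add: Q.m_ac)
    then show ?case using k stable by simp
  qed
  then have "emb s \<otimes>\<^bsub>Q\<^esub> x [^]\<^bsub>Q\<^esub> j \<in> A0" for j :: nat
  proof -
    have "emb s \<otimes>\<^bsub>Q\<^esub> x [^]\<^bsub>Q\<^esub> j = x [^]\<^bsub>Q\<^esub> j \<otimes>\<^bsub>Q\<^esub> emb s" using x sc by (simp add: Q.m_comm)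
    then show ?thesis using \<open>\<And>j. x [^]\<^bsub>Q\<^esub> j \<otimes>\<^bsub>Q\<^esub> emb s \<in> emb ` K\<close>[of j] subsetD[OF image_mono[OF K]] by simp
  qed
  then show ?thesis unfolding almost_integral_def using x s by blast
qed

lemma integral_subcring:
  assumes noeth: "noetherian_ring R"
  shows "subcring {x. integral_over_ring R x} Q"
proof -
  have eq: "{x. integral_over_ring R x} = {x. almost_integral x}"
    using integral_imp_almost almost_imp_integral[OF noeth] by blast
  show ?thesis unfolding eq
  proof (rule Q.subcringI'[OF Q.subringI])
    show "{x. almost_integral x} \<subseteq> carrier Q" by (auto simp: almost_integral_def)
    show one: "\<one>\<^bsub>Q\<^esub> \<in> {x. almost_integral x}" using almost_integral_emb[of \<one>] by simp
    show "x \<otimes>\<^bsub>Q\<^esub> y \<in> {x. almost_integral x}" "x \<oplus>\<^bsub>Q\<^esub> y \<in> {x. almost_integral x}"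
      if "x \<in> {x. almost_integral x}" "y \<in> {x. almost_integral x}" for x y
      using that almost_integral_mult almost_integral_add by auto
    show "\<ominus>\<^bsub>Q\<^esub> x \<in> {x. almost_integral x}" if h: "x \<in> {x. almost_integral x}" for x
    proof -
      have xc: "x \<in> carrier Q" using h by (auto simp: almost_integral_def)
      have "almost_integral (emb (\<ominus> \<one>) \<otimes>\<^bsub>Q\<^esub> x)" using almost_integral_mult[OF almost_integral_emb, of "\<ominus> \<one>" x] h by blast
      moreover have "emb (\<ominus> \<one>) \<otimes>\<^bsub>Q\<^esub> x = \<ominus>\<^bsub>Q\<^esub> x" using xc by (simp add: Q.l_minus)
      ultimately show ?thesis by simp
    qed
  qed
qed

end

section \<open>Maximal ideals of the integral closure\<close>

sublocale reduced_local_ring \<subseteq> total_quotient ..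

context reduced_local_ring
begin

abbreviation Rbar where "Rbar \<equiv> integral_closure R"
abbreviation B where "B \<equiv> {x. integral_over_ring R x}"
abbreviation MaxB where "MaxB \<equiv> Max_ideals (integral_closure R)"

lemma B_subcring: "subcring B Q" by (rule integral_subcring[OF noeth])

lemma B_iff: "x \<in> B \<longleftrightarrow> almost_integral x"
  using integral_imp_almost almost_imp_integral[OF noeth] by blast

lemma B_carrier: "x \<in> B \<Longrightarrow> x \<in> carrier Q"
  using B_iff almost_integral_def by blast

lemma B_mult: "x \<in> B \<Longrightarrow> y \<in> B \<Longrightarrow> x \<otimes>\<^bsub>Q\<^esub> y \<in> B"
  unfolding B_iff by (rule almost_integral_mult)

lemma B_add: "x \<in> B \<Longrightarrow> y \<in> B \<Longrightarrow> x \<oplus>\<^bsub>Q\<^esub> y \<in> B"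
  unfolding B_iff by (rule almost_integral_add)

lemma B_emb: "a \<in> carrier R \<Longrightarrow> emb a \<in> B"
  unfolding B_iff by (rule almost_integral_emb)

lemma B_neg: "x \<in> B \<Longrightarrow> \<ominus>\<^bsub>Q\<^esub> x \<in> B"
  using subcringE(5)[OF B_subcring] .

lemma B_one: "\<one>\<^bsub>Q\<^esub> \<in> B" using B_emb[of \<one>] by simp

lemma B_zero: "\<zero>\<^bsub>Q\<^esub> \<in> B" using B_emb[of \<zero>] by simp

lemma B_pow: "x \<in> B \<Longrightarrow> x [^]\<^bsub>Q\<^esub> (n::nat) \<in> B"
  by (induct n) (use B_one B_mult in auto)

lemma Rbar_cring: "cring Rbar"
  using B_subcring Q.subcring_iff[of B] B_carrier unfolding integral_closure_def by blast

lemma Rbar_simps: "carrier Rbar = B" "monoid.mult Rbar = monoid.mult Q" "add Rbar = add Q" "monoid.one Rbar = monoid.one Q" "ring.zero Rbar = ring.zero Q"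
  by (auto simp: integral_closure_def)

text \<open>\<open>integral_closure\<close> changes only the carrier of \<open>Q\<close>, but
  additive inverses are defined through the carrier. The two subtractions agree because inverses in
  \<open>Q\<close> are unique.\<close>

lemma Rbar_minus:
  assumes "x \<in> B" "y \<in> B" shows "x \<ominus>\<^bsub>Rbar\<^esub> y = x \<ominus>\<^bsub>Q\<^esub> y"
proof -
  interpret C: cring Rbar by (rule Rbar_cring)
  have "\<ominus>\<^bsub>Rbar\<^esub> y \<in> B" using C.a_inv_closed[of y] assms by (simp add: Rbar_simps)
  moreover have "\<ominus>\<^bsub>Rbar\<^esub> y \<oplus>\<^bsub>Q\<^esub> y = \<zero>\<^bsub>Q\<^esub>" using C.l_neg[of y] assms by (simp add: Rbar_simps)
  ultimately have "\<ominus>\<^bsub>Q\<^esub> y = \<ominus>\<^bsub>Rbar\<^esub> y" using Q.minus_equality[of "\<ominus>\<^bsub>Rbar\<^esub> y" y] B_carrier assms by simp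
  then show ?thesis by (simp add: a_minus_def Rbar_simps)
qed

lemma MaxB_maximal: "n \<in> MaxB \<Longrightarrow> maximalideal n Rbar" by (simp add: Max_ideals_def)

lemma MaxB_ideal: "n \<in> MaxB \<Longrightarrow> ideal n Rbar" using MaxB_maximal maximalideal.axioms(1) by blast

lemma MaxB_B: assumes "n \<in> MaxB" "x \<in> n" shows "x \<in> B"
  using ideal.Icarr[OF MaxB_ideal[OF assms(1)] assms(2)] by (simp add: Rbar_simps)

lemma MaxB_carrier: "n \<in> MaxB \<Longrightarrow> x \<in> n \<Longrightarrow> x \<in> carrier Q" using MaxB_B B_carrier by blast

lemma MaxB_add: "n \<in> MaxB \<Longrightarrow> x \<in> n \<Longrightarrow> y \<in> n \<Longrightarrow> x \<oplus>\<^bsub>Q\<^esub> y \<in> n"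
  using additive_subgroup.a_closed[OF ideal.axioms(1)[OF MaxB_ideal]] by (simp add: Rbar_simps)

lemma MaxB_mult_l: "n \<in> MaxB \<Longrightarrow> b \<in> B \<Longrightarrow> x \<in> n \<Longrightarrow> b \<otimes>\<^bsub>Q\<^esub> x \<in> n"
  using ideal.I_l_closed[OF MaxB_ideal] by (simp add: Rbar_simps)

lemma MaxB_mult_r: "n \<in> MaxB \<Longrightarrow> b \<in> B \<Longrightarrow> x \<in> n \<Longrightarrow> x \<otimes>\<^bsub>Q\<^esub> b \<in> n"
  using ideal.I_r_closed[OF MaxB_ideal] by (simp add: Rbar_simps)

lemma MaxB_zero: "n \<in> MaxB \<Longrightarrow> \<zero>\<^bsub>Q\<^esub> \<in> n"
  using additive_subgroup.zero_closed[OF ideal.axioms(1)[OF MaxB_ideal]] by (simp add: Rbar_simps)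

lemma MaxB_neg: assumes "n \<in> MaxB" "x \<in> n" shows "\<ominus>\<^bsub>Q\<^esub> x \<in> n"
proof -
  have "\<ominus>\<^bsub>Q\<^esub> \<one>\<^bsub>Q\<^esub> \<otimes>\<^bsub>Q\<^esub> x \<in> n" by (rule MaxB_mult_l[OF assms(1) B_neg[OF B_one] assms(2)])
  then show ?thesis using MaxB_carrier[OF assms] by (simp add: Q.l_minus)
qed

lemma MaxB_diff: "n \<in> MaxB \<Longrightarrow> x \<in> n \<Longrightarrow> y \<in> n \<Longrightarrow> x \<ominus>\<^bsub>Q\<^esub> y \<in> n"
  unfolding a_minus_def using MaxB_add MaxB_neg by blast

lemma MaxB_one: "n \<in> MaxB \<Longrightarrow> \<one>\<^bsub>Q\<^esub> \<notin> n"
  using cring.maximalideal_one_notin[OF Rbar_cring MaxB_maximal] by (simp add: Rbar_simps)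

lemma MaxB_prime: "n \<in> MaxB \<Longrightarrow> x \<in> B \<Longrightarrow> y \<in> B \<Longrightarrow> x \<otimes>\<^bsub>Q\<^esub> y \<in> n \<Longrightarrow> x \<in> n \<or> y \<in> n"
  using primeideal.I_prime[OF cring.maximalideal_prime[OF Rbar_cring MaxB_maximal]] by (simp add: Rbar_simps)

lemma MaxB_prime_pow:
  assumes n: "n \<in> MaxB" and x: "x \<in> B" and k: "x [^]\<^bsub>Q\<^esub> (k::nat) \<in> n" shows "x \<in> n"
  using k
proof (induct k)
  case 0
  then show ?case using MaxB_one[OF n] by simp
next
  case (Suc k)
  then show ?case using MaxB_prime[OF n B_pow[OF x] x] by auto
qed

lemma MaxB_inverse_mod:
  assumes n: "n \<in> MaxB" and x: "x \<in> B" "x \<notin> n"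
  obtains z where "z \<in> B" "x \<otimes>\<^bsub>Q\<^esub> z \<ominus>\<^bsub>Q\<^esub> \<one>\<^bsub>Q\<^esub> \<in> n"
proof -
  obtain z where z: "z \<in> carrier Rbar" "x \<otimes>\<^bsub>Rbar\<^esub> z \<ominus>\<^bsub>Rbar\<^esub> \<one>\<^bsub>Rbar\<^esub> \<in> n"
    using cring.maximalideal_inverse_mod[OF Rbar_cring MaxB_maximal[OF n], of x] x by (auto simp: Rbar_simps)
  then have "z \<in> B" "x \<otimes>\<^bsub>Q\<^esub> z \<ominus>\<^bsub>Q\<^esub> \<one>\<^bsub>Q\<^esub> \<in> n"
    using Rbar_minus[OF B_mult[OF x(1)] B_one, of z] by (auto simp: Rbar_simps)
  then show thesis using that by blast
qed

lemma MaxB_incomparable: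
  assumes "n \<in> MaxB" "n' \<in> MaxB" "n \<noteq> n'"
  obtains x where "x \<in> n" "x \<notin> n'"
proof -
  have "\<not> n \<subseteq> n'"
  proof
    assume "n \<subseteq> n'"
    then have "n' = n \<or> n' = carrier Rbar"
      using maximalideal.I_maximal[OF MaxB_maximal[OF assms(1)] MaxB_ideal[OF assms(2)]]
        MaxB_B[OF assms(2)] by (simp add: Rbar_simps subset_iff)
    then show False using assms(3) maximalideal.I_notcarr[OF MaxB_maximal[OF assms(2)]] by simp
  qed
  then show thesis using that by blast
qed

lemma B_unit:
  assumes u: "u \<in> B" and n: "\<And>n. n \<in> MaxB \<Longrightarrow> u \<notin> n"
  obtains w where "w \<in> B" "u \<otimes>\<^bsub>Q\<^esub> w = \<one>\<^bsub>Q\<^esub>"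
proof -
  interpret C: cring Rbar by (rule Rbar_cring)
  have uc: "u \<in> carrier Rbar" using u by (simp add: Rbar_simps)
  have "\<one>\<^bsub>Rbar\<^esub> \<in> PIdl\<^bsub>Rbar\<^esub> u"
  proof (rule ccontr)
    assume "\<one>\<^bsub>Rbar\<^esub> \<notin> PIdl\<^bsub>Rbar\<^esub> u"
    then obtain M where "maximalideal M Rbar" "PIdl\<^bsub>Rbar\<^esub> u \<subseteq> M"
      using C.exists_maximalideal_superset[OF C.cgenideal_ideal[OF uc]] by blast
    then show False using n[of M] C.cgenideal_self[OF uc] by (auto simp: Max_ideals_def)
  qed
  then obtain w where "w \<in> B" "\<one>\<^bsub>Q\<^esub> = w \<otimes>\<^bsub>Q\<^esub> u" by (auto simp: cgenideal_def Rbar_simps)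
  then show thesis using that B_carrier u by (metis Q.m_comm)
qed

lemma Q_one_not_zero: "\<one>\<^bsub>Q\<^esub> \<noteq> \<zero>\<^bsub>Q\<^esub>"
  using emb_inj[of \<one> \<zero>] one_not_zero by auto

lemma MaxB_nonempty: "MaxB \<noteq> {}"
proof
  assume e: "MaxB = {}"
  obtain w where "w \<in> B" "\<zero>\<^bsub>Q\<^esub> \<otimes>\<^bsub>Q\<^esub> w = \<one>\<^bsub>Q\<^esub>"
    by (rule B_unit[OF B_zero]) (use e in auto)
  then show False using B_carrier Q_one_not_zero by (metis Q.l_null)
qed

text \<open>The integral equation of \<open>x\<close>, homogenised by \<open>g\<close>: the
  dependence among the numerators of d x^j is multiplied by g^N, and then \<open>d\<close> is
  cancelled. Each summand keeps at least one factor \<open>g\<close>, which later places a^N in a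
  prescribed ideal.\<close>

lemma integral_multiple_relation:
  assumes g: "g \<in> carrier R" and a: "a \<in> carrier R" and x: "x \<in> B" and eq: "emb a = emb g \<otimes>\<^bsub>Q\<^esub> x"
  obtains N :: nat and c where "N > 0" "\<And>i. c i \<in> carrier R"
    "a [^] N = finsum R (\<lambda>i. c i \<otimes> a [^] i \<otimes> g [^] (N - i)) {..<N}"
proof -
  obtain d where xc: "x \<in> carrier Q" and d: "d \<in> NZD" "\<And>j::nat. emb d \<otimes>\<^bsub>Q\<^esub> x [^]\<^bsub>Q\<^esub> j \<in> A0"
    using x unfolding B_iff almost_integral_def by blast
  note dc = nzd_carrier[OF d(1)]
  have "\<forall>j::nat. \<exists>b. b \<in> carrier R \<and> emb d \<otimes>\<^bsub>Q\<^esub> x [^]\<^bsub>Q\<^esub> j = emb b" using d(2) by auto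
  then obtain b where b: "\<And>j::nat. b j \<in> carrier R" "\<And>j::nat. emb d \<otimes>\<^bsub>Q\<^esub> x [^]\<^bsub>Q\<^esub> j = emb (b j)" by metis
  have gb: "g [^] j \<otimes> b j = d \<otimes> a [^] j" for j :: nat
  proof (rule emb_inj)
    have "emb (g [^] j \<otimes> b j) = emb g [^]\<^bsub>Q\<^esub> j \<otimes>\<^bsub>Q\<^esub> (emb d \<otimes>\<^bsub>Q\<^esub> x [^]\<^bsub>Q\<^esub> j)"
      using g b by (simp add: emb.ring.hom_nat_pow)
    also have "\<dots> = emb d \<otimes>\<^bsub>Q\<^esub> (emb g \<otimes>\<^bsub>Q\<^esub> x) [^]\<^bsub>Q\<^esub> j" using g dc xc by (simp add: Q.nat_pow_distrib Q.m_ac)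
    also have "\<dots> = emb (d \<otimes> a [^] j)" using a dc by (simp add: eq[symmetric] emb.ring.hom_nat_pow)
    finally show "emb (g [^] j \<otimes> b j) = emb (d \<otimes> a [^] j)" .
  qed (use g a b dc in auto)
  obtain N c where c: "\<And>i. c i \<in> carrier R" and bN: "b N = finsum R (\<lambda>i. c i \<otimes> b i) {..<N}"
    using noetherian_sequence_dependent[OF noeth, of b] b(1) by metis
  let ?f = "\<lambda>i. c i \<otimes> a [^] i \<otimes> g [^] (N - i)"
  have fS: "finsum R ?f {..<N} \<in> carrier R" using a g c by (intro finsum_closed) auto
  have "d \<otimes> a [^] N = finsum R (\<lambda>i. g [^] N \<otimes> (c i \<otimes> b i)) {..<N}"
    unfolding gb[symmetric] bN using g b c by (intro finsum_rdistr) auto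
  also have "\<dots> = finsum R (\<lambda>i. d \<otimes> ?f i) {..<N}"
  proof (rule finsum_cong')
    fix i assume "i \<in> {..<N}"
    then have "g [^] N = g [^] (N - i) \<otimes> g [^] i" using g by (simp add: nat_pow_mult)
    then have "g [^] N \<otimes> (c i \<otimes> b i) = c i \<otimes> g [^] (N - i) \<otimes> (g [^] i \<otimes> b i)" using g b c by (simp add: m_ac)
    then show "g [^] N \<otimes> (c i \<otimes> b i) = d \<otimes> ?f i" unfolding gb using g a c dc by (simp add: m_ac)
  qed (use g a c dc in auto)
  also have "\<dots> = d \<otimes> finsum R ?f {..<N}" using g a c dc by (intro finsum_rdistr[symmetric]) auto
  finally have eqd: "d \<otimes> a [^] N = d \<otimes> finsum R ?f {..<N}" .
  have "d \<otimes> (a [^] N \<ominus> finsum R ?f {..<N}) = d \<otimes> a [^] N \<ominus> d \<otimes> finsum R ?f {..<N}"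
    using a dc fS by (simp add: a_minus_def r_distr r_minus)
  also have "\<dots> = \<zero>" unfolding eqd using dc fS by (simp add: a_minus_def r_neg)
  finally have "a [^] N \<ominus> finsum R ?f {..<N} = \<zero>" using nzd_cancel[OF d(1)] a fS by simp
  then have aN: "a [^] N = finsum R ?f {..<N}" using a fS by simp
  moreover have "N > 0"
  proof (rule ccontr)
    assume "\<not> N > 0"
    then show False using aN one_not_zero by simp
  qed
  ultimately show thesis using that c by blast
qed

lemma finsum_ideal:
  assumes "ideal K R" "finite F" "\<And>i. i \<in> F \<Longrightarrow> f i \<in> K"
  shows "finsum R f F \<in> K"
  using assms(2,3)
proof (induct F rule: finite_induct)
  case empty
  then show ?case using ideal_zero_closed[OF assms(1)] by simp
next
  case (insert x F)
  then have "finsum R f (insert x F) = f x \<oplus> finsum R f F"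
    using ideal_carrier[OF assms(1)] by (intro finsum_insert) auto
  then show ?case using insert ideal_add_closed[OF assms(1)] by simp
qed

text \<open>R/dR is finite, so two powers of \<open>r\<close> agree modulo \<open>d\<close>. Their
  difference is r^i times 1 - r^(j-i), and the latter is a unit.\<close>

lemma m_nilpotent_mod_nzd:
  assumes r: "r \<in> m" and d: "d \<in> NZD"
  obtains i :: nat and a where "a \<in> carrier R" "r [^] i = a \<otimes> d"
proof -
  note c = m_carrier[OF r] nzd_carrier[OF d]
  have K: "ideal (PIdl d) R" by (rule cgenideal_ideal[OF c(2)])
  obtain F where F: "finite F" "\<And>a. a \<in> carrier R \<Longrightarrow> \<exists>f\<in>F. a \<ominus> f \<in> PIdl d" "F \<subseteq> carrier R"
    using finite_cover_of_nzd[OF K cgenideal_self[OF c(2)] d] unfolding finite_cover_def by blast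
  have "\<forall>k::nat. \<exists>f. f \<in> F \<and> r [^] k \<ominus> f \<in> PIdl d" using F(2)[OF nat_pow_closed[OF c(1)]] by blast
  then obtain \<phi> where phi: "\<And>k::nat. \<phi> k \<in> F" "\<And>k::nat. r [^] k \<ominus> \<phi> k \<in> PIdl d" by metis
  have "\<not> inj \<phi>" using phi(1) F(1) by (metis finite_subset image_subsetI infinite_UNIV_nat finite_imageD)
  then obtain i j where ij: "i < j" "\<phi> i = \<phi> j" unfolding inj_def by (metis nat_neq_iff)
  have pc: "\<phi> j \<in> carrier R" using phi(1) F(3) by blast
  have "(r [^] i \<ominus> \<phi> j) \<ominus> (r [^] j \<ominus> \<phi> j) \<in> PIdl d" using phi(2)[of i] phi(2)[of j] ij(2) ideal_diff_closed[OF K] by simp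
  moreover have "(p \<ominus> \<phi> j) \<ominus> (p' \<ominus> \<phi> j) = p \<ominus> p'" if "p \<in> carrier R" "p' \<in> carrier R" for p p' using that pc by algebra
  ultimately have 1: "r [^] i \<ominus> r [^] j \<in> PIdl d" using c by simp
  obtain k where k: "j = i + Suc k" using ij(1) less_iff_Suc_add by auto
  define u where "u = \<one> \<ominus> r [^] Suc k"
  have "r [^] Suc k \<in> m" using r c ideal_m by (simp add: ideal.I_l_closed)
  then have U: "u \<in> Units R" unfolding u_def by (rule one_minus_m_Unit)
  have "r [^] j = r [^] i \<otimes> r [^] Suc k" unfolding k using c(1) by (rule nat_pow_mult[symmetric])
  moreover have "p \<ominus> p \<otimes> w = (\<one> \<ominus> w) \<otimes> p" if "p \<in> carrier R" "w \<in> carrier R" for p w using that by algebra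
  ultimately have "u \<otimes> r [^] i \<in> PIdl d" using 1 c unfolding u_def by (metis nat_pow_closed)
  then have "inv u \<otimes> (u \<otimes> r [^] i) \<in> PIdl d" using U K by (simp add: ideal.I_l_closed)
  then have "r [^] i \<in> PIdl d" using U Units_closed[OF U] c by (simp add: m_assoc[symmetric])
  then show thesis using that by (auto simp: cgenideal_def)
qed

text \<open>Otherwise some \<open>z\<close> in \<open>B\<close> has r z congruent to 1 modulo
  \<open>n\<close>, and so has every power of r z. A high power of \<open>r\<close> absorbs the
  common denominator \<open>d\<close> of the powers of \<open>z\<close>, so a power of r z is the
  image of some \<open>u\<close> in \<open>m\<close>. Then 1 - u is both a unit and in
  \<open>n\<close>.\<close>

lemma MaxB_lies_over:
  assumes n: "n \<in> MaxB" and r: "r \<in> m"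
  shows "emb r \<in> n"
proof (rule ccontr)
  assume nr: "emb r \<notin> n"
  have rc: "r \<in> carrier R" using r m_carrier by simp
  obtain z where z: "z \<in> B" "emb r \<otimes>\<^bsub>Q\<^esub> z \<ominus>\<^bsub>Q\<^esub> \<one>\<^bsub>Q\<^esub> \<in> n" using MaxB_inverse_mod[OF n B_emb[OF rc] nr] by blast
  obtain d where zc: "z \<in> carrier Q" and d: "d \<in> NZD" "\<And>j::nat. emb d \<otimes>\<^bsub>Q\<^esub> z [^]\<^bsub>Q\<^esub> j \<in> A0"
    using z(1) unfolding B_iff almost_integral_def by blast
  note dc = nzd_carrier[OF d(1)]
  define x where "x = emb r \<otimes>\<^bsub>Q\<^esub> z"
  have xB: "x \<in> B" and xc: "x \<in> carrier Q" using B_mult[OF B_emb[OF rc] z(1)] B_carrier by (auto simp: x_def)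
  have xk: "x [^]\<^bsub>Q\<^esub> k \<ominus>\<^bsub>Q\<^esub> \<one>\<^bsub>Q\<^esub> \<in> n" for k :: nat
  proof (induct k)
    case 0
    then show ?case using MaxB_zero[OF n] by (simp add: a_minus_def Q.r_neg)
  next
    case (Suc k)
    have "y \<otimes>\<^bsub>Q\<^esub> x \<ominus>\<^bsub>Q\<^esub> \<one>\<^bsub>Q\<^esub> = (y \<ominus>\<^bsub>Q\<^esub> \<one>\<^bsub>Q\<^esub>) \<otimes>\<^bsub>Q\<^esub> x \<oplus>\<^bsub>Q\<^esub> (x \<ominus>\<^bsub>Q\<^esub> \<one>\<^bsub>Q\<^esub>)" if "y \<in> carrier Q" for y
      using that xc Q.one_closed by (simp add: a_minus_def Q.l_distr Q.l_minus Q.a_assoc[symmetric]) (simp add: Q.a_assoc Q.r_neg1 Q.l_neg)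
    then show ?case using MaxB_add[OF n MaxB_mult_r[OF n xB Suc]] z(2) xc x_def by simp
  qed
  obtain i :: nat and a where a: "a \<in> carrier R" "r [^] i = a \<otimes> d" using m_nilpotent_mod_nzd[OF r d(1)] by blast
  obtain b where b: "b \<in> carrier R" "emb d \<otimes>\<^bsub>Q\<^esub> z [^]\<^bsub>Q\<^esub> Suc i = emb b" using d(2) by blast
  \<comment> \<open>The exponent is \<open>Suc i\<close> and not \<open>i\<close>, so that a factor
    \<open>r\<close> is left over and puts \<open>u\<close> into \<open>m\<close>.\<close>
  define u where "u = r \<otimes> a \<otimes> b"
  have um: "u \<in> m" unfolding u_def using r a b ideal_m by (simp add: ideal.I_r_closed)
  note uc = m_carrier[OF um]
  have "x [^]\<^bsub>Q\<^esub> Suc i = emb (r [^] Suc i) \<otimes>\<^bsub>Q\<^esub> z [^]\<^bsub>Q\<^esub> Suc i"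
    unfolding x_def emb.ring.hom_nat_pow[OF rc] using rc zc by (intro Q.nat_pow_distrib) auto
  also have "r [^] Suc i = r \<otimes> a \<otimes> d" using rc a dc by (simp add: m_ac)
  also have "emb (r \<otimes> a \<otimes> d) \<otimes>\<^bsub>Q\<^esub> z [^]\<^bsub>Q\<^esub> Suc i = emb (r \<otimes> a) \<otimes>\<^bsub>Q\<^esub> (emb d \<otimes>\<^bsub>Q\<^esub> z [^]\<^bsub>Q\<^esub> Suc i)"
    using rc a(1) dc zc by (simp add: Q.m_assoc del: Q.nat_pow_Suc)
  also have "\<dots> = emb u" unfolding b(2) u_def using rc a b by simp
  finally have xu: "x [^]\<^bsub>Q\<^esub> Suc i = emb u" .
  have "emb u \<ominus>\<^bsub>Q\<^esub> \<one>\<^bsub>Q\<^esub> \<in> n" using xk[of "Suc i"] unfolding xu .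
  from MaxB_neg[OF n this] have in_n: "emb (\<one> \<ominus> u) \<in> n" using uc by (simp add: a_minus_def Q.minus_add Q.a_comm)
  have U: "\<one> \<ominus> u \<in> Units R" using um by (rule one_minus_m_Unit)
  have "emb (inv (\<one> \<ominus> u)) \<otimes>\<^bsub>Q\<^esub> emb (\<one> \<ominus> u) \<in> n"
    using MaxB_mult_l[OF n B_emb in_n] U by simp
  moreover have "emb (inv (\<one> \<ominus> u)) \<otimes>\<^bsub>Q\<^esub> emb (\<one> \<ominus> u) = \<one>\<^bsub>Q\<^esub>"
    using U by (metis Units_closed Units_inv_closed Units_l_inv emb.hom_mult emb.hom_one)
  ultimately show False using MaxB_one[OF n] by simp
qed

end

section \<open>Chinese remaindering and finiteness of the set of maximal ideals\<close>

context reduced_local_ring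
begin

text \<open>Maximal ideals are incomparable, so each ideal of \<open>G\<close> has an element
  outside \<open>n\<close>; the product of these stays outside because \<open>n\<close> is
  prime.\<close>

lemma MaxB_separating:
  assumes n: "n \<in> MaxB" and G: "finite G" "G \<subseteq> MaxB" "n \<notin> G"
  shows "\<exists>p\<in>B. p \<notin> n \<and> (\<forall>n'\<in>G. p \<in> n')"
  using G
proof (induct G rule: finite_induct)
  case empty
  then show ?case using B_one MaxB_one[OF n] by blast
next
  case (insert n' G)
  then obtain p where p: "p \<in> B" "p \<notin> n" "\<And>n''. n'' \<in> G \<Longrightarrow> p \<in> n''" by auto
  have n': "n' \<in> MaxB" "n' \<noteq> n" using insert by auto
  obtain x where x: "x \<in> n'" "x \<notin> n" using MaxB_incomparable[OF n'(1) n n'(2)] by blast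
  have xB: "x \<in> B" using MaxB_B[OF n'(1) x(1)] .
  have "p \<otimes>\<^bsub>Q\<^esub> x \<notin> n" using MaxB_prime[OF n p(1) xB] p x by blast
  moreover have "p \<otimes>\<^bsub>Q\<^esub> x \<in> n''" if "n'' \<in> insert n' G" for n''
  proof (cases "n'' = n'")
    case True
    then show ?thesis using MaxB_mult_l[OF n'(1) p(1) x(1)] by simp
  next
    case False
    then have "n'' \<in> G" using that by simp
    then show ?thesis using MaxB_mult_r[OF _ xB p(3)] insert.prems by blast
  qed
  ultimately show ?case using B_mult[OF p(1) xB] by blast
qed

text \<open>Stated for a finite subset \<open>F\<close> because the finiteness of
  \<open>MaxB\<close> is itself proved with these elements.\<close>

lemma MaxB_CRT:
  assumes F: "finite F" "F \<subseteq> MaxB"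
  obtains e where "\<And>n. n \<in> F \<Longrightarrow> e n \<in> B" "\<And>n. n \<in> F \<Longrightarrow> e n \<ominus>\<^bsub>Q\<^esub> \<one>\<^bsub>Q\<^esub> \<in> n"
    "\<And>n n'. n \<in> F \<Longrightarrow> n' \<in> F \<Longrightarrow> n \<noteq> n' \<Longrightarrow> e n \<in> n'"
proof -
  have "\<exists>e. e \<in> B \<and> e \<ominus>\<^bsub>Q\<^esub> \<one>\<^bsub>Q\<^esub> \<in> n \<and> (\<forall>n'\<in>F. n \<noteq> n' \<longrightarrow> e \<in> n')" if nF: "n \<in> F" for n
  proof -
    have n: "n \<in> MaxB" using nF F by blast
    obtain p where p: "p \<in> B" "p \<notin> n" "\<And>n'. n' \<in> F - {n} \<Longrightarrow> p \<in> n'"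
      using MaxB_separating[OF n, of "F - {n}"] F by auto
    obtain z where z: "z \<in> B" "p \<otimes>\<^bsub>Q\<^esub> z \<ominus>\<^bsub>Q\<^esub> \<one>\<^bsub>Q\<^esub> \<in> n" using MaxB_inverse_mod[OF n p(1,2)] by blast
    have "p \<otimes>\<^bsub>Q\<^esub> z \<in> n'" if "n' \<in> F" "n \<noteq> n'" for n'
      using MaxB_mult_r[OF _ z(1) p(3)] that F by blast
    then show ?thesis using B_mult[OF p(1) z(1)] z(2) by blast
  qed
  then obtain e where e: "\<And>n. n \<in> F \<Longrightarrow> e n \<in> B \<and> e n \<ominus>\<^bsub>Q\<^esub> \<one>\<^bsub>Q\<^esub> \<in> n \<and> (\<forall>n'\<in>F. n \<noteq> n' \<longrightarrow> e n \<in> n')"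
    by metis
  show thesis by (rule that[of e]) (use e in auto)
qed

lemma common_denominator:
  assumes "finite V" "V \<subseteq> carrier Q"
  shows "\<exists>d\<in>NZD. \<forall>x\<in>V. emb d \<otimes>\<^bsub>Q\<^esub> x \<in> A0"
  using assms
proof (induct V rule: finite_induct)
  case empty
  then show ?case using nzd_one by blast
next
  case (insert x V)
  then obtain d where d: "d \<in> NZD" "\<And>y. y \<in> V \<Longrightarrow> emb d \<otimes>\<^bsub>Q\<^esub> y \<in> A0" by auto
  have xc: "x \<in> carrier Q" and Vc: "\<And>y. y \<in> V \<Longrightarrow> y \<in> carrier Q" using insert.prems by auto
  obtain a s where s: "a \<in> carrier R" "s \<in> NZD" "emb s \<otimes>\<^bsub>Q\<^esub> x = emb a" using carrier_Q_denominator[OF xc] by blast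
  note c = nzd_carrier[OF d(1)] nzd_carrier[OF s(2)]
  have "emb (d \<otimes> s) \<otimes>\<^bsub>Q\<^esub> y \<in> A0" if "y \<in> insert x V" for y
  proof (cases "y = x")
    case True
    have "emb (d \<otimes> s) \<otimes>\<^bsub>Q\<^esub> x = emb d \<otimes>\<^bsub>Q\<^esub> (emb s \<otimes>\<^bsub>Q\<^esub> x)" using c xc by (simp add: Q.m_assoc)
    also have "\<dots> = emb d \<otimes>\<^bsub>Q\<^esub> emb a" by (simp only: s(3))
    also have "\<dots> \<in> A0" using c s by (intro A0_mult imageI)
    finally show ?thesis using True by simp
  next
    case False
    then have y: "y \<in> V" using that by simp
    have "emb (d \<otimes> s) \<otimes>\<^bsub>Q\<^esub> y = emb s \<otimes>\<^bsub>Q\<^esub> (emb d \<otimes>\<^bsub>Q\<^esub> y)" using c Vc[OF y] by (simp add: Q.m_ac)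
    also have "\<dots> \<in> A0" by (rule A0_mult[OF imageI[OF c(2)] d(2)[OF y]])
    finally show ?thesis .
  qed
  then show ?case using nzd_mult[OF d(1) s(2)] by blast
qed

lemma Q_diff_mult: "x \<in> carrier Q \<Longrightarrow> y \<in> carrier Q \<Longrightarrow> z \<in> carrier Q \<Longrightarrow>
    z \<otimes>\<^bsub>Q\<^esub> (x \<ominus>\<^bsub>Q\<^esub> y) = z \<otimes>\<^bsub>Q\<^esub> x \<ominus>\<^bsub>Q\<^esub> z \<otimes>\<^bsub>Q\<^esub> y"
  by (simp add: a_minus_def Q.r_distr Q.r_minus)

lemma emb_diff: "a \<in> carrier R \<Longrightarrow> b \<in> carrier R \<Longrightarrow> emb (a \<ominus> b) = emb a \<ominus>\<^bsub>Q\<^esub> emb b"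
  by (simp add: a_minus_def)

text \<open>The contraction to \<open>R\<close> of d V, for \<open>V\<close> an ideal of
  \<open>B\<close>. It turns ideals of \<open>B\<close> into ideals of \<open>R\<close>, where the
  pigeonhole bound and products of ideals are available.\<close>

definition scaled :: "'a \<Rightarrow> ('a \<times> 'a) set set \<Rightarrow> 'a set" where
  "scaled d V = {k \<in> carrier R. \<exists>x\<in>V. emb k = emb d \<otimes>\<^bsub>Q\<^esub> x}"

lemma scaled_ideal:
  assumes d: "d \<in> carrier R" and V: "V \<subseteq> B" and zero: "\<zero>\<^bsub>Q\<^esub> \<in> V"
    and add: "\<And>x y. x \<in> V \<Longrightarrow> y \<in> V \<Longrightarrow> x \<oplus>\<^bsub>Q\<^esub> y \<in> V"
    and mult: "\<And>b x. b \<in> B \<Longrightarrow> x \<in> V \<Longrightarrow> b \<otimes>\<^bsub>Q\<^esub> x \<in> V"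
  shows "ideal (scaled d V) R"
proof (rule idealI[OF ring_axioms])
  have scaledI: "k \<in> scaled d V" if "k \<in> carrier R" "x \<in> V" "emb k = emb d \<otimes>\<^bsub>Q\<^esub> x" for k x
    using that by (auto simp: scaled_def)
  have smult: "y \<otimes> x \<in> scaled d V" if x: "x \<in> scaled d V" and y: "y \<in> carrier R" for x y
  proof -
    obtain b where b: "x \<in> carrier R" "b \<in> V" "emb x = emb d \<otimes>\<^bsub>Q\<^esub> b" using x by (auto simp: scaled_def)
    have bc: "b \<in> carrier Q" using b V B_carrier by blast
    show ?thesis by (rule scaledI[OF _ mult[OF B_emb[OF y] b(2)]]) (use b y bc d in \<open>auto simp: Q.m_ac\<close>)
  qed
  show "subgroup (scaled d V) (add_monoid R)"
  proof (rule add.subgroupI)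
    show "scaled d V \<subseteq> carrier R" by (auto simp: scaled_def)
    have "\<zero> \<in> scaled d V" by (rule scaledI[OF _ zero]) (use d in auto)
    then show "scaled d V \<noteq> {}" by blast
    fix x assume x: "x \<in> scaled d V"
    then obtain b where b: "x \<in> carrier R" "b \<in> V" "emb x = emb d \<otimes>\<^bsub>Q\<^esub> b" by (auto simp: scaled_def)
    show "\<ominus> x \<in> scaled d V" using smult[OF x, of "\<ominus> \<one>"] b by (simp add: l_minus)
    fix y assume "y \<in> scaled d V"
    then obtain b' where b': "y \<in> carrier R" "b' \<in> V" "emb y = emb d \<otimes>\<^bsub>Q\<^esub> b'" by (auto simp: scaled_def)
    have "b \<in> carrier Q" "b' \<in> carrier Q" using b b' V B_carrier by blast+
    then show "x \<oplus> y \<in> scaled d V" by (intro scaledI[OF _ add[OF b(2) b'(2)]])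
        (use b b' d in \<open>auto simp: Q.r_distr\<close>)
  qed
  fix x y assume x: "x \<in> scaled d V" and y: "y \<in> carrier R"
  show "y \<otimes> x \<in> scaled d V" by (rule smult[OF x y])
  then show "x \<otimes> y \<in> scaled d V" using x y by (simp add: m_comm scaled_def)
qed

text \<open>Given more than \<open>D\<close> maximal ideals, the pigeonhole bound is applied to the
  numerators of their Chinese remainder elements inside the contraction of d B. Two of these
  elements then differ by a multiple of \<open>t\<close> in \<open>B\<close>, hence agree modulo
  every maximal ideal; but modulo one of the two ideals they are 1 and 0.\<close>

lemma finite_MaxB: "finite MaxB"
proof (rule ccontr)
  assume inf: "infinite MaxB"
  obtain t where t: "t \<in> m" "t \<in> NZD" using m_has_nonzerodivisor by blast
  note tc = m_carrier[OF t(1)]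
  obtain D :: nat where D: "\<And>K f. ideal K R \<Longrightarrow> (\<exists>s\<in>K. s \<in> NZD) \<Longrightarrow> (\<And>i. i \<le> D \<Longrightarrow> f i \<in> K) \<Longrightarrow>
    \<exists>i j k. i < j \<and> j \<le> D \<and> k \<in> K \<and> f i \<ominus> f j = t \<otimes> k" using nzd_pigeonhole[OF t(2)] by metis
  obtain F where F: "F \<subseteq> MaxB" "finite F" "card F = Suc D"
    using infinite_arbitrarily_large[OF inf, of "Suc D"] by blast
  obtain \<nu> where nu: "bij_betw \<nu> {0..<Suc D} F" using ex_bij_betw_nat_finite[OF F(2)] F(3) by auto
  obtain e where e: "\<And>n. n \<in> F \<Longrightarrow> e n \<in> B" "\<And>n. n \<in> F \<Longrightarrow> e n \<ominus>\<^bsub>Q\<^esub> \<one>\<^bsub>Q\<^esub> \<in> n"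
    "\<And>n n'. n \<in> F \<Longrightarrow> n' \<in> F \<Longrightarrow> n \<noteq> n' \<Longrightarrow> e n \<in> n'" using MaxB_CRT[OF F(2,1)] by blast
  have "e ` F \<subseteq> carrier Q" using e(1) B_carrier by blast
  then obtain d where d: "d \<in> NZD" "\<And>n. n \<in> F \<Longrightarrow> emb d \<otimes>\<^bsub>Q\<^esub> e n \<in> A0"
    using common_denominator[of "e ` F"] F(2) by blast
  note dc = nzd_carrier[OF d(1)]
  have "\<forall>n\<in>F. \<exists>a. a \<in> carrier R \<and> emb d \<otimes>\<^bsub>Q\<^esub> e n = emb a" using d(2) by blast
  then obtain a where a: "\<And>n. n \<in> F \<Longrightarrow> a n \<in> carrier R" "\<And>n. n \<in> F \<Longrightarrow> emb d \<otimes>\<^bsub>Q\<^esub> e n = emb (a n)" by metis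
  define K where "K = scaled d B"
  have KI: "k \<in> K" if "k \<in> carrier R" "b \<in> B" "emb k = emb d \<otimes>\<^bsub>Q\<^esub> b" for k b
    using that by (auto simp: K_def scaled_def)
  have K: "ideal K R" unfolding K_def by (rule scaled_ideal[OF dc subset_refl B_zero B_add B_mult])
  have dK: "d \<in> K" by (rule KI[OF dc B_one]) (use dc in simp)
  have nuF: "\<nu> i \<in> F" if "i \<le> D" for i using nu that by (auto simp: bij_betw_def)
  have "\<exists>i j k. i < j \<and> j \<le> D \<and> k \<in> K \<and> a (\<nu> i) \<ominus> a (\<nu> j) = t \<otimes> k"
  proof (rule D[OF K])
    show "\<exists>s\<in>K. s \<in> NZD" using dK d by blast
    fix i assume "i \<le> D"
    then show "a (\<nu> i) \<in> K" using KI a e(1) nuF by metis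
  qed
  then obtain i j k where ij: "i < j" "j \<le> D" and k: "k \<in> K" "a (\<nu> i) \<ominus> a (\<nu> j) = t \<otimes> k" by blast
  have Fi: "\<nu> i \<in> F" "\<nu> j \<in> F" using nuF ij by auto
  have ne: "\<nu> i \<noteq> \<nu> j" using inj_onD[of \<nu> "{0..<Suc D}" i j] nu ij by (auto simp: bij_betw_def)
  obtain b where b: "k \<in> carrier R" "b \<in> B" "emb k = emb d \<otimes>\<^bsub>Q\<^esub> b" using k(1) by (auto simp: K_def scaled_def)
  note bc = B_carrier[OF b(2)] B_carrier[OF e(1)[OF Fi(1)]] B_carrier[OF e(1)[OF Fi(2)]]
  have "emb d \<otimes>\<^bsub>Q\<^esub> (e (\<nu> i) \<ominus>\<^bsub>Q\<^esub> e (\<nu> j)) = emb (a (\<nu> i) \<ominus> a (\<nu> j))"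
    using Q_diff_mult[OF bc(2,3), of "emb d"] dc a Fi by (simp add: emb_diff)
  also have "\<dots> = emb t \<otimes>\<^bsub>Q\<^esub> (emb d \<otimes>\<^bsub>Q\<^esub> b)" using k(2) b tc by simp
  also have "\<dots> = emb d \<otimes>\<^bsub>Q\<^esub> (emb t \<otimes>\<^bsub>Q\<^esub> b)" using tc dc bc by (simp add: Q.m_ac)
  finally have eq: "e (\<nu> i) \<ominus>\<^bsub>Q\<^esub> e (\<nu> j) = emb t \<otimes>\<^bsub>Q\<^esub> b"
    using emb_cancel[OF d(1)] bc tc by simp
  define n where "n = \<nu> i"
  have n: "n \<in> MaxB" using Fi F by (auto simp: n_def)
  have 1: "e n \<ominus>\<^bsub>Q\<^esub> e (\<nu> j) \<in> n" using eq MaxB_mult_r[OF n b(2) MaxB_lies_over[OF n t(1)]] by (simp add: n_def)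
  have 2: "e (\<nu> j) \<in> n" using e(3)[OF Fi(2,1)] ne by (simp add: n_def)
  have "(e n \<ominus>\<^bsub>Q\<^esub> e (\<nu> j)) \<oplus>\<^bsub>Q\<^esub> e (\<nu> j) = e n" using bc by (simp add: a_minus_def Q.a_assoc Q.l_neg n_def)
  then have 3: "e n \<in> n" using MaxB_add[OF n 1 2] by simp
  have 4: "e n \<ominus>\<^bsub>Q\<^esub> \<one>\<^bsub>Q\<^esub> \<in> n" using e(2)[OF Fi(1)] by (simp add: n_def)
  have "e n \<ominus>\<^bsub>Q\<^esub> (e n \<ominus>\<^bsub>Q\<^esub> \<one>\<^bsub>Q\<^esub>) = \<one>\<^bsub>Q\<^esub>"
    using bc(2) by (simp add: a_minus_def Q.minus_add Q.a_assoc[symmetric] Q.r_neg n_def)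
  then show False using MaxB_diff[OF n 3 4] MaxB_one[OF n] by simp
qed

lemma frac_add_same:
  assumes "a \<in> carrier R" "b \<in> carrier R" "s \<in> NZD"
  shows "frac (a \<oplus> b) s = frac a s \<oplus>\<^bsub>Q\<^esub> frac b s"
proof -
  note sc = nzd_carrier[OF assms(3)]
  have "(a \<oplus> b) \<otimes> (s \<otimes> s) = (a \<otimes> s \<oplus> b \<otimes> s) \<otimes> s" using assms(1,2) sc by algebra
  then show ?thesis using assms sc by (simp add: frac_add frac_eq_iff nzd_mult)
qed

lemma frac_smult:
  assumes "r \<in> carrier R" "a \<in> carrier R" "s \<in> NZD"
  shows "frac (r \<otimes> a) s = emb r \<otimes>\<^bsub>Q\<^esub> frac a s"
  using assms nzd_carrier[OF assms(3)] by (simp add: frac_embed_def frac_mult nzd_one)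

lemma frac_pow:
  assumes "a \<in> carrier R" "s \<in> NZD"
  shows "frac a s [^]\<^bsub>Q\<^esub> (k::nat) = frac (a [^] k) (s [^] k)"
  by (induct k) (use assms in \<open>auto simp: frac_one frac_mult nzd_pow\<close>)

end

section \<open>Homogeneous primes of the Rees algebra attached to the maximal ideals of
  \<open>B\<close>\<close>

locale principal_power_data = reduced_local_ring +
  fixes I :: "'a set" and s y :: 'a and h n0 :: nat
  assumes I: "ideal I R" and s: "s \<in> I" "s \<in> nonzerodivisors R"
    and h: "h > 0" "h \<le> n0" and y: "y \<in> ideal_pow R I h" "y \<in> nonzerodivisors R"
    and divis: "\<And>c. c \<in> ideal_pow R I n0 \<Longrightarrow> \<exists>u\<in>ideal_pow R I (n0 - h). c = y \<otimes> u"
begin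

lemma y_carrier: "y \<in> carrier R" using nzd_carrier y by blast

text \<open>For \<open>l = 1\<close>, multiplication by c / y maps I^(n0-h) into itself since I^n0
  lies in y I^(n0-h), so c / y is almost integral. Larger \<open>l\<close> follow because elements
  of I^(hl) are sums of products.\<close>

lemma frac_pow_B:
  assumes "c \<in> ideal_pow R I (h * l)" shows "frac c (y [^] l) \<in> B"
proof -
  have base: "frac c y \<in> B" if c: "c \<in> ideal_pow R I h" for c
  proof -
    have cc: "c \<in> carrier R" using c ideal_pow_carrier[OF I] by blast
    have "almost_integral (frac c y)"
    proof (rule almost_integral_stable_ideal)
      show "frac c y \<in> carrier Q" using frac_carrier cc y by blast
      show "ideal_pow R I (n0 - h) \<subseteq> carrier R" using ideal_pow_carrier[OF I] by blast
      show "s [^] (n0 - h) \<in> ideal_pow R I (n0 - h)" using ideal_pow_nat_pow_mem1[OF I s(1)] .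
      show "s [^] (n0 - h) \<in> NZD" using nzd_pow[OF s(2)] .
      fix k assume k: "k \<in> ideal_pow R I (n0 - h)"
      have kc: "k \<in> carrier R" using k ideal_pow_carrier[OF I] by blast
      have "c \<otimes> k \<in> ideal_pow R I n0" by (rule ideal_pow_mult_mem[OF I c k]) (use h in simp)
      then obtain u where u: "u \<in> ideal_pow R I (n0 - h)" "c \<otimes> k = y \<otimes> u" using divis by blast
      have uc: "u \<in> carrier R" using u ideal_pow_carrier[OF I] by blast
      have "frac c y \<otimes>\<^bsub>Q\<^esub> emb k = frac (c \<otimes> k) y"
        using cc kc y by (simp add: frac_embed_def frac_mult nzd_one y_carrier)
      also have "\<dots> = emb u" unfolding u(2) frac_embed_def
        using uc y y_carrier by (simp add: frac_eq_iff nzd_one m_comm)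
      finally show "frac c y \<otimes>\<^bsub>Q\<^esub> emb k \<in> emb ` ideal_pow R I (n0 - h)" using u by blast
    qed
    then show ?thesis using B_iff by blast
  qed
  show ?thesis using assms
  proof (induct l arbitrary: c)
    case 0
    then show ?case using B_emb[of c] by (simp add: frac_embed_def)
  next
    case (Suc l)
    have "c \<in> ideal_pow R I h \<cdot> ideal_pow R I (h * l)" using Suc.prems ideal_pow_add[OF I, of h "h * l"] by simp
    then have "c \<in> carrier R \<and> frac c (y [^] Suc l) \<in> B"
    proof (induct c rule: ideal_prod.induct)
      case (prod i j)
      have c: "i \<in> carrier R" "j \<in> carrier R" using prod ideal_pow_carrier[OF I] by blast+
      have "frac (i \<otimes> j) (y [^] Suc l) = frac i y \<otimes>\<^bsub>Q\<^esub> frac j (y [^] l)"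
        using c y nzd_pow[OF y(2), of l] y_carrier by (simp add: frac_mult m_comm)
      then show ?case using B_mult[OF base[OF prod(1)] Suc.hyps[OF prod(2)]] c by simp
    next
      case (sum s1 s2)
      then show ?case using frac_add_same[of s1 s2 "y [^] Suc l"] nzd_pow[OF y(2), of "Suc l"] B_add by simp
    qed
    then show ?case by blast
  qed
qed

text \<open>The degree-\<open>l\<close> part of the homogeneous prime of the Rees algebra of \<open>I\<close>
  corresponding to \<open>n\<close>.\<close>

definition W :: "('a \<times> 'a) set set \<Rightarrow> nat \<Rightarrow> 'a set" where
  "W n l = {c \<in> ideal_pow R I l. \<forall>z\<in>ideal_pow R I (l * (h - 1)). frac (c \<otimes> z) (y [^] l) \<in> n}"

lemma hl_split: "h * l = l + l * (h - 1)"
  using h(1) by (cases h) (auto simp: algebra_simps)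

text \<open>The cofactor \<open>z\<close> raises the degree from \<open>l\<close> to h l, the degree
  of y^l. The quotient is thus a fraction of degree zero, and such fractions lie in
  \<open>B\<close>, where membership in \<open>n\<close> makes sense.\<close>

lemma W_frac_B:
  assumes "c \<in> ideal_pow R I l" "z \<in> ideal_pow R I (l * (h - 1))"
  shows "frac (c \<otimes> z) (y [^] l) \<in> B"
  by (rule frac_pow_B, rule ideal_pow_mult_mem[OF I assms hl_split])

lemma W_carrier: "c \<in> W n l \<Longrightarrow> c \<in> carrier R" using ideal_pow_carrier[OF I] by (auto simp: W_def)

lemma W_add:
  assumes n: "n \<in> MaxB" and c: "c \<in> W n l" "d \<in> W n l" shows "c \<oplus> d \<in> W n l"
proof -
  have "frac ((c \<oplus> d) \<otimes> z) (y [^] l) \<in> n" if z: "z \<in> ideal_pow R I (l * (h - 1))" for z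
  proof -
    have zc: "z \<in> carrier R" using z ideal_pow_carrier[OF I] by blast
    have "frac ((c \<oplus> d) \<otimes> z) (y [^] l) = frac (c \<otimes> z) (y [^] l) \<oplus>\<^bsub>Q\<^esub> frac (d \<otimes> z) (y [^] l)"
      using W_carrier[OF c(1)] W_carrier[OF c(2)] zc nzd_pow[OF y(2)] by (simp add: l_distr frac_add_same)
    then show ?thesis using MaxB_add[OF n] c z by (simp add: W_def)
  qed
  then show ?thesis using c ideal_add_closed[OF ideal_pow_ideal[OF I]] by (simp add: W_def)
qed

text \<open>The disjunction serves two ends: closure of \<open>W n l\<close> under scalars, and m
  I^l \<subseteq> W n l, for which \<open>n\<close> lies over \<open>m\<close>.\<close>

lemma W_smult:
  assumes n: "n \<in> MaxB" and r: "r \<in> carrier R" and c: "c \<in> ideal_pow R I l" and "c \<in> W n l \<or> r \<in> m"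
  shows "r \<otimes> c \<in> W n l"
proof -
  have cc: "c \<in> carrier R" using c ideal_pow_carrier[OF I] by blast
  have "frac ((r \<otimes> c) \<otimes> z) (y [^] l) \<in> n" if z: "z \<in> ideal_pow R I (l * (h - 1))" for z
  proof -
    have zc: "z \<in> carrier R" using z ideal_pow_carrier[OF I] by blast
    have e: "frac ((r \<otimes> c) \<otimes> z) (y [^] l) = emb r \<otimes>\<^bsub>Q\<^esub> frac (c \<otimes> z) (y [^] l)"
      using r cc zc nzd_pow[OF y(2)] by (simp add: m_assoc frac_smult)
    from assms(4) show ?thesis
    proof
      assume "c \<in> W n l"
      then have "frac (c \<otimes> z) (y [^] l) \<in> n" using z by (simp add: W_def)
      then show ?thesis unfolding e by (rule MaxB_mult_l[OF n B_emb[OF r]])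
    next
      assume "r \<in> m"
      then show ?thesis unfolding e using MaxB_mult_r[OF n W_frac_B[OF c z] MaxB_lies_over[OF n]] by blast
    qed
  qed
  then show ?thesis using r c ideal_pow_ideal[OF I] by (simp add: W_def ideal.I_l_closed)
qed

lemma W_zero: assumes n: "n \<in> MaxB" shows "\<zero> \<in> W n l"
proof -
  have z: "\<zero> \<in> ideal_pow R I l" using ideal_zero_closed[OF ideal_pow_ideal[OF I]] .
  show ?thesis using W_smult[OF n zero_closed z] ideal_zero_closed[OF ideal_m] by simp
qed

lemma W_ideal: assumes n: "n \<in> MaxB" shows "ideal (W n l) R"
proof (rule idealI[OF ring_axioms])
  have mem: "c \<in> ideal_pow R I l" if "c \<in> W n l" for c using that by (simp add: W_def)
  show "subgroup (W n l) (add_monoid R)"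
  proof (rule add.subgroupI)
    show "W n l \<subseteq> carrier R" using W_carrier by blast
    show "W n l \<noteq> {}" using W_zero[OF n] by blast
    fix a assume a: "a \<in> W n l"
    have "\<ominus> \<one> \<otimes> a \<in> W n l" using W_smult[OF n _ mem[OF a]] a by simp
    then show "\<ominus> a \<in> W n l" using W_carrier[OF a] by (simp add: l_minus)
    show "a \<oplus> b \<in> W n l" if "b \<in> W n l" for b using W_add[OF n a that] .
  qed
  fix a x assume a: "a \<in> W n l" and x: "x \<in> carrier R"
  show "x \<otimes> a \<in> W n l" using W_smult[OF n x mem[OF a]] a by simp
  then show "a \<otimes> x \<in> W n l" using x W_carrier[OF a] by (simp add: m_comm)
qed

lemma m_pow_subset_W: assumes n: "n \<in> MaxB" shows "m \<cdot> ideal_pow R I l \<subseteq> W n l"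
proof (rule ideal_prod_subsetI[OF W_ideal[OF n]])
  fix i j assume "i \<in> m" "j \<in> ideal_pow R I l"
  then show "i \<otimes> j \<in> W n l" using W_smult[OF n m_carrier, of i j l] by simp
qed

text \<open>A cofactor of degree (l + l')(h - 1) is a sum of products of cofactors for
  \<open>c\<close> and for \<open>c'\<close>, so each fraction splits into one in \<open>n\<close>
  times one in \<open>B\<close>.\<close>

lemma W_mult:
  assumes n: "n \<in> MaxB" and c: "c \<in> W n l" and c': "c' \<in> ideal_pow R I l'"
  shows "c \<otimes> c' \<in> W n (l + l')"
proof -
  have cI: "c \<in> ideal_pow R I l" using c by (simp add: W_def)
  have cc: "c \<in> carrier R" "c' \<in> carrier R" using cI c' ideal_pow_carrier[OF I] by blast+
  note N = nzd_pow[OF y(2)]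
  have "frac ((c \<otimes> c') \<otimes> z) (y [^] (l + l')) \<in> n" if z: "z \<in> ideal_pow R I ((l + l') * (h - 1))" for z
  proof -
    have "z \<in> ideal_pow R I (l * (h - 1)) \<cdot> ideal_pow R I (l' * (h - 1))"
      using z ideal_pow_add[OF I, of "l * (h - 1)" "l' * (h - 1)"] by (simp add: add_mult_distrib)
    then have "z \<in> carrier R \<and> frac ((c \<otimes> c') \<otimes> z) (y [^] (l + l')) \<in> n"
    proof (induct z rule: ideal_prod.induct)
      case (prod i j)
      have ic: "i \<in> carrier R" "j \<in> carrier R" using prod ideal_pow_carrier[OF I] by blast+
      have "(c \<otimes> c') \<otimes> (i \<otimes> j) = (c \<otimes> i) \<otimes> (c' \<otimes> j)" using cc ic by (simp add: m_ac)
      then have "frac ((c \<otimes> c') \<otimes> (i \<otimes> j)) (y [^] (l + l')) = frac (c \<otimes> i) (y [^] l) \<otimes>\<^bsub>Q\<^esub> frac (c' \<otimes> j) (y [^] l')"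
        using cc ic N y_carrier by (simp add: frac_mult nat_pow_mult)
      moreover have "frac (c \<otimes> i) (y [^] l) \<in> n" using c prod by (simp add: W_def)
      ultimately show ?case using MaxB_mult_r[OF n W_frac_B[OF c' prod(2)]] ic by simp
    next
      case (sum s1 s2)
      have "(c \<otimes> c') \<otimes> (s1 \<oplus> s2) = (c \<otimes> c') \<otimes> s1 \<oplus> (c \<otimes> c') \<otimes> s2" using cc sum by (simp add: r_distr)
      then show ?case using sum cc N MaxB_add[OF n] by (simp add: frac_add_same)
    qed
    then show ?thesis by blast
  qed
  then show ?thesis using ideal_pow_mult_mem[OF I cI c' refl] by (simp add: W_def)
qed

text \<open>Testing c^k against z^k gives the \<open>k\<close>-th power of the fraction c z / y^l,
  and \<open>n\<close> is prime.\<close>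

lemma W_prime:
  assumes n: "n \<in> MaxB" and c: "c \<in> ideal_pow R I l" and k: "c [^] (k::nat) \<in> W n (l * k)"
  shows "c \<in> W n l"
proof -
  have cc: "c \<in> carrier R" using c ideal_pow_carrier[OF I] by blast
  have "frac (c \<otimes> z) (y [^] l) \<in> n" if z: "z \<in> ideal_pow R I (l * (h - 1))" for z
  proof (rule MaxB_prime_pow[OF n W_frac_B[OF c z]])
    have zc: "z \<in> carrier R" using z ideal_pow_carrier[OF I] by blast
    have "z [^] k \<in> ideal_pow R I (l * k * (h - 1))" by (rule ideal_pow_nat_pow_mem[OF I z]) simp
    then have "frac (c [^] k \<otimes> z [^] k) (y [^] (l * k)) \<in> n" using k by (simp add: W_def)
    then show "frac (c \<otimes> z) (y [^] l) [^]\<^bsub>Q\<^esub> k \<in> n"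
      using cc zc nzd_pow[OF y(2)] y_carrier by (simp add: frac_pow nat_pow_distrib nat_pow_pow)
  qed
  then show ?thesis using c by (simp add: W_def)
qed

text \<open>\<open>y\<close> is a sum of products of elements of \<open>I\<close> and of I^(h-1). If
  all of \<open>I\<close> were in \<open>W n 1\<close>, then y / y = 1 would be in
  \<open>n\<close>.\<close>

lemma W_proper:
  assumes n: "n \<in> MaxB" shows "\<exists>c\<in>I. c \<notin> W n 1"
proof (rule ccontr)
  assume "\<not> ?thesis"
  then have all: "frac (c \<otimes> z) y \<in> n" if "c \<in> I" "z \<in> ideal_pow R I (h - 1)" for c z
    using that y_carrier by (auto simp: W_def)
  have "y \<in> I \<cdot> ideal_pow R I (h - 1)" using y(1) h(1) by (cases h) auto
  then have "y \<in> carrier R \<and> frac y y \<in> n"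
  proof (rule ideal_prod.induct[of y R I "ideal_pow R I (h - 1)" "\<lambda>x. x \<in> carrier R \<and> frac x y \<in> n"])
    fix i j assume ij: "i \<in> I" "j \<in> ideal_pow R I (h - 1)"
    show "i \<otimes> j \<in> carrier R \<and> frac (i \<otimes> j) y \<in> n"
      using all[OF ij] ideal_carrier[OF I ij(1)] ideal_pow_carrier[OF I ij(2)] by simp
  next
    fix s1 s2 assume "s1 \<in> carrier R \<and> frac s1 y \<in> n" "s2 \<in> carrier R \<and> frac s2 y \<in> n"
    then show "s1 \<oplus> s2 \<in> carrier R \<and> frac (s1 \<oplus> s2) y \<in> n"
      using MaxB_add[OF n] y(2) by (simp add: frac_add_same)
  qed
  moreover have "frac y y = \<one>\<^bsub>Q\<^esub>" using y y_carrier by (simp add: frac_one frac_eq_iff nzd_one)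
  ultimately show False using MaxB_one[OF n] by simp
qed

text \<open>Let \<open>L\<close> in J^g dominate \<open>S\<close>. If v = L^h / y^g were in some
  \<open>n\<close>, then \<open>L\<close> would lie in \<open>W n g\<close>, hence a power of each
  \<open>b\<close> in \<open>S\<close> would lie in the corresponding \<open>W\<close>, and so would
  \<open>b\<close>. Thus \<open>v\<close> is a unit of \<open>B\<close>, every a^(gh) is L^h times
  an integral element, and the homogenised equation makes each generator of \<open>I\<close>
  integral over \<open>J\<close>.\<close>

lemma reduction_of_avoiding:
  assumes S: "finite S" "S \<subseteq> I" and avoid: "\<And>n. n \<in> MaxB \<Longrightarrow> \<exists>b\<in>S. b \<notin> W n 1"
  shows "is_reduction R (Idl S) I"
proof -
  have Sc: "S \<subseteq> carrier R" using S ideal_carrier[OF I] by blast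
  define J where "J = Idl S"
  have J: "ideal J R" "J \<subseteq> I" using genideal_ideal[OF Sc] genideal_minimal[OF I S(2)] by (auto simp: J_def)
  obtain g L where g: "g > 0" and L: "L \<in> ideal_pow R J g" and dom: "\<And>b. b \<in> S \<Longrightarrow> dominated I L g b 1"
    using dominating_form[OF I s S] unfolding J_def by blast
  have LI: "L \<in> ideal_pow R I g" using L ideal_pow_mono[OF J(2)] by blast
  have Lc: "L \<in> carrier R" using LI ideal_pow_carrier[OF I] by blast
  define v where "v = frac (L [^] h) (y [^] g)"
  have "L [^] h \<in> ideal_pow R I (h * g)" by (rule ideal_pow_nat_pow_mem[OF I LI]) simp
  then have vB: "v \<in> B" unfolding v_def by (rule frac_pow_B)
  have vn: "v \<notin> n" if n: "n \<in> MaxB" for n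
  proof
    assume v: "v \<in> n"
    have "L \<in> W n g"
    proof -
      \<comment> \<open>The \<open>h\<close>-th power of this fraction is \<open>v\<close> times an
        element of \<open>B\<close>, so it lies in the prime \<open>n\<close>.\<close>
      have "frac (L \<otimes> z) (y [^] g) \<in> n" if z: "z \<in> ideal_pow R I (g * (h - 1))" for z
      proof (rule MaxB_prime_pow[OF n W_frac_B[OF LI z]])
        have zc: "z \<in> carrier R" using z ideal_pow_carrier[OF I] by blast
        have "z [^] h \<in> ideal_pow R I (h * (g * (h - 1)))" by (rule ideal_pow_nat_pow_mem[OF I z]) simp
        then have zB: "frac (z [^] h) (y [^] (g * (h - 1))) \<in> B" by (rule frac_pow_B)
        have "g * h = g + g * (h - 1)" using hl_split[of g] by (simp add: mult.commute)
        then have "frac (L \<otimes> z) (y [^] g) [^]\<^bsub>Q\<^esub> h = v \<otimes>\<^bsub>Q\<^esub> frac (z [^] h) (y [^] (g * (h - 1)))"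
          unfolding v_def using Lc zc y_carrier nzd_pow[OF y(2)]
          by (simp add: frac_pow frac_mult nat_pow_distrib nat_pow_pow nat_pow_mult)
        then show "frac (L \<otimes> z) (y [^] g) [^]\<^bsub>Q\<^esub> h \<in> n" using MaxB_mult_r[OF n zB v] by simp
      qed
      then show ?thesis using LI by (simp add: W_def)
    qed
    obtain b where b: "b \<in> S" "b \<notin> W n 1" using avoid[OF n] by blast
    obtain k u w where k: "k > 0" "g \<le> k" "u \<in> ideal_pow R I (k - g)" "w \<in> m \<cdot> ideal_pow R I k" "b [^] k = L \<otimes> u \<oplus> w"
      using dom[OF b(1)] unfolding dominated_def by auto
    have "L \<otimes> u \<in> W n k" using W_mult[OF n \<open>L \<in> W n g\<close> k(3)] k(2) by simp
    moreover have "w \<in> W n k" using k(4) m_pow_subset_W[OF n] by blast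
    ultimately have "b [^] k \<in> W n (1 * k)" using W_add[OF n] k(5) by simp
    moreover have "b \<in> ideal_pow R I 1" using b S ideal_pow_one[OF I] by auto
    ultimately show False using W_prime[OF n] b(2) by blast
  qed
  obtain w where w: "w \<in> B" "v \<otimes>\<^bsub>Q\<^esub> w = \<one>\<^bsub>Q\<^esub>" using B_unit[OF vB vn] by blast
  define G where "G = L [^] h"
  define e where "e = g * h"
  have e: "e > 0" using g h by (simp add: e_def)
  have GJ: "G \<in> ideal_pow R J e" unfolding G_def e_def by (rule ideal_pow_nat_pow_mem[OF J(1) L refl])
  have Gc: "G \<in> carrier R" using Lc by (simp add: G_def)
  obtain S0 where S0: "S0 \<subseteq> carrier R" "finite S0" "I = Idl S0"
    using noetherian_ring.finetely_gen[OF noeth I] by blast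
  have "is_reduction R J I"
  proof (rule is_reductionI_elementwise[OF I J S0(2,3,1)])
    fix a assume "a \<in> S0"
    then have aI: "a \<in> I" using S0 genideal_self by blast
    have ac: "a \<in> carrier R" using aI ideal_carrier[OF I] by blast
    have "a [^] e \<in> ideal_pow R I (h * g)" using ideal_pow_nat_pow_mem1[OF I aI, of e] by (simp add: e_def mult.commute)
    then have pB: "frac (a [^] e) (y [^] g) \<in> B" by (rule frac_pow_B)
    \<comment> \<open>\<open>x\<close> stands for a^e / G: both terms have degree g h, and the unit
      \<open>v\<close> compares \<open>G\<close> with y^g.\<close>
    define x where "x = frac (a [^] e) (y [^] g) \<otimes>\<^bsub>Q\<^esub> w"
    have xB: "x \<in> B" unfolding x_def by (rule B_mult[OF pB w(1)])
    have yg: "y [^] g \<in> NZD" "y [^] g \<in> carrier R" using nzd_pow[OF y(2)] nzd_carrier by auto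
    note cc = B_carrier[OF vB] B_carrier[OF w(1)] B_carrier[OF pB] emb.hom_closed[OF yg(2)]
    have Gv: "emb G = v \<otimes>\<^bsub>Q\<^esub> emb (y [^] g)" unfolding v_def G_def using frac_emb[of "L [^] h" "y [^] g"] Lc yg by simp
    have "emb (a [^] e) = frac (a [^] e) (y [^] g) \<otimes>\<^bsub>Q\<^esub> emb (y [^] g)" using frac_emb[of "a [^] e" "y [^] g"] ac yg by simp
    also have "\<dots> = frac (a [^] e) (y [^] g) \<otimes>\<^bsub>Q\<^esub> (v \<otimes>\<^bsub>Q\<^esub> w) \<otimes>\<^bsub>Q\<^esub> emb (y [^] g)" using cc w(2) by simp
    also have "\<dots> = emb G \<otimes>\<^bsub>Q\<^esub> x" unfolding Gv x_def using cc by (simp add: Q.m_ac)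
    finally have "emb (a [^] e) = emb G \<otimes>\<^bsub>Q\<^esub> x" .
    then obtain N :: nat and c where N: "N > 0" "\<And>i. c i \<in> carrier R"
      "(a [^] e) [^] N = finsum R (\<lambda>i. c i \<otimes> (a [^] e) [^] i \<otimes> G [^] (N - i)) {..<N}"
      using integral_multiple_relation[OF Gc nat_pow_closed[OF ac] xB] by blast
    define H where "H = J \<cdot> ideal_pow R I (e * N - 1)"
    have H: "ideal H R" unfolding H_def using J(1) ideal_pow_ideal[OF I] by (rule ideal_prod_is_ideal)
    have "finsum R (\<lambda>i. c i \<otimes> (a [^] e) [^] i \<otimes> G [^] (N - i)) {..<N} \<in> H"
    proof (rule finsum_ideal[OF H])
      fix i assume "i \<in> {..<N}"
      then have i: "i < N" by simp
      \<comment> \<open>Since i < N, every summand contains a factor \<open>G\<close>. One copy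
        supplies the factor from \<open>J\<close>; all other factors are only counted as powers of
        \<open>I\<close>.\<close>
      then obtain k where k: "N - i = Suc k" by (metis Suc_diff_Suc)
      have GI: "G \<in> ideal_pow R I e" using GJ ideal_pow_mono[OF J(2)] by blast
      have ae: "a [^] e \<in> ideal_pow R I e" by (rule ideal_pow_nat_pow_mem1[OF I aI])
      have "(a [^] e) [^] i \<otimes> G [^] k \<in> ideal_pow R I (e * i + e * k)"
        by (rule ideal_pow_mult_mem[OF I ideal_pow_nat_pow_mem[OF I ae refl] ideal_pow_nat_pow_mem[OF I GI refl] refl])
      moreover have "G \<in> J \<cdot> ideal_pow R I (e - 1)"
      proof -
        have "G \<in> J \<cdot> ideal_pow R J (e - 1)" using GJ e by (cases e) auto
        then show ?thesis using ideal_prod_mono[OF order_refl ideal_pow_mono[OF J(2)]] by blast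
      qed
      ultimately have "G \<otimes> ((a [^] e) [^] i \<otimes> G [^] k) \<in> (J \<cdot> ideal_pow R I (e - 1)) \<cdot> ideal_pow R I (e * i + e * k)"
        by (intro ideal_prod.prod)
      also have "\<dots> = J \<cdot> ideal_pow R I (e - 1 + (e * i + e * k))"
        by (simp add: ideal_prod_assoc J(1) ideal_pow_ideal[OF I] ideal_pow_add[OF I, symmetric])
      also have "e - 1 + (e * i + e * k) = e * N - 1"
      proof -
        have "N = Suc (i + k)" using k i by simp
        then show ?thesis using e by (simp add: algebra_simps)
      qed
      finally have "G \<otimes> ((a [^] e) [^] i \<otimes> G [^] k) \<in> H" by (simp add: H_def)
      then have "c i \<otimes> (G \<otimes> ((a [^] e) [^] i \<otimes> G [^] k)) \<in> H" using N(2)[of i] H by (simp add: ideal.I_l_closed)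
      moreover have "c i \<otimes> (a [^] e) [^] i \<otimes> G [^] (N - i) = c i \<otimes> (G \<otimes> ((a [^] e) [^] i \<otimes> G [^] k))"
        unfolding k using N(2)[of i] ac Gc by (simp add: m_ac)
      ultimately show "c i \<otimes> (a [^] e) [^] i \<otimes> G [^] (N - i) \<in> H" by simp
    qed simp
    then have "(a [^] e) [^] N \<in> H" unfolding N(3) .
    then have "a [^] (e * N) \<in> J \<cdot> ideal_pow R I (e * N - 1)" using ac by (simp add: nat_pow_pow H_def)
    then show "\<exists>n>0. a [^] n \<in> J \<cdot> ideal_pow R I (n - 1)" using e N(1) by (intro exI[of _ "e * N"]) simp
  qed
  then show ?thesis by (simp add: J_def)
qed

end

section \<open>Upper bound\<close>

context reduced_local_ring
begin

lemma transversal_card_ge_2: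
  assumes tE: "transversal R m E"
  shows "2 \<le> card E"
proof -
  note E = transversalD[OF tE]
  obtain e f where ef: "e \<in> E" "\<zero> \<ominus> e \<in> m" "f \<in> E" "\<one> \<ominus> f \<in> m" using E(3)[of \<zero>] E(3)[of \<one>] by auto
  have "e \<noteq> f"
  proof
    assume "e = f"
    have ec: "e \<in> carrier R" using ef E by blast
    have "(\<one> \<ominus> e) \<ominus> (\<zero> \<ominus> e) \<in> m" using ef \<open>e = f\<close> ideal_diff_closed[OF ideal_m] by blast
    moreover have "(\<one> \<ominus> e) \<ominus> (\<zero> \<ominus> e) = \<one>" using ec by algebra
    ultimately show False using one_notin_m by simp
  qed
  then have "card {e, f} = 2" by simp
  moreover have "card {e, f} \<le> card E" using ef E(1) by (intro card_mono) auto
  ultimately show ?thesis by simp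
qed

text \<open>\<open>T\<close> represents the vector space I / m I and \<open>V \<inter> T\<close> its
  proper subspace V / m I. Translating by the multiples r c of one \<open>c\<close> outside
  \<open>V\<close>, for \<open>r\<close> in \<open>E\<close>, gives distinct classes: a unit
  multiple of \<open>c\<close> in \<open>V\<close> would put \<open>c\<close> itself there.\<close>

lemma proper_submodule_index:
  assumes tE: "transversal R m E"
    and I: "ideal I R" and V: "ideal V R" "V \<subseteq> I" "V \<noteq> I" "m \<cdot> I \<subseteq> V"
    and T: "finite T" "T \<subseteq> I" "\<And>a. a \<in> I \<Longrightarrow> \<exists>e\<in>T. a \<ominus> e \<in> m \<cdot> I"
      "\<And>e e'. e \<in> T \<Longrightarrow> e' \<in> T \<Longrightarrow> e \<ominus> e' \<in> m \<cdot> I \<Longrightarrow> e = e'"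
  shows "card E * card (V \<inter> T) \<le> card T"
proof -
  note E = transversalD[OF tE]
  have mI: "ideal (m \<cdot> I) R" using ideal_m I by (rule ideal_prod_is_ideal)
  obtain c where c: "c \<in> I" "c \<notin> V" using V by blast
  have cc: "c \<in> carrier R" using c ideal_carrier[OF I] by blast
  have Ic: "x \<in> carrier R" if "x \<in> I" for x using that ideal_carrier[OF I] by blast
  obtain rep where rep: "\<And>a. a \<in> I \<Longrightarrow> rep a \<in> T" "\<And>a. a \<in> I \<Longrightarrow> a \<ominus> rep a \<in> m \<cdot> I" using T(3) by metis
  let ?f = "\<lambda>(r, w). rep (w \<oplus> r \<otimes> c)"
  have mem: "w \<oplus> r \<otimes> c \<in> I" if "r \<in> E" "w \<in> V \<inter> T" for r w
    using that V c E(2) by (intro ideal_add_closed[OF I] ideal.I_l_closed[OF I]) auto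
  have "inj_on ?f (E \<times> (V \<inter> T))"
  proof (rule inj_onI, clarify)
    fix r w r' w' assume h: "r \<in> E" "w \<in> V" "w \<in> T" "r' \<in> E" "w' \<in> V" "w' \<in> T"
      and eq: "rep (w \<oplus> r \<otimes> c) = rep (w' \<oplus> r' \<otimes> c)"
    have hc: "r \<in> carrier R" "r' \<in> carrier R" "w \<in> carrier R" "w' \<in> carrier R"
      using h E(2) V(2) Ic by blast+
    define \<rho> where "\<rho> = rep (w \<oplus> r \<otimes> c)"
    have rc: "\<rho> \<in> carrier R" using rep(1)[OF mem] h T Ic unfolding \<rho>_def by blast
    have "(w \<oplus> r \<otimes> c) \<ominus> \<rho> \<in> m \<cdot> I" "(w' \<oplus> r' \<otimes> c) \<ominus> \<rho> \<in> m \<cdot> I"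
      using rep(2)[OF mem[of r w]] rep(2)[OF mem[of r' w']] h eq unfolding \<rho>_def by simp_all
    then have "((w \<oplus> r \<otimes> c) \<ominus> \<rho>) \<ominus> ((w' \<oplus> r' \<otimes> c) \<ominus> \<rho>) \<in> m \<cdot> I" by (rule ideal_diff_closed[OF mI])
    moreover have "((w \<oplus> r \<otimes> c) \<ominus> \<rho>) \<ominus> ((w' \<oplus> r' \<otimes> c) \<ominus> \<rho>) = (w \<ominus> w') \<oplus> (r \<ominus> r') \<otimes> c"
      using hc rc cc by algebra
    ultimately have d: "(w \<ominus> w') \<oplus> (r \<ominus> r') \<otimes> c \<in> m \<cdot> I" by simp
    have "r \<ominus> r' \<in> m"
    proof (rule ccontr)
      assume "r \<ominus> r' \<notin> m"
      then have U: "r \<ominus> r' \<in> Units R" using not_in_m_Unit hc by simp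
      have "((w \<ominus> w') \<oplus> (r \<ominus> r') \<otimes> c) \<ominus> (w \<ominus> w') \<in> V"
        using d V(4) h ideal_diff_closed[OF V(1)] by blast
      moreover have "((w \<ominus> w') \<oplus> (r \<ominus> r') \<otimes> c) \<ominus> (w \<ominus> w') = (r \<ominus> r') \<otimes> c" using hc cc by algebra
      ultimately have "inv (r \<ominus> r') \<otimes> ((r \<ominus> r') \<otimes> c) \<in> V" using V(1) U by (simp add: ideal.I_l_closed)
      then show False using U cc c(2) Units_closed[OF U] by (simp add: m_assoc[symmetric])
    qed
    then have rr: "r = r'" using E(4) h by blast
    have "(w \<ominus> w') \<oplus> (r \<ominus> r) \<otimes> c = w \<ominus> w'" using hc cc by algebra
    then have "w \<ominus> w' \<in> m \<cdot> I" using d rr by simp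
    then have "w = w'" using T(4) h by blast
    then show "r = r' \<and> w = w'" using rr by simp
  qed
  moreover have "?f p \<in> T" if "p \<in> E \<times> (V \<inter> T)" for p
    using that rep(1)[OF mem[of "fst p" "snd p"]] by (cases p) simp
  then have "?f ` (E \<times> (V \<inter> T)) \<subseteq> T" by blast
  ultimately have "card (E \<times> (V \<inter> T)) \<le> card T" using T(1) by (intro card_inj_on_le) auto
  then show ?thesis by (simp add: card_cartesian_product)
qed

text \<open>Averaged over the nonzero classes \<open>b\<close> of \<open>I / m I\<close>, fewer than \<open>|F| / q\<close> of the submodules
  contain \<open>b\<close>; choose such a \<open>b\<close> and recurse on the submodules containing it.\<close>

lemma avoid_proper_submodules:
  assumes tE: "transversal R m E"
    and I: "ideal I R" and s: "s \<in> I" "s \<in> nonzerodivisors R"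
    and F: "finite F" "card F \<le> (\<Sum>i=1..N. card E ^ i)"
    and V: "\<And>x. x \<in> F \<Longrightarrow> ideal (V x) R \<and> V x \<subseteq> I \<and> V x \<noteq> I \<and> m \<cdot> I \<subseteq> V x"
  shows "\<exists>S. finite S \<and> card S \<le> N \<and> S \<subseteq> I \<and> (\<forall>x\<in>F. \<exists>b\<in>S. b \<notin> V x)"
proof -
  have mI: "ideal (m \<cdot> I) R" using ideal_m I by (rule ideal_prod_is_ideal)
  obtain t where t: "t \<in> m" "t \<in> NZD" using m_has_nonzerodivisor by blast
  have "t \<otimes> s \<in> m \<cdot> I" "t \<otimes> s \<in> NZD" using t s nzd_mult by (auto intro: ideal_prod.prod)
  then have "finite_cover R (m \<cdot> I)" using finite_cover_of_nzd[OF mI] by blast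
  then obtain E' where "transversal R (m \<cdot> I) E'" using finite_cover_transversal[OF mI] by blast
  note E' = transversalD[OF this]
  define T where "T = E' \<inter> I"
  have T1: "finite T" "T \<subseteq> I" using E' by (auto simp: T_def)
  have T2: "\<exists>e\<in>T. a \<ominus> e \<in> m \<cdot> I" if a: "a \<in> I" for a
  proof -
    have ac: "a \<in> carrier R" using a ideal_carrier[OF I] by blast
    obtain e where e: "e \<in> E'" "a \<ominus> e \<in> m \<cdot> I" using E'(3)[OF ac] by blast
    have ec: "e \<in> carrier R" using e E' by blast
    have "a \<ominus> e \<in> I" using e ideal_prod_inter[OF ideal_m I] by blast
    then have "a \<ominus> (a \<ominus> e) \<in> I" using a ideal_diff_closed[OF I] by blast
    moreover have "a \<ominus> (a \<ominus> e) = e" using ac ec by algebra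
    ultimately show ?thesis using e by (auto simp: T_def)
  qed
  have T3: "e = e'" if "e \<in> T" "e' \<in> T" "e \<ominus> e' \<in> m \<cdot> I" for e e' using that E'(4) by (auto simp: T_def)
  \<comment> \<open>\<open>t0\<close> represents the zero class. It lies in every
    \<open>V x\<close>, so it is left out of the averaging.\<close>
  obtain t0 where t0: "t0 \<in> T" "\<zero> \<ominus> t0 \<in> m \<cdot> I" using T2[OF ideal_zero_closed[OF I]] by blast
  have t0m: "t0 \<in> m \<cdot> I"
  proof -
    have "t0 \<in> carrier R" using t0 T1 ideal_carrier[OF I] by blast
    then have "t0 = \<zero> \<ominus> (\<zero> \<ominus> t0)" by algebra
    then show ?thesis using ideal_diff_closed[OF mI ideal_zero_closed[OF mI] t0(2)] by simp
  qed
  define q where "q = card E"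
  have q: "q \<ge> 2" unfolding q_def by (rule transversal_card_ge_2[OF tE])
  define \<tau> where "\<tau> = card T"
  have idx: "q * card (V x \<inter> T) \<le> \<tau>" if "x \<in> F" for x
    unfolding q_def \<tau>_def using V[OF that]
    by (intro proper_submodule_index[OF tE I _ _ _ _ T1 T2 T3]) auto
  show ?thesis using F V idx
  proof (induct N arbitrary: F)
    case 0
    then show ?case by (intro exI[of _ "{}"]) auto
  next
    case (Suc N)
    define c where "c = (\<Sum>i=1..N. q ^ i)"
    \<comment> \<open>The recursion behind the bound: choosing one element must cut q (c + 1)
      submodules down to at most \<open>c\<close>, the bound for one element fewer.\<close>
    have sumq: "(\<Sum>i=1..Suc N. q ^ i) = q * (c + 1)"
    proof -
      have "(\<Sum>i=1..Suc N. q ^ i) = q ^ 1 + (\<Sum>i=Suc 1..Suc N. q ^ i)"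
        by (rule sum.atLeast_Suc_atMost) simp
      also have "(\<Sum>i=Suc 1..Suc N. q ^ i) = (\<Sum>i=1..N. q ^ Suc i)" by (rule sum.shift_bounds_cl_Suc_ivl)
      also have "\<dots> = q * c" unfolding c_def by (simp add: sum_distrib_left)
      finally show ?thesis by simp
    qed
    have Fle: "card F \<le> q * (c + 1)" using Suc.prems(2) unfolding q_def[symmetric] sumq .
    show ?case
    proof (cases "F = {}")
      case True
      then show ?thesis by (intro exI[of _ "{}"]) auto
    next
      case False
      then obtain x0 where x0: "x0 \<in> F" by blast
      have one: "card (V x \<inter> T) \<ge> 1" if "x \<in> F" for x
      proof -
        have "t0 \<in> V x \<inter> T" using t0 t0m Suc.prems(3)[OF that] by blast
        then show ?thesis using T1 by (metis One_nat_def Suc_leI card_gt_0_iff empty_iff finite_Int)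
      qed
      have tq: "q \<le> \<tau>" using Suc.prems(4)[OF x0] one[OF x0] by (metis le_trans mult.right_neutral mult_le_mono2)
      define cnt where "cnt b = card {x\<in>F. b \<in> V x}" for b
      have "\<exists>b\<in>T - {t0}. cnt b \<le> c"
      proof (rule ccontr)
        assume "\<not> ?thesis"
        then have big: "c + 1 \<le> cnt b" if "b \<in> T - {t0}" for b using that by force
        \<comment> \<open>Double counting of the pairs of a nonzero class \<open>b\<close> and a
          submodule containing it. If every class were in at least c + 1 submodules, the index bound
          would give q (c + 1) (\<tau> - 1) \<le> q (c + 1) (\<tau> - q), against q \<ge> 2 and
          \<tau> \<ge> q.\<close>
        have "(\<tau> - 1) * (c + 1) = (\<Sum>b\<in>T - {t0}. c + 1)" using t0 T1 by (simp add: \<tau>_def)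
        also have "\<dots> \<le> (\<Sum>b\<in>T - {t0}. cnt b)" by (rule sum_mono) (rule big)
        also have "\<dots> = (\<Sum>b\<in>T - {t0}. \<Sum>x\<in>F. if b \<in> V x then 1 else 0)"
          unfolding cnt_def using Suc.prems(1) by (simp add: sum.If_cases Int_def)
        also have "\<dots> = (\<Sum>x\<in>F. \<Sum>b\<in>T - {t0}. if b \<in> V x then 1 else 0)" by (rule sum.swap)
        also have "\<dots> = (\<Sum>x\<in>F. card (V x \<inter> T) - 1)"
        proof (rule sum.cong[OF refl])
          fix x assume x: "x \<in> F"
          have "(\<Sum>b\<in>T - {t0}. if b \<in> V x then 1 else 0) = card ((T - {t0}) \<inter> {b. b \<in> V x})"
            using T1 by (simp add: sum.If_cases)
          also have "(T - {t0}) \<inter> {b. b \<in> V x} = (V x \<inter> T) - {t0}" by blast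
          also have "card \<dots> = card (V x \<inter> T) - 1"
            using t0 t0m Suc.prems(3)[OF x] T1 by (intro card_Diff_singleton) auto
          finally show "(\<Sum>b\<in>T - {t0}. if b \<in> V x then 1 else 0) = card (V x \<inter> T) - 1" .
        qed
        finally have le: "(\<tau> - 1) * (c + 1) \<le> (\<Sum>x\<in>F. card (V x \<inter> T) - 1)" .
        have "q * ((\<tau> - 1) * (c + 1)) \<le> q * (\<Sum>x\<in>F. card (V x \<inter> T) - 1)" using le by simp
        also have "\<dots> = (\<Sum>x\<in>F. q * (card (V x \<inter> T) - 1))" by (simp add: sum_distrib_left)
        also have "\<dots> \<le> (\<Sum>x\<in>F. \<tau> - q)"
        proof (rule sum_mono)
          fix x assume "x \<in> F"
          then show "q * (card (V x \<inter> T) - 1) \<le> \<tau> - q" using Suc.prems(4)[of x] by (simp add: diff_mult_distrib2 diff_le_mono)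
        qed
        also have "\<dots> = card F * (\<tau> - q)" by simp
        also have "\<dots> \<le> q * (c + 1) * (\<tau> - q)" using Fle by (rule mult_le_mono1)
        finally have "q * ((\<tau> - 1) * (c + 1)) \<le> q * (c + 1) * (\<tau> - q)" .
        then have "(q * (c + 1)) * (\<tau> - 1) \<le> (q * (c + 1)) * (\<tau> - q)"
          by (simp only: mult.commute[of "\<tau> - 1"] mult.assoc)
        then have "\<tau> - 1 \<le> \<tau> - q" using q by (metis Suc_eq_plus1 mult_le_cancel1 nat_0_less_mult_iff zero_less_Suc less_le_trans zero_less_numeral)
        then show False using q tq by linarith
      qed
      then obtain b where b: "b \<in> T" "cnt b \<le> c" by blast
      let ?F = "{x\<in>F. b \<in> V x}"
      have "\<exists>S. finite S \<and> card S \<le> N \<and> S \<subseteq> I \<and> (\<forall>x\<in>?F. \<exists>b\<in>S. b \<notin> V x)"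
      proof (rule Suc.hyps)
        show "finite ?F" using Suc.prems(1) by simp
        show "card ?F \<le> (\<Sum>i=1..N. card E ^ i)" using b(2) by (simp add: cnt_def c_def q_def)
        show "ideal (V x) R \<and> V x \<subseteq> I \<and> V x \<noteq> I \<and> m \<cdot> I \<subseteq> V x" if "x \<in> ?F" for x
          using that Suc.prems(3)[of x] by simp
        show "q * card (V x \<inter> T) \<le> \<tau>" if "x \<in> ?F" for x using that Suc.prems(4)[of x] by simp
      qed
      then obtain S where S: "finite S" "card S \<le> N" "S \<subseteq> I" "\<And>x. x \<in> ?F \<Longrightarrow> \<exists>b\<in>S. b \<notin> V x" by blast
      have "card (insert b S) \<le> Suc N" using S(1,2) by (simp add: card_insert_if)
      moreover have "insert b S \<subseteq> I" using S b T1 by blast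
      moreover have "\<exists>b'\<in>insert b S. b' \<notin> V x" if "x \<in> F" for x using S(4)[of x] that by (cases "b \<in> V x") auto
      ultimately show ?thesis using S(1) by (intro exI[of _ "insert b S"]) auto
    qed
  qed
qed

text \<open>The submodules to be avoided are the degree-one parts \<open>W n 1\<close>, one for each
  maximal ideal of \<open>B\<close>: they are proper and contain m I.\<close>

lemma has_n_gen_reduction_regular:
  assumes tE: "transversal R m E"
    and I: "ideal I R" and s: "s \<in> I" "s \<in> nonzerodivisors R"
    and N: "card MaxB \<le> (\<Sum>i=1..N. card E ^ i)"
  shows "\<exists>S. finite S \<and> card S \<le> N \<and> S \<subseteq> I \<and> is_reduction R (Idl S) I"
proof -
  obtain h n y where d: "h > 0" "h \<le> n" "y \<in> ideal_pow R I h" "y \<in> nonzerodivisors R"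
    "\<And>c. c \<in> ideal_pow R I n \<Longrightarrow> \<exists>u\<in>ideal_pow R I (n - h). c = y \<otimes> u"
    using principal_power[OF I s] by blast
  interpret P: principal_power_data R m I s y h n
    by (intro principal_power_data.intro principal_power_data_axioms.intro reduced_local_ring_axioms I s d)
  have V: "ideal (P.W n 1) R \<and> P.W n 1 \<subseteq> I \<and> P.W n 1 \<noteq> I \<and> m \<cdot> I \<subseteq> P.W n 1" if n: "n \<in> MaxB" for n
  proof (intro conjI)
    show "ideal (P.W n 1) R" by (rule P.W_ideal[OF n])
    show "P.W n 1 \<subseteq> I" using ideal_pow_one[OF I] by (auto simp: P.W_def)
    show "P.W n 1 \<noteq> I" using P.W_proper[OF n] by blast
    show "m \<cdot> I \<subseteq> P.W n 1" using P.m_pow_subset_W[OF n, of 1] ideal_pow_one[OF I] by simp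
  qed
  obtain S where S: "finite S" "card S \<le> N" "S \<subseteq> I" "\<And>n. n \<in> MaxB \<Longrightarrow> \<exists>b\<in>S. b \<notin> P.W n 1"
    using avoid_proper_submodules[OF tE I s finite_MaxB N, of "\<lambda>n. P.W n 1"] V by blast
  then show ?thesis using P.reduction_of_avoiding[OF S(1,3,4)] by blast
qed

lemma ideal_prod_subset_mod:
  assumes "ideal V R" "ideal Y R" "ideal V' R" "ideal Y' R" "ideal K R"
    and "V \<subseteq> V' <+>\<^bsub>R\<^esub> K" "Y \<subseteq> Y' <+>\<^bsub>R\<^esub> K"
  shows "V \<cdot> Y \<subseteq> V' \<cdot> Y' <+>\<^bsub>R\<^esub> K"
proof (rule ideal_prod_subsetI)
  show id: "ideal (V' \<cdot> Y' <+>\<^bsub>R\<^esub> K) R" using assms ideal_prod_is_ideal add_ideals by blast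
  fix i j assume "i \<in> V" "j \<in> Y"
  then obtain p k p' k' where h: "p \<in> V'" "k \<in> K" "i = p \<oplus> k" "p' \<in> Y'" "k' \<in> K" "j = p' \<oplus> k'"
    using assms(6,7) by (meson ideal_addE subsetD)
  have c: "p \<in> carrier R" "k \<in> carrier R" "p' \<in> carrier R" "k' \<in> carrier R"
    using h assms ideal_carrier by blast+
  have "i \<otimes> j = p \<otimes> p' \<oplus> (p \<otimes> k' \<oplus> k \<otimes> (p' \<oplus> k'))" unfolding h(3,6) using c by algebra
  moreover have "p \<otimes> k' \<oplus> k \<otimes> (p' \<oplus> k') \<in> K"
    using h c assms(5) by (intro ideal_add_closed[OF assms(5)]) (auto simp: ideal.I_l_closed ideal.I_r_closed)
  ultimately show "i \<otimes> j \<in> V' \<cdot> Y' <+>\<^bsub>R\<^esub> K" using ideal_addI ideal_prod.prod h by metis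
qed

text \<open>An arbitrary ideal \<open>I\<close> is handled through the regular ideal \<open>I + ann I\<close>, in which
  the two summands are orthogonal.\<close>

lemma has_n_gen_reduction_all:
  assumes tE: "transversal R m E"
    and I: "ideal I R" and N: "card MaxB \<le> (\<Sum>i=1..N. card E ^ i)"
  shows "\<exists>S. finite S \<and> card S \<le> N \<and> S \<subseteq> I \<and> (\<exists>\<mu>. ideal_pow R I (Suc \<mu>) \<subseteq> (Idl S) \<cdot> ideal_pow R I \<mu>)"
proof -
  have Ic: "I \<subseteq> carrier R" using ideal_carrier[OF I] by blast
  define K where "K = ann I"
  have K: "ideal K R" unfolding K_def by (rule ann_ideal[OF Ic])
  define I' where "I' = I <+>\<^bsub>R\<^esub> K"
  have I': "ideal I' R" unfolding I'_def using I K by (rule add_ideals)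
  obtain s where s: "s \<in> I'" "s \<in> NZD" using add_ann_has_nonzerodivisor[OF I] unfolding I'_def K_def by blast
  obtain S' where S': "finite S'" "card S' \<le> N" "S' \<subseteq> I'" "is_reduction R (Idl S') I'"
    using has_n_gen_reduction_regular[OF tE I' s N] by blast
  have "\<forall>b\<in>S'. \<exists>x. x \<in> I \<and> (\<exists>k\<in>K. b = x \<oplus> k)" using S'(3) unfolding I'_def by (meson ideal_addE subsetD)
  then obtain f where f: "\<And>b. b \<in> S' \<Longrightarrow> f b \<in> I" "\<And>b. b \<in> S' \<Longrightarrow> \<exists>k\<in>K. b = f b \<oplus> k" by metis
  define S where "S = f ` S'"
  have S: "finite S" "card S \<le> N" "S \<subseteq> I" using S' f card_image_le[OF S'(1), of f] by (auto simp: S_def)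
  have Sc: "S \<subseteq> carrier R" using S Ic by blast
  define J where "J = Idl S"
  have J: "ideal J R" "J \<subseteq> I" using genideal_ideal[OF Sc] genideal_minimal[OF I S(3)] by (auto simp: J_def)
  have JK: "ideal (J <+>\<^bsub>R\<^esub> K) R" using J K add_ideals by blast
  have S'c: "S' \<subseteq> carrier R" using S' ideal_carrier[OF I'] by blast
  have J'sub: "Idl S' \<subseteq> J <+>\<^bsub>R\<^esub> K"
  proof (rule genideal_minimal[OF JK], rule subsetI)
    fix b assume b: "b \<in> S'"
    then obtain k where k: "k \<in> K" "b = f b \<oplus> k" using f(2) by blast
    have "f b \<in> J" using b genideal_self[OF Sc] by (auto simp: S_def J_def)
    then show "b \<in> J <+>\<^bsub>R\<^esub> K" using ideal_addI[OF _ k(1)] k(2) by metis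
  qed
  have pow: "ideal_pow R I' k \<subseteq> ideal_pow R I k <+>\<^bsub>R\<^esub> K" for k
  proof (induct k)
    case 0
    then show ?case using ideal_add_upper1[OF oneideal K] by simp
  next
    case (Suc k)
    then show ?case unfolding ideal_pow.simps
      by (intro ideal_prod_subset_mod I I' K ideal_pow_ideal) (simp_all add: I'_def)
  qed
  obtain \<mu> where mu: "ideal_pow R I' (Suc \<mu>) = (Idl S') \<cdot> ideal_pow R I' \<mu>"
    using S'(4) unfolding is_reduction_def by blast
  have JI: "J \<cdot> ideal_pow R I \<mu> \<subseteq> I"
    using ideal_prod_inter[OF J(1) ideal_pow_ideal[OF I], of \<mu>] J(2) by blast
  have "ideal_pow R I (Suc \<mu>) \<subseteq> J \<cdot> ideal_pow R I \<mu>"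
  proof
    fix a assume a: "a \<in> ideal_pow R I (Suc \<mu>)"
    have "I \<subseteq> I'" unfolding I'_def by (rule ideal_add_upper1[OF I K])
    then have "a \<in> (Idl S') \<cdot> ideal_pow R I' \<mu>" using a ideal_pow_mono mu by blast
    also have "\<dots> \<subseteq> J \<cdot> ideal_pow R I \<mu> <+>\<^bsub>R\<^esub> K"
      by (rule ideal_prod_subset_mod[OF genideal_ideal[OF S'c] ideal_pow_ideal[OF I'] J(1) ideal_pow_ideal[OF I] K J'sub pow])
    finally obtain u k where uk: "u \<in> J \<cdot> ideal_pow R I \<mu>" "k \<in> K" "a = u \<oplus> k" by (elim ideal_addE)
    have aI: "a \<in> I" using a ideal_pow_decreasing[OF I, of 1 "Suc \<mu>"] ideal_pow_one[OF I] by auto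
    have uI: "u \<in> I" using uk JI by blast
    have c: "a \<in> carrier R" "u \<in> carrier R" "k \<in> carrier R" using aI uI uk Ic ideal_carrier[OF K] by blast+
    \<comment> \<open>The error \<open>k\<close> lies in \<open>I\<close> as well as in
      \<open>ann I\<close>, so its square is zero and reducedness removes it.\<close>
    have "(u \<oplus> k) \<ominus> u = k" using c by algebra
    then have "k \<in> I" using ideal_diff_closed[OF I aI uI] uk(3) by simp
    then have "k \<otimes> k = \<zero>" using uk(2) by (simp add: K_def ann_def)
    then have "k = \<zero>" using reduced c by blast
    then show "a \<in> J \<cdot> ideal_pow R I \<mu>" using uk c by simp
  qed
  then show ?thesis using S unfolding J_def by blast
qed

end

section \<open>Lower bound\<close>

lemma card_PiE_const: "finite I \<Longrightarrow> card (PiE I (\<lambda>_. E)) = card E ^ card I"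
  by (simp add: card_PiE)

context reduced_local_ring
begin

text \<open>Normalised representatives of the points of the projective \<open>n\<close>-space over the residue field:
  the first nonzero coordinate is one.\<close>

definition points :: "'a set \<Rightarrow> nat \<Rightarrow> (nat \<Rightarrow> 'a) set" where
  "points E n = {v \<in> PiE {..n} (\<lambda>_. E). \<exists>j\<le>n. (\<forall>i<j. v i \<in> m) \<and> v j \<ominus> \<one> \<in> m}"

text \<open>If the normalised coordinate is the \<open>j\<close>-th, the entries up to
  \<open>j\<close> are forced, being the representatives of 0 and 1 in \<open>E\<close>. The entries
  after it leave at most |E|^(n-j) choices.\<close>

lemma card_points:
  assumes tE: "transversal R m E"
  shows "card (points E n) \<le> (\<Sum>i\<le>n. card E ^ i)" and "finite (points E n)"
proof -
  note E = transversalD[OF tE]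
  define P where "P j = {v \<in> PiE {..n} (\<lambda>_. E). (\<forall>i<j. v i \<in> m) \<and> v j \<ominus> \<one> \<in> m}" for j
  have eq: "points E n = (\<Union>j\<le>n. P j)" unfolding points_def P_def by blast
  have finPi: "finite (PiE {..n} (\<lambda>_. E))" using E(1) by (simp add: finite_PiE)
  show "finite (points E n)" unfolding points_def using finPi by simp
  have cP: "card (P j) \<le> card E ^ (n - j)" if j: "j \<le> n" for j
  proof -
    let ?r = "\<lambda>v. restrict v {j<..n}"
    have "inj_on ?r (P j)"
    proof (rule inj_onI)
      fix v w assume v: "v \<in> P j" and w: "w \<in> P j" and e: "?r v = ?r w"
      have vE: "v \<in> PiE {..n} (\<lambda>_. E)" "w \<in> PiE {..n} (\<lambda>_. E)" using v w by (auto simp: P_def)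
      have "v i = w i" if i: "i \<in> {..n}" for i
      proof -
        have iE: "v i \<in> E" "w i \<in> E" using vE i by (auto simp: PiE_def)
        have ic: "v i \<in> carrier R" "w i \<in> carrier R" using iE E by auto
        consider "i < j" | "i = j" | "i \<in> {j<..n}" using i by force
        then show ?thesis
        proof cases
          case 1
          then have "v i \<in> m" "w i \<in> m" using v w by (auto simp: P_def)
          then show ?thesis using E(4)[OF iE] ideal_diff_closed[OF ideal_m] by blast
        next
          case 2
          then have "v i \<ominus> \<one> \<in> m" "w i \<ominus> \<one> \<in> m" using v w by (auto simp: P_def)
          then have "(v i \<ominus> \<one>) \<ominus> (w i \<ominus> \<one>) \<in> m" by (rule ideal_diff_closed[OF ideal_m])
          moreover have "(v i \<ominus> \<one>) \<ominus> (w i \<ominus> \<one>) = v i \<ominus> w i" using ic by algebra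
          ultimately show ?thesis using E(4)[OF iE] by simp
        next
          case 3
          then show ?thesis using fun_cong[OF e, of i] by simp
        qed
      qed
      then show "v = w" using PiE_ext[OF vE] by blast
    qed
    moreover have "?r v \<in> PiE {j<..n} (\<lambda>_. E)" if "v \<in> P j" for v
      using that by (auto simp: P_def PiE_def Pi_def)
    then have "?r ` P j \<subseteq> PiE {j<..n} (\<lambda>_. E)" by blast
    ultimately have "card (P j) \<le> card (PiE {j<..n} (\<lambda>_. E))"
      using E(1) by (intro card_inj_on_le[of ?r]) (auto simp: finite_PiE)
    then show ?thesis using card_PiE_const[of "{j<..n}" E] by simp
  qed
  have "card (points E n) \<le> (\<Sum>j\<le>n. card (P j))" unfolding eq by (rule card_UN_le) simp
  also have "\<dots> \<le> (\<Sum>j\<le>n. card E ^ (n - j))" by (rule sum_mono) (use cP in simp)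
  also have "\<dots> = (\<Sum>i\<le>n. card E ^ i)"
    by (rule sum.reindex_bij_witness[of _ "\<lambda>i. n - i" "\<lambda>i. n - i"]) auto
  finally show "card (points E n) \<le> (\<Sum>i\<le>n. card E ^ i)" .
qed

text \<open>There are q^(n+1) vectors over the residue field but at most q^n tuples of values, where
  q = |E|. Two vectors with equal values have a nonzero difference on which all forms vanish;
  scaling by the inverse of its first nonzero coordinate gives a normalised point.\<close>

lemma linear_forms_common_zero:
  assumes tE: "transversal R m E"
    and S: "finite S" "card S \<le> n" and r: "\<And>b j. b \<in> S \<Longrightarrow> r b j \<in> carrier R"
  shows "\<exists>v\<in>points E n. \<forall>b\<in>S. finsum R (\<lambda>j. r b j \<otimes> v j) {..<Suc n} \<in> m"
proof -
  note E = transversalD[OF tE]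
  obtain rep where rep: "\<And>a. a \<in> carrier R \<Longrightarrow> rep a \<in> E" "\<And>a. a \<in> carrier R \<Longrightarrow> a \<ominus> rep a \<in> m" using E(3) by metis
  define q where "q = card E"
  have q: "q \<ge> 2" unfolding q_def by (rule transversal_card_ge_2[OF tE])
  define lam where "lam b v = finsum R (\<lambda>j. r b j \<otimes> v j) {..<Suc n}" for b v
  have vc: "v j \<in> carrier R" if "v \<in> PiE {..n} (\<lambda>_. E)" "j < Suc n" for v j
    using that E(2) by (auto simp: PiE_def Pi_def less_Suc_eq_le)
  have lamc: "lam b v \<in> carrier R" if "v \<in> PiE {..n} (\<lambda>_. E)" "b \<in> S" for b v
    unfolding lam_def using vc[OF that(1)] r[OF that(2)] by (intro finsum_closed) auto
  define Phi where "Phi v = restrict (\<lambda>b. rep (lam b v)) S" for v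
  have "\<not> inj_on Phi (PiE {..n} (\<lambda>_. E))"
  proof
    assume inj: "inj_on Phi (PiE {..n} (\<lambda>_. E))"
    have "Phi v \<in> PiE S (\<lambda>_. E)" if "v \<in> PiE {..n} (\<lambda>_. E)" for v
      unfolding Phi_def using rep(1)[OF lamc[OF that]] by (auto simp: PiE_def Pi_def)
    then have "Phi ` PiE {..n} (\<lambda>_. E) \<subseteq> PiE S (\<lambda>_. E)" by blast
    then have "card (PiE {..n} (\<lambda>_. E)) \<le> card (PiE S (\<lambda>_. E))"
      using inj E(1) S(1) by (intro card_inj_on_le[of Phi]) (auto simp: finite_PiE)
    then have "q ^ Suc n \<le> q ^ card S" using card_PiE_const[of "{..n}" E] card_PiE_const[OF S(1), of E] by (simp add: q_def)
    then have "Suc n \<le> card S" using q by (simp add: power_increasing_iff del: power_Suc)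
    then show False using S(2) by simp
  qed
  then obtain v w where vw: "v \<in> PiE {..n} (\<lambda>_. E)" "w \<in> PiE {..n} (\<lambda>_. E)" "v \<noteq> w" "Phi v = Phi w"
    unfolding inj_on_def by blast
  have "\<exists>j. j \<le> n \<and> v j \<ominus> w j \<notin> m"
  proof -
    obtain j where j: "j \<in> {..n}" "v j \<noteq> w j" using vw PiE_ext[OF vw(1,2)] by blast
    have "v j \<in> E" "w j \<in> E" using vw j by (auto simp: PiE_def)
    then show ?thesis using E(4) j by (intro exI[of _ j]) auto
  qed
  \<comment> \<open>The least index at which \<open>v\<close> and \<open>w\<close> differ modulo
    \<open>m\<close> becomes the normalising coordinate.\<close>
  then obtain j where j: "j \<le> n" "v j \<ominus> w j \<notin> m" and least: "\<And>i. i < j \<Longrightarrow> \<not> (i \<le> n \<and> v i \<ominus> w i \<notin> m)"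
    using exists_least_iff[of "\<lambda>j. j \<le> n \<and> v j \<ominus> w j \<notin> m"] by blast
  have vwc: "v i \<in> carrier R" "w i \<in> carrier R" if "i \<le> n" for i using vc vw that by auto
  have U: "v j \<ominus> w j \<in> Units R" using not_in_m_Unit j vwc by simp
  define z where "z = inv (v j \<ominus> w j)"
  have zc: "z \<in> carrier R" using U by (simp add: z_def)
  define u where "u = restrict (\<lambda>i. rep (z \<otimes> (v i \<ominus> w i))) {..n}"
  have zdc: "z \<otimes> (v i \<ominus> w i) \<in> carrier R" if "i \<le> n" for i using zc vwc[OF that] by simp
  have uE: "u \<in> PiE {..n} (\<lambda>_. E)" unfolding u_def using rep(1)[OF zdc] by auto
  have uc: "u i \<in> carrier R" if "i \<le> n" for i using vc[OF uE] that by auto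
  have um: "z \<otimes> (v i \<ominus> w i) \<ominus> u i \<in> m" if "i \<le> n" for i using rep(2)[OF zdc[OF that]] that by (simp add: u_def)
  have "u \<in> points E n"
    unfolding points_def
  proof (intro CollectI conjI exI[of _ j] allI impI)
    show "u \<in> PiE {..n} (\<lambda>_. E)" by (rule uE)
    show "j \<le> n" by fact
    show "u i \<in> m" if "i < j" for i
    proof -
      have i: "i \<le> n" using that j by simp
      have "v i \<ominus> w i \<in> m" using least[OF that] i by blast
      then have "z \<otimes> (v i \<ominus> w i) \<in> m" using zc ideal_m by (simp add: ideal.I_l_closed)
      then have "z \<otimes> (v i \<ominus> w i) \<ominus> (z \<otimes> (v i \<ominus> w i) \<ominus> u i) \<in> m" using um[OF i] by (rule ideal_diff_closed[OF ideal_m])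
      moreover have "p \<ominus> (p \<ominus> u i) = u i" if "p \<in> carrier R" for p using that uc[OF i] by algebra
      ultimately show ?thesis using zdc[OF i] by simp
    qed
    have "z \<otimes> (v j \<ominus> w j) = \<one>" using U by (simp add: z_def)
    then have "\<one> \<ominus> u j \<in> m" using um[OF j(1)] by simp
    moreover have "u j \<ominus> \<one> = \<ominus> (\<one> \<ominus> u j)" using uc[OF j(1)] by algebra
    ultimately show "u j \<ominus> \<one> \<in> m" using ideal_m by (simp add: additive_subgroup.a_inv_closed ideal.axioms(1))
  qed
  moreover have "finsum R (\<lambda>j. r b j \<otimes> u j) {..<Suc n} \<in> m" if b: "b \<in> S" for b
  proof -
    have rc: "r b i \<in> carrier R" for i using r b by blast
    have dm: "lam b v \<ominus> lam b w \<in> m"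
    proof -
      have "rep (lam b v) = rep (lam b w)" using fun_cong[OF vw(4), of b] b by (simp add: Phi_def)
      then have "(lam b v \<ominus> rep (lam b v)) \<ominus> (lam b w \<ominus> rep (lam b v)) \<in> m"
        using rep(2)[OF lamc[OF vw(1) b]] rep(2)[OF lamc[OF vw(2) b]] ideal_diff_closed[OF ideal_m] by simp
      moreover have "(p \<ominus> e) \<ominus> (p' \<ominus> e) = p \<ominus> p'" if "p \<in> carrier R" "p' \<in> carrier R" "e \<in> carrier R" for p p' e
        using that by algebra
      ultimately show ?thesis using lamc[OF vw(1) b] lamc[OF vw(2) b] rep(1)[OF lamc[OF vw(1) b]] E(2) by auto
    qed
    \<comment> \<open>Replacing z (v - w) by its representatives \<open>u\<close> changes each
      summand by an element of \<open>m\<close>. The induction on the number of summands carries the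
      closure facts along.\<close>
    have "finsum R (\<lambda>j. r b j \<otimes> u j) {..<k} \<in> carrier R \<and> finsum R (\<lambda>j. r b j \<otimes> v j) {..<k} \<in> carrier R \<and>
      finsum R (\<lambda>j. r b j \<otimes> w j) {..<k} \<in> carrier R \<and>
      z \<otimes> (finsum R (\<lambda>j. r b j \<otimes> v j) {..<k} \<ominus> finsum R (\<lambda>j. r b j \<otimes> w j) {..<k}) \<ominus> finsum R (\<lambda>j. r b j \<otimes> u j) {..<k} \<in> m"
      if "k \<le> Suc n" for k
      using that
    proof (induct k)
      case 0
      have "z \<otimes> (\<zero> \<ominus> \<zero>) \<ominus> \<zero> = \<zero>" using zc by algebra
      then show ?case using ideal_zero_closed[OF ideal_m] by simp
    next
      case (Suc k)
      have k: "k \<le> n" using Suc.prems by simp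
      define A where "A = finsum R (\<lambda>j. r b j \<otimes> u j) {..<k}"
      define A' where "A' = finsum R (\<lambda>j. r b j \<otimes> v j) {..<k}"
      define A'' where "A'' = finsum R (\<lambda>j. r b j \<otimes> w j) {..<k}"
      have IH: "A \<in> carrier R" "A' \<in> carrier R" "A'' \<in> carrier R" "z \<otimes> (A' \<ominus> A'') \<ominus> A \<in> m"
        using Suc unfolding A_def A'_def A''_def by auto
      have step: "finsum R (\<lambda>j. r b j \<otimes> x j) {..<Suc k} = r b k \<otimes> x k \<oplus> finsum R (\<lambda>j. r b j \<otimes> x j) {..<k}"
        if "\<And>i. i \<le> n \<Longrightarrow> x i \<in> carrier R" for x
        unfolding lessThan_Suc using that rc k by (intro finsum_insert) auto
      have s: "finsum R (\<lambda>j. r b j \<otimes> u j) {..<Suc k} = r b k \<otimes> u k \<oplus> A"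
        "finsum R (\<lambda>j. r b j \<otimes> v j) {..<Suc k} = r b k \<otimes> v k \<oplus> A'"
        "finsum R (\<lambda>j. r b j \<otimes> w j) {..<Suc k} = r b k \<otimes> w k \<oplus> A''"
        unfolding A_def A'_def A''_def using step uc vwc by blast+
      note c = IH(1-3) rc[of k] zc uc[OF k] vwc[OF k]
      have "z \<otimes> ((r b k \<otimes> v k \<oplus> A') \<ominus> (r b k \<otimes> w k \<oplus> A'')) \<ominus> (r b k \<otimes> u k \<oplus> A)
        = r b k \<otimes> (z \<otimes> (v k \<ominus> w k) \<ominus> u k) \<oplus> (z \<otimes> (A' \<ominus> A'') \<ominus> A)" using c by algebra
      moreover have "\<dots> \<in> m"
        using um[OF k] IH(4) rc ideal_m by (intro ideal_add_closed[OF ideal_m]) (auto simp: ideal.I_l_closed)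
      ultimately show ?case unfolding s using c by simp
    qed
    from this[of "Suc n"] have h: "finsum R (\<lambda>j. r b j \<otimes> u j) {..<Suc n} \<in> carrier R"
      "z \<otimes> (lam b v \<ominus> lam b w) \<ominus> finsum R (\<lambda>j. r b j \<otimes> u j) {..<Suc n} \<in> m"
      unfolding lam_def by auto
    have zm: "z \<otimes> (lam b v \<ominus> lam b w) \<in> m" using dm zc ideal_m by (simp add: ideal.I_l_closed)
    define A where "A = finsum R (\<lambda>j. r b j \<otimes> u j) {..<Suc n}"
    have Ac: "A \<in> carrier R" using h(1) by (simp only: A_def)
    have "p \<ominus> (p \<ominus> A) = A" if "p \<in> carrier R" for p using that Ac by algebra
    then have "z \<otimes> (lam b v \<ominus> lam b w) \<ominus> (z \<otimes> (lam b v \<ominus> lam b w) \<ominus> A) = A"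
      using zm m_carrier by blast
    then show ?thesis using ideal_diff_closed[OF ideal_m zm h(2)] by (simp add: A_def)
  qed
  ultimately show ?thesis by blast
qed

text \<open>Interpolation with Chinese remainder elements as coefficients: modulo \<open>n\<close>
  every term except the one for \<open>n\<close> vanishes.\<close>

lemma MaxB_interpolation:
  assumes p: "\<And>n. n \<in> MaxB \<Longrightarrow> p n \<in> carrier R"
  shows "\<exists>f\<in>B. \<forall>n\<in>MaxB. f \<ominus>\<^bsub>Q\<^esub> emb (p n) \<in> n"
proof -
  obtain e where e: "\<And>n. n \<in> MaxB \<Longrightarrow> e n \<in> B" "\<And>n. n \<in> MaxB \<Longrightarrow> e n \<ominus>\<^bsub>Q\<^esub> \<one>\<^bsub>Q\<^esub> \<in> n"
    "\<And>n n'. n \<in> MaxB \<Longrightarrow> n' \<in> MaxB \<Longrightarrow> n \<noteq> n' \<Longrightarrow> e n \<in> n'" using MaxB_CRT[OF finite_MaxB subset_refl] by blast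
  have termB: "emb (p n) \<otimes>\<^bsub>Q\<^esub> e n \<in> B" if "n \<in> MaxB" for n using B_mult[OF B_emb[OF p[OF that]] e(1)[OF that]] .
  have sum: "finsum Q f F \<in> V" if "finite F" "\<And>x. x \<in> F \<Longrightarrow> f x \<in> V" "\<zero>\<^bsub>Q\<^esub> \<in> V"
    "\<And>x y. x \<in> V \<Longrightarrow> y \<in> V \<Longrightarrow> x \<oplus>\<^bsub>Q\<^esub> y \<in> V" "V \<subseteq> carrier Q" for f :: "('a \<times> 'a) set set \<Rightarrow> _" and F V
    using that(1,2)
  proof (induct F rule: finite_induct)
    case (insert x F)
    have "finsum Q f (insert x F) = f x \<oplus>\<^bsub>Q\<^esub> finsum Q f F"
      using insert that(5) by (intro Q.finsum_insert) auto
    then show ?case using insert that(4) by simp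
  qed (use that(3) in simp)
  define f where "f = finsum Q (\<lambda>n. emb (p n) \<otimes>\<^bsub>Q\<^esub> e n) MaxB"
  have "f \<in> B" unfolding f_def using termB B_zero B_add B_carrier by (intro sum[OF finite_MaxB]) auto
  moreover have "f \<ominus>\<^bsub>Q\<^esub> emb (p n) \<in> n" if n: "n \<in> MaxB" for n
  proof -
    define g where "g = finsum Q (\<lambda>n. emb (p n) \<otimes>\<^bsub>Q\<^esub> e n) (MaxB - {n})"
    have gn: "g \<in> n" unfolding g_def
    proof (rule sum)
      show "emb (p x) \<otimes>\<^bsub>Q\<^esub> e x \<in> n" if "x \<in> MaxB - {n}" for x
        using that MaxB_mult_l[OF n B_emb[OF p] e(3)[OF _ n]] by blast
      show "n \<subseteq> carrier Q" using MaxB_carrier[OF n] by blast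
    qed (use finite_MaxB MaxB_zero[OF n] MaxB_add[OF n] in auto)
    have "f = finsum Q (\<lambda>n. emb (p n) \<otimes>\<^bsub>Q\<^esub> e n) (insert n (MaxB - {n}))" unfolding f_def using n by (simp add: insert_absorb)
    also have "\<dots> = emb (p n) \<otimes>\<^bsub>Q\<^esub> e n \<oplus>\<^bsub>Q\<^esub> g" unfolding g_def
      using finite_MaxB B_carrier[OF termB] n by (intro Q.finsum_insert) auto
    finally have f: "f = emb (p n) \<otimes>\<^bsub>Q\<^esub> e n \<oplus>\<^bsub>Q\<^esub> g" .
    have 1: "emb (p n) \<otimes>\<^bsub>Q\<^esub> (e n \<ominus>\<^bsub>Q\<^esub> \<one>\<^bsub>Q\<^esub>) \<in> n" using MaxB_mult_l[OF n B_emb[OF p[OF n]] e(2)[OF n]] .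
    have "emb (p n) \<otimes>\<^bsub>Q\<^esub> (e n \<ominus>\<^bsub>Q\<^esub> \<one>\<^bsub>Q\<^esub>) \<oplus>\<^bsub>Q\<^esub> g = f \<ominus>\<^bsub>Q\<^esub> emb (p n)" unfolding f
      using B_carrier[OF e(1)[OF n]] emb.hom_closed[OF p[OF n]] MaxB_carrier[OF n gn]
      by (simp add: a_minus_def Q.r_distr Q.r_minus Q.a_ac)
    then show ?thesis using MaxB_add[OF n 1 gn] by simp
  qed
  ultimately show ?thesis by blast
qed

lemma scaled_prod:
  assumes d: "d \<in> carrier R" "d' \<in> carrier R" and V: "V \<subseteq> B" and K: "ideal (scaled (d \<otimes> d') V) R"
    and mult: "\<And>b x. b \<in> B \<Longrightarrow> x \<in> V \<Longrightarrow> x \<otimes>\<^bsub>Q\<^esub> b \<in> V"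
  shows "scaled d V \<cdot> scaled d' B \<subseteq> scaled (d \<otimes> d') V"
proof (rule ideal_prod_subsetI[OF K])
  fix i j assume "i \<in> scaled d V" "j \<in> scaled d' B"
  then obtain x b where h: "i \<in> carrier R" "x \<in> V" "emb i = emb d \<otimes>\<^bsub>Q\<^esub> x"
    "j \<in> carrier R" "b \<in> B" "emb j = emb d' \<otimes>\<^bsub>Q\<^esub> b" unfolding scaled_def by blast
  have c: "x \<in> carrier Q" "b \<in> carrier Q" using h V B_carrier by blast+
  have "emb (i \<otimes> j) = emb (d \<otimes> d') \<otimes>\<^bsub>Q\<^esub> (x \<otimes>\<^bsub>Q\<^esub> b)" using h c d by (simp add: Q.m_ac)
  then show "i \<otimes> j \<in> scaled (d \<otimes> d') V" using h mult unfolding scaled_def by blast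
qed

lemma exists_ideal_without_reduction:
  assumes tE: "transversal R m E"
    and big: "(\<Sum>i\<le>n. card E ^ i) \<le> card MaxB"
  shows "\<exists>I. ideal I R \<and> \<not> has_n_gen_reduction R n I"
proof -
  note E = transversalD[OF tE]
  have "card (points E n) \<le> card MaxB" using card_points(1)[OF tE, of n] big by simp
  then obtain \<iota> where iota: "inj_on \<iota> (points E n)" "\<iota> ` points E n \<subseteq> MaxB"
    using card_le_inj[OF card_points(2)[OF tE] finite_MaxB] by blast
  have Pne: "points E n \<noteq> {}"
    using linear_forms_common_zero[OF tE, of "{}" n "\<lambda>_ _. \<zero>"] by auto
  then obtain v0 where v0: "v0 \<in> points E n" by blast
  \<comment> \<open>\<open>p\<close> inverts the injection \<open>\<iota>\<close>, so that every
    point occurs at some maximal ideal; maximal ideals outside its image receive the default point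
    \<open>v0\<close>.\<close>
  define p where "p \<nu> = (if \<nu> \<in> \<iota> ` points E n then the_inv_into (points E n) \<iota> \<nu> else v0)" for \<nu>
  have p: "p \<nu> \<in> points E n" for \<nu>
    unfolding p_def using v0 the_inv_into_into[OF iota(1), of \<nu> "points E n"] by simp
  have psurj: "\<exists>\<nu>\<in>MaxB. p \<nu> = v" if "v \<in> points E n" for v
  proof (rule bexI[of _ "\<iota> v"])
    show "p (\<iota> v) = v" unfolding p_def using that the_inv_into_f_f[OF iota(1) that] by simp
    show "\<iota> v \<in> MaxB" using that iota(2) by blast
  qed
  have pc: "v j \<in> carrier R" if "v \<in> points E n" "j \<le> n" for v j
    using that E(2) by (auto simp: points_def PiE_def Pi_def)
  have "\<exists>f. j \<le> n \<longrightarrow> f \<in> B \<and> (\<forall>\<nu>\<in>MaxB. f \<ominus>\<^bsub>Q\<^esub> emb (p \<nu> j) \<in> \<nu>)" for j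
    using MaxB_interpolation[of "\<lambda>\<nu>. p \<nu> j"] pc[OF p] by blast
  then obtain f where f: "\<And>j. j \<le> n \<Longrightarrow> f j \<in> B" "\<And>j \<nu>. j \<le> n \<Longrightarrow> \<nu> \<in> MaxB \<Longrightarrow> f j \<ominus>\<^bsub>Q\<^esub> emb (p \<nu> j) \<in> \<nu>"
    by metis
  have "f ` {..n} \<subseteq> carrier Q" using f(1) B_carrier by blast
  then obtain d where d: "d \<in> NZD" "\<And>j. j \<le> n \<Longrightarrow> emb d \<otimes>\<^bsub>Q\<^esub> f j \<in> A0"
    using common_denominator[of "f ` {..n}"] by blast
  note dc = nzd_carrier[OF d(1)]
  have "\<forall>j. \<exists>a. j \<le> n \<longrightarrow> a \<in> carrier R \<and> emb d \<otimes>\<^bsub>Q\<^esub> f j = emb a" using d(2) by blast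
  then obtain a where a: "\<And>j. j \<le> n \<Longrightarrow> a j \<in> carrier R" "\<And>j. j \<le> n \<Longrightarrow> emb d \<otimes>\<^bsub>Q\<^esub> f j = emb (a j)" by metis
  define I where "I = Idl (a ` {..<Suc n})"
  have ac: "a ` {..<Suc n} \<subseteq> carrier R" using a(1) by auto
  have I: "ideal I R" unfolding I_def by (rule genideal_ideal[OF ac])
  have aI: "a j \<in> I" if "j \<le> n" for j using genideal_self[OF ac] that by (auto simp: I_def)
  note scB = scaled_ideal[OF _ subset_refl B_zero B_add B_mult]
  have "a j \<in> scaled d B" if "j \<le> n" for j
    unfolding scaled_def using a(1)[OF that] a(2)[OF that, symmetric] f(1)[OF that] by blast
  then have Isub: "I \<subseteq> scaled d B" unfolding I_def by (intro genideal_minimal[OF scB[OF dc]]) auto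
  have Ipow: "ideal_pow R I \<mu> \<subseteq> scaled (d [^] \<mu>) B" for \<mu>
  proof (induct \<mu>)
    case 0
    have "x \<in> scaled \<one> B" if "x \<in> carrier R" for x
      unfolding scaled_def using that B_emb[OF that] by force
    then show ?case by auto
  next
    case (Suc \<mu>)
    have "ideal_pow R I (Suc \<mu>) \<subseteq> scaled d B \<cdot> scaled (d [^] \<mu>) B"
      unfolding ideal_pow.simps by (rule ideal_prod_mono[OF Isub Suc])
    also have "\<dots> \<subseteq> scaled (d \<otimes> d [^] \<mu>) B"
      by (rule scaled_prod[OF dc _ subset_refl scB]) (use dc B_mult in auto)
    finally show ?case using dc by (simp add: m_comm)
  qed
  have "\<not> has_n_gen_reduction R n I"
  proof
    assume "has_n_gen_reduction R n I"
    then obtain J S where J: "is_reduction R J I" and S: "finite S" "card S \<le> n" "S \<subseteq> carrier R" "J = Idl S"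
      unfolding has_n_gen_reduction_def n_generated_def by blast
    have JI: "J \<subseteq> I" "ideal J R" using J unfolding is_reduction_def by auto
    obtain \<mu> where mu: "ideal_pow R I (Suc \<mu>) = J \<cdot> ideal_pow R I \<mu>" using J unfolding is_reduction_def by blast
    have SI: "S \<subseteq> I" using S JI genideal_self[OF S(3)] by blast
    have "\<exists>c. (\<forall>i. c i \<in> carrier R) \<and> b = finsum R (\<lambda>i. c i \<otimes> a i) {..<Suc n}" if "b \<in> S" for b
      using Idl_image_finsum[of "Suc n" a b] a(1) SI that unfolding I_def by (metis less_Suc_eq_le subsetD)
    then obtain r where r: "\<And>b i. b \<in> S \<Longrightarrow> r b i \<in> carrier R" "\<And>b. b \<in> S \<Longrightarrow> b = finsum R (\<lambda>i. r b i \<otimes> a i) {..<Suc n}"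
      by metis
    obtain v where v: "v \<in> points E n" "\<And>b. b \<in> S \<Longrightarrow> finsum R (\<lambda>j. r b j \<otimes> v j) {..<Suc n} \<in> m"
      using linear_forms_common_zero[OF tE S(1,2), of r] r(1) by blast
    obtain \<nu> where nu: "\<nu> \<in> MaxB" "p \<nu> = v" using psurj[OF v(1)] by blast
    have fv: "f j \<ominus>\<^bsub>Q\<^esub> emb (v j) \<in> \<nu>" if "j \<le> n" for j using f(2)[OF that nu(1)] nu(2) by simp
    have nuB: "\<nu> \<subseteq> B" using MaxB_B[OF nu(1)] by blast
    note scN = scaled_ideal[OF _ nuB MaxB_zero[OF nu(1)] MaxB_add[OF nu(1)] MaxB_mult_l[OF nu(1)]]
    \<comment> \<open>Written as d x, an element \<open>b\<close> has \<open>x\<close> congruent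
      modulo \<open>\<nu>\<close> to the value of its linear form at \<open>v\<close>. That value
      lies in \<open>m\<close>, hence in \<open>\<nu>\<close>.\<close>
    have bS: "b \<in> scaled d \<nu>" if b: "b \<in> S" for b
    proof -
      have rc: "r b i \<in> carrier R" for i using r b by blast
      have "finsum R (\<lambda>j. r b j \<otimes> a j) {..<k} \<in> carrier R \<and> finsum R (\<lambda>j. r b j \<otimes> v j) {..<k} \<in> carrier R \<and>
        (\<exists>x\<in>B. emb (finsum R (\<lambda>j. r b j \<otimes> a j) {..<k}) = emb d \<otimes>\<^bsub>Q\<^esub> x \<and> x \<ominus>\<^bsub>Q\<^esub> emb (finsum R (\<lambda>j. r b j \<otimes> v j) {..<k}) \<in> \<nu>)"
        if "k \<le> Suc n" for k
        using that
      proof (induct k)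
        case 0
        then show ?case using MaxB_zero[OF nu(1)] B_zero dc
          by (auto intro!: exI[of _ "\<zero>\<^bsub>Q\<^esub>"] simp: a_minus_def)
      next
        case (Suc k)
        have k: "k \<le> n" using Suc.prems by simp
        define A where "A = finsum R (\<lambda>j. r b j \<otimes> a j) {..<k}"
        define A' where "A' = finsum R (\<lambda>j. r b j \<otimes> v j) {..<k}"
        obtain x where IH: "A \<in> carrier R" "A' \<in> carrier R" "x \<in> B" "emb A = emb d \<otimes>\<^bsub>Q\<^esub> x" "x \<ominus>\<^bsub>Q\<^esub> emb A' \<in> \<nu>"
          using Suc unfolding A_def A'_def by auto
        have s: "finsum R (\<lambda>j. r b j \<otimes> a j) {..<Suc k} = r b k \<otimes> a k \<oplus> A"
          "finsum R (\<lambda>j. r b j \<otimes> v j) {..<Suc k} = r b k \<otimes> v k \<oplus> A'"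
          unfolding A_def A'_def lessThan_Suc using rc a(1) pc[OF v(1)] k by (intro finsum_insert; auto)+
        define x' where "x' = emb (r b k) \<otimes>\<^bsub>Q\<^esub> f k \<oplus>\<^bsub>Q\<^esub> x"
        have x'B: "x' \<in> B" unfolding x'_def by (rule B_add[OF B_mult[OF B_emb[OF rc] f(1)[OF k]] IH(3)])
        note c = B_carrier[OF f(1)[OF k]] B_carrier[OF IH(3)] emb.hom_closed[OF rc[of k]] emb.hom_closed[OF pc[OF v(1) k]]
          emb.hom_closed[OF IH(2)] emb.hom_closed[OF dc]
        have "emb (r b k \<otimes> a k \<oplus> A) = emb (r b k) \<otimes>\<^bsub>Q\<^esub> (emb d \<otimes>\<^bsub>Q\<^esub> f k) \<oplus>\<^bsub>Q\<^esub> emb d \<otimes>\<^bsub>Q\<^esub> x"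
          using rc a[OF k] IH by simp
        also have "\<dots> = emb d \<otimes>\<^bsub>Q\<^esub> x'" unfolding x'_def using c by (simp add: Q.r_distr Q.m_ac)
        finally have 1: "emb (r b k \<otimes> a k \<oplus> A) = emb d \<otimes>\<^bsub>Q\<^esub> x'" .
        have "x' \<ominus>\<^bsub>Q\<^esub> emb (r b k \<otimes> v k \<oplus> A') = emb (r b k) \<otimes>\<^bsub>Q\<^esub> (f k \<ominus>\<^bsub>Q\<^esub> emb (v k)) \<oplus>\<^bsub>Q\<^esub> (x \<ominus>\<^bsub>Q\<^esub> emb A')"
          unfolding x'_def using c rc pc[OF v(1) k] IH(2)
          by (simp add: a_minus_def Q.r_distr Q.r_minus Q.minus_add Q.a_ac)
        also have "\<dots> \<in> \<nu>" by (rule MaxB_add[OF nu(1) MaxB_mult_l[OF nu(1) B_emb[OF rc] fv[OF k]] IH(5)])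
        finally have 2: "x' \<ominus>\<^bsub>Q\<^esub> emb (r b k \<otimes> v k \<oplus> A') \<in> \<nu>" .
        show ?case unfolding s using 1 2 x'B rc a(1)[OF k] IH pc[OF v(1) k] by blast
      qed
      from this[of "Suc n"] obtain x where x: "x \<in> B" "emb b = emb d \<otimes>\<^bsub>Q\<^esub> x"
        "x \<ominus>\<^bsub>Q\<^esub> emb (finsum R (\<lambda>j. r b j \<otimes> v j) {..<Suc n}) \<in> \<nu>" using r(2)[OF b] by auto
      define w where "w = emb (finsum R (\<lambda>j. r b j \<otimes> v j) {..<Suc n})"
      have wn: "w \<in> \<nu>" unfolding w_def using MaxB_lies_over[OF nu(1) v(2)[OF b]] .
      have "(x \<ominus>\<^bsub>Q\<^esub> w) \<oplus>\<^bsub>Q\<^esub> w = x" using B_carrier[OF x(1)] MaxB_carrier[OF nu(1) wn]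
        by (simp add: a_minus_def Q.a_assoc Q.l_neg)
      then have "x \<in> \<nu>" using MaxB_add[OF nu(1) x(3)[folded w_def] wn] by simp
      then show ?thesis unfolding scaled_def using x(2) b S(3) by blast
    qed
    have "J \<subseteq> scaled d \<nu>" unfolding S(4) by (rule genideal_minimal[OF scN[OF dc] subsetI[OF bS]])
    then have "J \<cdot> ideal_pow R I \<mu> \<subseteq> scaled d \<nu> \<cdot> scaled (d [^] \<mu>) B" using Ipow by (rule ideal_prod_mono)
    also have "\<dots> \<subseteq> scaled (d \<otimes> d [^] \<mu>) \<nu>"
      by (rule scaled_prod[OF dc _ nuB scN]) (use dc MaxB_mult_r[OF nu(1)] in auto)
    finally have sub: "ideal_pow R I (Suc \<mu>) \<subseteq> scaled (d [^] Suc \<mu>) \<nu>" using mu dc by (simp add: m_comm)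
    \<comment> \<open>A coordinate of \<open>v\<close> congruent to 1 gives the contradiction: the
      power of \<open>a j\<close> forces \<open>f j\<close> into \<open>\<nu>\<close>, although
      \<open>f j\<close> is congruent to 1 there.\<close>
    obtain j where j: "j \<le> n" "v j \<ominus> \<one> \<in> m" using v(1) by (auto simp: points_def)
    have "a j [^] Suc \<mu> \<in> ideal_pow R I (Suc \<mu>)" by (rule ideal_pow_nat_pow_mem1[OF I aI[OF j(1)]])
    then obtain x where x: "x \<in> \<nu>" "emb (a j [^] Suc \<mu>) = emb (d [^] Suc \<mu>) \<otimes>\<^bsub>Q\<^esub> x" using sub unfolding scaled_def by blast
    note fc = B_carrier[OF f(1)[OF j(1)]]
    have "emb (a j [^] Suc \<mu>) = emb (a j) [^]\<^bsub>Q\<^esub> Suc \<mu>" using a(1)[OF j(1)] by (rule emb.ring.hom_nat_pow)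
    also have "\<dots> = (emb d \<otimes>\<^bsub>Q\<^esub> f j) [^]\<^bsub>Q\<^esub> Suc \<mu>" using a(2)[OF j(1)] by simp
    also have "\<dots> = emb d [^]\<^bsub>Q\<^esub> Suc \<mu> \<otimes>\<^bsub>Q\<^esub> f j [^]\<^bsub>Q\<^esub> Suc \<mu>" using fc dc by (intro Q.nat_pow_distrib) auto
    also have "emb d [^]\<^bsub>Q\<^esub> Suc \<mu> = emb (d [^] Suc \<mu>)" using dc by (rule emb.ring.hom_nat_pow[symmetric])
    finally have "emb (d [^] Suc \<mu>) \<otimes>\<^bsub>Q\<^esub> f j [^]\<^bsub>Q\<^esub> Suc \<mu> = emb (d [^] Suc \<mu>) \<otimes>\<^bsub>Q\<^esub> x" using x(2) by simp
    then have "f j [^]\<^bsub>Q\<^esub> Suc \<mu> = x"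
      using emb_cancel[OF nzd_pow[OF d(1), of "Suc \<mu>"], of "f j [^]\<^bsub>Q\<^esub> Suc \<mu>" x] fc MaxB_carrier[OF nu(1) x(1)] Q.nat_pow_closed by blast
    then have fn: "f j \<in> \<nu>" using MaxB_prime_pow[OF nu(1) f(1)[OF j(1)], of "Suc \<mu>"] x(1) by simp
    have 1: "f j \<ominus>\<^bsub>Q\<^esub> (f j \<ominus>\<^bsub>Q\<^esub> emb (v j)) \<in> \<nu>" using MaxB_diff[OF nu(1) fn fv[OF j(1)]] .
    have vc: "v j \<in> carrier R" using pc[OF v(1) j(1)] .
    have "f j \<ominus>\<^bsub>Q\<^esub> (f j \<ominus>\<^bsub>Q\<^esub> emb (v j)) = emb (v j)"
      using fc emb.hom_closed[OF vc] by (simp add: a_minus_def Q.minus_add Q.a_assoc[symmetric] Q.r_neg)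
    then have 2: "emb (v j) \<in> \<nu>" using 1 by simp
    have 3: "emb (v j \<ominus> \<one>) \<in> \<nu>" by (rule MaxB_lies_over[OF nu(1) j(2)])
    have "emb (v j) \<ominus>\<^bsub>Q\<^esub> emb (v j \<ominus> \<one>) = \<one>\<^bsub>Q\<^esub>"
      using emb.hom_closed[OF vc] vc by (simp add: a_minus_def Q.minus_add Q.a_assoc[symmetric] Q.r_neg)
    then show False using MaxB_diff[OF nu(1) 2 3] MaxB_one[OF nu(1)] by simp
  qed
  then show ?thesis using I by blast
qed

end

section \<open>Passage to the reduced ring\<close>

locale surj_ring_hom = ring_hom_cring R S h for R (structure) and S (structure) and h +
  assumes surj: "h ` carrier R = carrier S"
begin

lemma lift: assumes "x \<in> carrier S" obtains a where "a \<in> carrier R" "x = h a"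
  using assms surj by blast

lemma h_diff: "a \<in> carrier R \<Longrightarrow> b \<in> carrier R \<Longrightarrow> h (a \<ominus>\<^bsub>R\<^esub> b) = h a \<ominus>\<^bsub>S\<^esub> h b"
  by (simp add: a_minus_def)

lemma image_ideal: assumes I: "ideal I R" shows "ideal (h ` I) S"
proof (rule idealI[OF S.ring_axioms])
  have Ic: "I \<subseteq> carrier R" using R.ideal_carrier[OF I] by blast
  show "subgroup (h ` I) (add_monoid S)"
  proof (rule S.add.subgroupI)
    show "h ` I \<subseteq> carrier S" using Ic by auto
    show "h ` I \<noteq> {}" using R.ideal_zero_closed[OF I] by blast
    fix x assume "x \<in> h ` I"
    then obtain a where a: "a \<in> I" "x = h a" by blast
    have "h (\<ominus>\<^bsub>R\<^esub> a) \<in> h ` I" using a I by (intro imageI) (simp add: additive_subgroup.a_inv_closed ideal.axioms(1))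
    then show "\<ominus>\<^bsub>S\<^esub> x \<in> h ` I" using subsetD[OF Ic a(1)] a(2) by simp
    fix y assume "y \<in> h ` I"
    then obtain b where b: "b \<in> I" "y = h b" by blast
    have "h (a \<oplus>\<^bsub>R\<^esub> b) \<in> h ` I" using R.ideal_add_closed[OF I a(1) b(1)] by (rule imageI)
    then show "x \<oplus>\<^bsub>S\<^esub> y \<in> h ` I" using subsetD[OF Ic a(1)] subsetD[OF Ic b(1)] a(2) b(2) by simp
  qed
  fix x y assume "x \<in> h ` I" "y \<in> carrier S"
  then obtain a b where ab: "a \<in> I" "x = h a" "b \<in> carrier R" "y = h b" by (auto elim: lift)
  have "h (b \<otimes>\<^bsub>R\<^esub> a) \<in> h ` I" "h (a \<otimes>\<^bsub>R\<^esub> b) \<in> h ` I"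
    using ideal.I_l_closed[OF I ab(1,3)] ideal.I_r_closed[OF I ab(1,3)] by simp_all
  then show "y \<otimes>\<^bsub>S\<^esub> x \<in> h ` I" "x \<otimes>\<^bsub>S\<^esub> y \<in> h ` I" using subsetD[OF Ic ab(1)] ab(2-4) by simp_all
qed

lemma image_prod:
  assumes I: "ideal I R" and J: "ideal J R"
  shows "h ` (ideal_prod R I J) = ideal_prod S (h ` I) (h ` J)"
proof (rule subset_antisym)
  show "h ` ideal_prod R I J \<subseteq> ideal_prod S (h ` I) (h ` J)"
  proof (rule subsetI)
    fix x assume "x \<in> h ` ideal_prod R I J"
    then obtain a where a: "a \<in> ideal_prod R I J" "x = h a" by blast
    from a(1) have "a \<in> carrier R \<and> h a \<in> ideal_prod S (h ` I) (h ` J)"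
    proof (induct a rule: ideal_prod.induct)
      case (prod i j)
      have "i \<in> carrier R" "j \<in> carrier R" using prod R.ideal_carrier I J by blast+
      then show ?case using ideal_prod.prod[of "h i" "h ` I" "h j" "h ` J" S] prod by simp
    next
      case (sum s1 s2)
      then show ?case using ideal_prod.sum[of "h s1" S "h ` I" "h ` J" "h s2"] by simp
    qed
    then show "x \<in> ideal_prod S (h ` I) (h ` J)" using a by simp
  qed
  show "ideal_prod S (h ` I) (h ` J) \<subseteq> h ` ideal_prod R I J"
  proof (rule S.ideal_prod_subsetI[OF image_ideal[OF R.ideal_prod_is_ideal[OF I J]]])
    fix x y assume "x \<in> h ` I" "y \<in> h ` J"
    then obtain i j where ij: "i \<in> I" "x = h i" "j \<in> J" "y = h j" by blast
    have "i \<in> carrier R" "j \<in> carrier R" using ij R.ideal_carrier I J by blast+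
    then have "x \<otimes>\<^bsub>S\<^esub> y = h (i \<otimes>\<^bsub>R\<^esub> j)" using ij by simp
    then show "x \<otimes>\<^bsub>S\<^esub> y \<in> h ` ideal_prod R I J" using imageI[OF ideal_prod.prod[OF ij(1,3), of R], of h] by simp
  qed
qed

lemma image_pow:
  assumes I: "ideal I R" shows "h ` (ideal_pow R I n) = ideal_pow S (h ` I) n"
  by (induct n) (simp_all add: surj image_prod[OF I R.ideal_pow_ideal[OF I]])

lemma vimage_ideal:
  assumes K: "ideal K S" shows "ideal {r \<in> carrier R. h r \<in> K} R"
  by (rule ring.ideal_vimage[OF K])

lemma image_vimage:
  assumes K: "ideal K S" shows "h ` {r \<in> carrier R. h r \<in> K} = K"
proof (rule subset_antisym)
  show "K \<subseteq> h ` {r \<in> carrier R. h r \<in> K}"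
  proof
    fix x assume x: "x \<in> K"
    obtain a where "a \<in> carrier R" "x = h a" using S.ideal_carrier[OF K x] by (rule lift)
    then show "x \<in> h ` {r \<in> carrier R. h r \<in> K}" using x by blast
  qed
qed blast

lemma image_Idl:
  assumes T: "T \<subseteq> carrier R" shows "h ` (Idl\<^bsub>R\<^esub> T) = Idl\<^bsub>S\<^esub> (h ` T)"
proof (rule subset_antisym)
  have hT: "h ` T \<subseteq> carrier S" using T by auto
  note K = S.genideal_ideal[OF hT]
  have "T \<subseteq> {r \<in> carrier R. h r \<in> Idl\<^bsub>S\<^esub> (h ` T)}" using T S.genideal_self[OF hT] by blast
  then have "Idl\<^bsub>R\<^esub> T \<subseteq> {r \<in> carrier R. h r \<in> Idl\<^bsub>S\<^esub> (h ` T)}" by (rule R.genideal_minimal[OF vimage_ideal[OF K]])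
  then show "h ` (Idl\<^bsub>R\<^esub> T) \<subseteq> Idl\<^bsub>S\<^esub> (h ` T)" by blast
  show "Idl\<^bsub>S\<^esub> (h ` T) \<subseteq> h ` (Idl\<^bsub>R\<^esub> T)"
    using image_mono[OF R.genideal_self[OF T]] by (rule S.genideal_minimal[OF image_ideal[OF R.genideal_ideal[OF T]]])
qed

lemma image_noetherian:
  assumes "noetherian_ring R" shows "noetherian_ring S"
proof (rule S.noetherian_ringI)
  fix K assume K: "ideal K S"
  obtain T where T: "T \<subseteq> carrier R" "finite T" "{r \<in> carrier R. h r \<in> K} = Idl\<^bsub>R\<^esub> T"
    using noetherian_ring.finetely_gen[OF assms vimage_ideal[OF K]] by blast
  have "K = Idl\<^bsub>S\<^esub> (h ` T)" using image_vimage[OF K] image_Idl[OF T(1)] T(3) by simp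
  then show "\<exists>A\<subseteq>carrier S. finite A \<and> K = Idl\<^bsub>S\<^esub> A" using T by (intro exI[of _ "h ` T"]) auto
qed

lemma vimage_prime:
  assumes P: "primeideal P S" shows "primeideal {r \<in> carrier R. h r \<in> P} R"
proof (rule primeidealI)
  have idP: "ideal P S" using P by (rule primeideal.axioms(1))
  show "ideal {r \<in> carrier R. h r \<in> P} R" by (rule vimage_ideal[OF idP])
  show "cring R" by (rule R.is_cring)
  show "carrier R \<noteq> {r \<in> carrier R. h r \<in> P}"
  proof
    assume "carrier R = {r \<in> carrier R. h r \<in> P}"
    then have "\<one>\<^bsub>R\<^esub> \<in> {r \<in> carrier R. h r \<in> P}" by (metis R.one_closed)
    then have "\<one>\<^bsub>S\<^esub> \<in> P" by simp
    then show False using ideal.one_imp_carrier[OF idP] primeideal.I_notcarr[OF P] by simp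
  qed
  fix a b assume "a \<in> carrier R" "b \<in> carrier R" "a \<otimes>\<^bsub>R\<^esub> b \<in> {r \<in> carrier R. h r \<in> P}"
  then show "a \<in> {r \<in> carrier R. h r \<in> P} \<or> b \<in> {r \<in> carrier R. h r \<in> P}"
    using primeideal.I_prime[OF P, of "h a" "h b"] by simp
qed

lemma vimage_prime_chain:
  assumes "prime_chain S n" shows "prime_chain R n"
proof -
  obtain P where P: "\<And>i. i \<le> n \<Longrightarrow> primeideal (P i) S" "\<And>i. i < n \<Longrightarrow> P i \<subset> P (Suc i)"
    using assms unfolding prime_chain_def by blast
  have "{r \<in> carrier R. h r \<in> P i} \<subset> {r \<in> carrier R. h r \<in> P (Suc i)}" if i: "i < n" for i
  proof -
    obtain x where x: "x \<in> P (Suc i)" "x \<notin> P i" using P(2)[OF i] by blast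
    have "x \<in> carrier S" using S.ideal_carrier[OF primeideal.axioms(1)[OF P(1)[of "Suc i"]] x(1)] i by simp
    then obtain a where "a \<in> carrier R" "x = h a" by (rule lift)
    then show ?thesis using P(2)[OF i] x by blast
  qed
  then show ?thesis unfolding prime_chain_def using vimage_prime[OF P(1)]
    by (intro exI[of _ "\<lambda>i. {r \<in> carrier R. h r \<in> P i}"]) simp
qed

lemma image_reduction:
  assumes I: "ideal I R" and J: "is_reduction R J I" shows "is_reduction S (h ` J) (h ` I)"
proof -
  have idJ: "ideal J R" "J \<subseteq> I" using J by (auto simp: is_reduction_def)
  obtain k where k: "k > 0" "ideal_pow R I (Suc k) = ideal_prod R J (ideal_pow R I k)" using J by (auto simp: is_reduction_def)
  have "ideal_pow S (h ` I) (Suc k) = h ` (ideal_pow R I (Suc k))" by (rule image_pow[OF I, symmetric])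
  also have "\<dots> = ideal_prod S (h ` J) (ideal_pow S (h ` I) k)"
    unfolding k(2) by (simp only: image_prod[OF idJ(1) R.ideal_pow_ideal[OF I]] image_pow[OF I])
  finally show ?thesis unfolding is_reduction_def using k(1) image_ideal[OF idJ(1)] idJ(2) by blast
qed

text \<open>Reductions and generating sets map forward along \<open>h\<close>, so the preimage of an
  ideal without a small reduction has none either.\<close>

lemma no_reduction_lift:
  assumes K: "ideal K S" "\<not> has_n_gen_reduction S n K"
  shows "\<exists>I. ideal I R \<and> \<not> has_n_gen_reduction R n I"
proof (intro exI conjI notI)
  let ?I = "{r \<in> carrier R. h r \<in> K}"
  show I: "ideal ?I R" by (rule vimage_ideal[OF K(1)])
  assume "has_n_gen_reduction R n ?I"
  then obtain J T where J: "is_reduction R J ?I" and T: "finite T" "card T \<le> n" "T \<subseteq> carrier R" "J = Idl\<^bsub>R\<^esub> T"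
    unfolding has_n_gen_reduction_def n_generated_def by blast
  have "is_reduction S (h ` J) K" using image_reduction[OF I J] image_vimage[OF K(1)] by simp
  moreover have "n_generated S n (h ` J)"
    unfolding n_generated_def T(4) image_Idl[OF T(3)]
    using T(1-3) card_image_le[OF T(1), of h] by (intro exI[of _ "h ` T"]) auto
  ultimately show False using K(2) unfolding has_n_gen_reduction_def by blast
qed

end

text \<open>The difference of the two powers is a multiple of \<open>u\<close>, hence keeps one
  factor from \<open>J\<close>. When x - u is nilpotent, this puts a power of \<open>x\<close>
  itself into \<open>J\<close> times a power of \<open>I\<close>.\<close>

lemma (in cring) pow_minus_perturbed_mem:
  assumes I: "ideal I R" and J: "ideal J R" "J \<subseteq> I" and d: "d > 0"
    and x: "x \<in> ideal_pow R I d" and u: "u \<in> J \<cdot> ideal_pow R I (d - 1)"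
  shows "x [^] Suc c \<ominus> (x \<ominus> u) [^] Suc c \<in> J \<cdot> ideal_pow R I (d * Suc c - 1)"
proof -
  have id: "ideal (J \<cdot> ideal_pow R I k) R" for k using J(1) ideal_pow_ideal[OF I] by (rule ideal_prod_is_ideal)
  have mult: "a \<otimes> b \<in> J \<cdot> ideal_pow R I k'"
    if "a \<in> J \<cdot> ideal_pow R I k" "b \<in> ideal_pow R I l" "k' = k + l" for a b k l k'
  proof -
    have "a \<otimes> b \<in> (J \<cdot> ideal_pow R I k) \<cdot> ideal_pow R I l" using that by (simp add: ideal_prod.prod)
    also have "\<dots> = J \<cdot> ideal_pow R I k'"
      by (simp add: that(3) ideal_pow_add[OF I] ideal_prod_assoc J(1) ideal_pow_ideal[OF I])
    finally show ?thesis .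
  qed
  have uI: "u \<in> ideal_pow R I d"
  proof -
    have "u \<in> I \<cdot> ideal_pow R I (d - 1)" using u ideal_prod_mono[OF J(2) order_refl] by blast
    then show ?thesis using d by (cases d) auto
  qed
  have xu: "x \<ominus> u \<in> ideal_pow R I d" using ideal_diff_closed[OF ideal_pow_ideal[OF I] x uI] .
  have xc: "x \<in> carrier R" "u \<in> carrier R" using x uI ideal_pow_carrier[OF I] by blast+
  show ?thesis
  proof (induct c)
    case 0
    have "x \<ominus> (x \<ominus> u) = u" using xc by algebra
    then show ?case using u xc by simp
  next
    case (Suc c)
    define p where "p = x [^] Suc c"
    define w where "w = (x \<ominus> u) [^] Suc c"
    have pc: "p \<in> carrier R" "w \<in> carrier R" using xc by (auto simp: p_def w_def)
    have "x [^] Suc (Suc c) \<ominus> (x \<ominus> u) [^] Suc (Suc c) = p \<otimes> x \<ominus> w \<otimes> (x \<ominus> u)" by (simp add: p_def w_def)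
    also have "\<dots> = (p \<ominus> w) \<otimes> x \<oplus> u \<otimes> w" using pc xc by algebra
    also have "\<dots> \<in> J \<cdot> ideal_pow R I (d * Suc (Suc c) - 1)"
    proof (rule ideal_add_closed[OF id])
      show "(p \<ominus> w) \<otimes> x \<in> J \<cdot> ideal_pow R I (d * Suc (Suc c) - 1)"
        by (rule mult[OF Suc[folded p_def w_def] x]) (use d in simp)
      have wI: "w \<in> ideal_pow R I (d * Suc c)" unfolding w_def by (rule ideal_pow_nat_pow_mem[OF I xu refl])
      show "u \<otimes> w \<in> J \<cdot> ideal_pow R I (d * Suc (Suc c) - 1)"
        by (rule mult[OF u wI]) (use d in simp)
    qed
    finally show ?case .
  qed
qed

text \<open>For a generator \<open>a\<close> of \<open>I\<close>, the power a^(\<mu>+1) equals an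
  element of J I^\<mu> up to a nilpotent error. A further power absorbs the error, and the
  elementwise criterion applies; lifting the elements of \<open>T\<close> does not increase their
  number.\<close>

lemma (in surj_ring_hom) reduction_lift:
  assumes noeth: "noetherian_ring R" and I: "ideal I R"
    and nil: "\<And>r. r \<in> carrier R \<Longrightarrow> h r = \<zero>\<^bsub>S\<^esub> \<Longrightarrow> \<exists>c::nat. r [^]\<^bsub>R\<^esub> c = \<zero>\<^bsub>R\<^esub>"
    and T: "finite T" "card T \<le> n" "T \<subseteq> h ` I"
      "ideal_pow S (h ` I) (Suc \<mu>) \<subseteq> ideal_prod S (Idl\<^bsub>S\<^esub> T) (ideal_pow S (h ` I) \<mu>)"
  shows "has_n_gen_reduction R n I"
proof -
  have "\<forall>x\<in>T. \<exists>a. a \<in> I \<and> h a = x" using T(3) by blast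
  then obtain g where g: "\<And>x. x \<in> T \<Longrightarrow> g x \<in> I" "\<And>x. x \<in> T \<Longrightarrow> h (g x) = x" by metis
  define U where "U = g ` T"
  have U: "finite U" "card U \<le> n" "U \<subseteq> I" "h ` U = T"
    using T g card_image_le[OF T(1), of g] by (auto simp: U_def image_image)
  have Uc: "U \<subseteq> carrier R" using U R.ideal_carrier[OF I] by blast
  define J where "J = Idl\<^bsub>R\<^esub> U"
  have J: "ideal J R" "J \<subseteq> I" using R.genideal_ideal[OF Uc] R.genideal_minimal[OF I U(3)] by (auto simp: J_def)
  obtain F where F: "F \<subseteq> carrier R" "finite F" "I = Idl\<^bsub>R\<^esub> F" using noetherian_ring.finetely_gen[OF noeth I] by blast
  have "is_reduction R J I"
  proof (rule R.is_reductionI_elementwise[OF I J F(2,3,1)])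
    fix a assume "a \<in> F"
    then have aI: "a \<in> I" using F R.genideal_self by blast
    define x where "x = a [^]\<^bsub>R\<^esub> Suc \<mu>"
    have x: "x \<in> ideal_pow R I (Suc \<mu>)" unfolding x_def by (rule R.ideal_pow_nat_pow_mem1[OF I aI])
    have "h x \<in> h ` ideal_pow R I (Suc \<mu>)" using x by (rule imageI)
    then have "h x \<in> ideal_prod S (Idl\<^bsub>S\<^esub> T) (ideal_pow S (h ` I) \<mu>)" unfolding image_pow[OF I] using T(4) by blast
    also have "Idl\<^bsub>S\<^esub> T = h ` J" unfolding J_def image_Idl[OF Uc] U(4) ..
    also have "ideal_prod S (h ` J) (ideal_pow S (h ` I) \<mu>) = h ` ideal_prod R J (ideal_pow R I \<mu>)"
      by (simp only: image_prod[OF J(1) R.ideal_pow_ideal[OF I]] image_pow[OF I])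
    finally obtain u where u: "u \<in> ideal_prod R J (ideal_pow R I \<mu>)" "h x = h u" by blast
    have xc: "x \<in> carrier R" using x R.ideal_pow_carrier[OF I] by blast
    have uc: "u \<in> carrier R" using u R.ideal_carrier[OF R.ideal_prod_is_ideal[OF J(1) R.ideal_pow_ideal[OF I]]] by blast
    have "h (x \<ominus>\<^bsub>R\<^esub> u) = \<zero>\<^bsub>S\<^esub>" using xc uc u(2) by (simp add: h_diff)
    then obtain c :: nat where "(x \<ominus>\<^bsub>R\<^esub> u) [^]\<^bsub>R\<^esub> c = \<zero>\<^bsub>R\<^esub>" using nil xc uc by (meson R.minus_closed)
    then have c: "(x \<ominus>\<^bsub>R\<^esub> u) [^]\<^bsub>R\<^esub> Suc c = \<zero>\<^bsub>R\<^esub>" using xc uc by simp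
    have "x [^]\<^bsub>R\<^esub> Suc c \<ominus>\<^bsub>R\<^esub> (x \<ominus>\<^bsub>R\<^esub> u) [^]\<^bsub>R\<^esub> Suc c \<in> ideal_prod R J (ideal_pow R I (Suc \<mu> * Suc c - 1))"
      by (rule R.pow_minus_perturbed_mem[OF I J _ x]) (use u in simp_all)
    then have "x [^]\<^bsub>R\<^esub> Suc c \<in> ideal_prod R J (ideal_pow R I (Suc \<mu> * Suc c - 1))"
      unfolding c using xc by (simp add: a_minus_def)
    moreover have "x [^]\<^bsub>R\<^esub> Suc c = a [^]\<^bsub>R\<^esub> (Suc \<mu> * Suc c)"
      unfolding x_def using R.ideal_carrier[OF I aI] by (rule R.nat_pow_pow)
    ultimately show "\<exists>n>0. a [^]\<^bsub>R\<^esub> n \<in> ideal_prod R J (ideal_pow R I (n - 1))"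
      by (intro exI[of _ "Suc \<mu> * Suc c"]) simp
  qed
  moreover have "n_generated R n J" unfolding n_generated_def J_def using U Uc by blast
  ultimately show ?thesis unfolding has_n_gen_reduction_def by blast
qed

lemma (in cring) nilradical_ideal: "ideal (nilradical R) R"
proof (rule idealI[OF ring_axioms])
  have zero: "x [^] k = \<zero>" if "x \<in> carrier R" "x [^] (p::nat) = \<zero>" "p \<le> k" for x k p
  proof -
    have "x [^] k = x [^] p \<otimes> x [^] (k - p)" using nat_pow_mult[OF that(1), of p "k - p"] that(3) by simp
    then show ?thesis using that by simp
  qed
  have smult: "x \<otimes> a \<in> nilradical R" if h: "a \<in> nilradical R" "x \<in> carrier R" for a x
  proof -
    obtain p :: nat where p: "a \<in> carrier R" "a [^] p = \<zero>" using h unfolding nilradical_def by blast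
    have "(x \<otimes> a) [^] p = \<zero>" using p h by (simp add: nat_pow_distrib)
    then show ?thesis unfolding nilradical_def using p h by blast
  qed
  show "subgroup (nilradical R) (add_monoid R)"
  proof (rule add.subgroupI)
    show "nilradical R \<subseteq> carrier R" by (auto simp: nilradical_def)
    have "\<zero> [^] (1::nat) = \<zero>" by simp
    then show "nilradical R \<noteq> {}" unfolding nilradical_def by blast
    fix a assume a: "a \<in> nilradical R"
    then obtain p :: nat where p: "a \<in> carrier R" "a [^] p = \<zero>" unfolding nilradical_def by blast
    show "\<ominus> a \<in> nilradical R" using smult[OF a, of "\<ominus> \<one>"] p(1) by (simp add: l_minus)
    fix b assume "b \<in> nilradical R"
    then obtain q :: nat where q: "b \<in> carrier R" "b [^] q = \<zero>" unfolding nilradical_def by blast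
    \<comment> \<open>The statement with extra powers of \<open>a\<close> and \<open>b\<close> is
      closed under splitting off one factor a + b; at n = 0 one of the exponents reaches its
      nilpotency bound.\<close>
    have "a [^] i \<otimes> b [^] j \<otimes> (a \<oplus> b) [^] n = \<zero>" if "p + q \<le> i + j + n" for i j n :: nat
      using that
    proof (induct n arbitrary: i j)
      case 0
      then consider "p \<le> i" | "q \<le> j" by linarith
      then show ?case using zero[OF p, of i] zero[OF q, of j] p(1) q(1) by cases simp_all
    next
      case (Suc n)
      define w where "w = (a \<oplus> b) [^] n"
      have wc: "w \<in> carrier R" "a [^] i \<in> carrier R" "b [^] j \<in> carrier R" using p q by (auto simp: w_def)
      have "a [^] i \<otimes> b [^] j \<otimes> (w \<otimes> (a \<oplus> b)) = (a [^] i \<otimes> a) \<otimes> b [^] j \<otimes> w \<oplus> a [^] i \<otimes> (b [^] j \<otimes> b) \<otimes> w"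
        using wc p(1) q(1) by (simp add: r_distr m_ac)
      then show ?case using Suc.hyps[of "Suc i" j] Suc.hyps[of i "Suc j"] Suc.prems by (simp add: w_def)
    qed
    from this[of 0 0 "p + q"] show "a \<oplus> b \<in> nilradical R"
      unfolding nilradical_def using p(1) q(1) by (auto intro!: exI[of _ "p + q"])
  qed
  fix a x assume ax: "a \<in> nilradical R" "x \<in> carrier R"
  show "x \<otimes> a \<in> nilradical R" by (rule smult[OF ax])
  then show "a \<otimes> x \<in> nilradical R" using ax by (simp add: m_comm nilradical_def)
qed

lemma (in cring) nilradical_subset_prime:
  assumes P: "primeideal P R" shows "nilradical R \<subseteq> P"
proof
  fix a assume "a \<in> nilradical R"
  then obtain p :: nat where p: "a \<in> carrier R" "a [^] p = \<zero>" unfolding nilradical_def by blast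
  have idP: "ideal P R" using P by (rule primeideal.axioms(1))
  have "a [^] k \<in> P \<Longrightarrow> a \<in> P" for k :: nat
  proof (induct k)
    case 0
    then show ?case using ideal.one_imp_carrier[OF idP] primeideal.I_notcarr[OF P] by simp
  next
    case (Suc k)
    then show ?case using primeideal.I_prime[OF P, of "a [^] k" a] p(1) by auto
  qed
  then show "a \<in> P" using p(2) ideal_zero_closed[OF idP] by metis
qed

text \<open>Since (q - 1)(q + ... + q^n) = q^(n+1) - q, the condition M \<le> q + ... + q^n says
  that v = q + (q - 1) M is at most q^(n+1), that is, log_q v - 1 \<le> n. From M \<ge> 1 follows v
  > q and hence \<open>0 < N\<close>. For n < N the strict inequality of integers makes room for the
  additional summand 1.\<close>

lemma ceiling_log_geometric:
  fixes q M :: nat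
  assumes q: "q \<ge> 2" and M: "M \<ge> 1"
  defines "N \<equiv> nat \<lceil>-1 + log (real q) (real q + (real q - 1) * real M)\<rceil>"
  shows "0 < N" "M \<le> (\<Sum>i=1..N. q ^ i)" "\<And>n. n < N \<Longrightarrow> (\<Sum>i\<le>n. q ^ i) \<le> M"
proof -
  define v where "v = real q + (real q - 1) * real M"
  define L where "L = log (real q) v"
  have q1: "real q > 1" using q by simp
  have vq: "v > real q" unfolding v_def using q1 M by simp
  then have v0: "v > 0" using q1 by simp
  have L1: "L > 1" unfolding L_def using vq q1 v0 by (simp add: less_log_iff)
  have Ndef: "int N = \<lceil>L - 1\<rceil>" unfolding N_def L_def[symmetric] v_def[symmetric] using L1 by (simp add: algebra_simps)
  have N1: "L - 1 \<le> real N" using le_of_int_ceiling[of "L - 1"] Ndef by (metis of_int_of_nat_eq)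
  show "0 < N" using N1 L1 by (cases N) auto
  have geo: "(real q - 1) * real (\<Sum>i=1..n. q ^ i) = real q ^ Suc n - real q" for n
    by (induct n) (auto simp: algebra_simps)
  have "v \<le> real q ^ Suc N"
  proof -
    have "v = real q powr L" unfolding L_def using q1 v0 by simp
    also have "\<dots> \<le> real q powr real (Suc N)" using N1 q1 by (intro powr_mono) auto
    also have "\<dots> = real q ^ Suc N" using q1 by (intro powr_realpow) auto
    finally show ?thesis .
  qed
  then have "(real q - 1) * real M \<le> (real q - 1) * real (\<Sum>i=1..N. q ^ i)" unfolding geo v_def by simp
  then have "real M \<le> real (\<Sum>i=1..N. q ^ i)" using q1 by (subst (asm) mult_le_cancel_left_pos) auto
  then show "M \<le> (\<Sum>i=1..N. q ^ i)" using of_nat_le_iff by blast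
  fix n assume n: "n < N"
  have "real n < L - 1"
  proof (rule ccontr)
    assume "\<not> real n < L - 1"
    then have "L - 1 \<le> of_int (int n)" by simp
    then have "\<lceil>L - 1\<rceil> \<le> int n" by (rule ceiling_le)
    then show False using n Ndef by simp
  qed
  then have "real q ^ Suc n < v"
  proof -
    assume h: "real n < L - 1"
    have "real q ^ Suc n = real q powr real (Suc n)" using q1 by (intro powr_realpow[symmetric]) auto
    also have "\<dots> < real q powr L" using h q1 by (intro powr_less_mono) auto
    also have "\<dots> = v" unfolding L_def using q1 v0 by simp
    finally show ?thesis .
  qed
  then have "(real q - 1) * real (\<Sum>i=1..n. q ^ i) < (real q - 1) * real M" unfolding geo v_def by simp
  then have "real (\<Sum>i=1..n. q ^ i) < real M" using q1 by (subst (asm) mult_less_cancel_left_pos) auto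
  then have "(\<Sum>i=1..n. q ^ i) < M" using of_nat_less_iff by blast
  moreover have "(\<Sum>i\<le>n. q ^ i) = 1 + (\<Sum>i=1..n. q ^ i)"
    by (simp add: atMost_atLeast0 sum.atLeast_Suc_atMost)
  ultimately show "(\<Sum>i\<le>n. q ^ i) \<le> M" by simp
qed

section \<open>The reduced ring as a one-dimensional local ring with the same residue field\<close>

lemma (in cring) surj_hom_red_ring: "surj_ring_hom R (red_ring R) ((+>\<^bsub>R\<^esub>) (nilradical R))"
proof -
  interpret N: ideal "nilradical R" R by (rule nilradical_ideal)
  have "(+>\<^bsub>R\<^esub>) (nilradical R) ` carrier R = carrier (red_ring R)"
    unfolding red_ring_def FactRing_def A_RCOSETS_def' by auto
  then show ?thesis
    using N.rcos_ring_hom_cring[OF is_cring]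
    by (simp only: surj_ring_hom_def surj_ring_hom_axioms_def red_ring_def)
qed

lemma (in cring) red_ring_hom_zero:
  assumes "r \<in> carrier R" "nilradical R +> r = \<zero>\<^bsub>red_ring R\<^esub>" shows "r \<in> nilradical R"
  using ideal.rcos_const_imp_mem[OF nilradical_ideal assms(1)] assms(2) by (simp add: red_ring_def FactRing_def)

lemma (in cring) residue_transversal:
  assumes K: "ideal K R" and fin: "finite (carrier (R Quot K))"
  obtains E where "transversal R K E" "card E = card (carrier (R Quot K))"
proof -
  let ?C = "carrier (R Quot K)"
  have C: "?C = (\<lambda>a. K +> a) ` carrier R" by (auto simp: FactRing_def A_RCOSETS_def')
  have "\<forall>c\<in>?C. \<exists>r. r \<in> carrier R \<and> c = K +> r" using C by blast
  then obtain \<rho> where rho: "\<And>c. c \<in> ?C \<Longrightarrow> \<rho> c \<in> carrier R" "\<And>c. c \<in> ?C \<Longrightarrow> c = K +> \<rho> c" by metis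
  have inj: "inj_on \<rho> ?C" using rho(2) by (metis inj_onI)
  show thesis
  proof (rule that[of "\<rho> ` ?C"], rule transversalI)
    show "finite (\<rho> ` ?C)" "\<rho> ` ?C \<subseteq> carrier R" using fin rho by auto
    show "card (\<rho> ` ?C) = card ?C" using inj by (rule card_image)
    show "\<exists>e\<in>\<rho> ` ?C. a \<ominus> e \<in> K" if a: "a \<in> carrier R" for a
    proof -
      have c: "K +> a \<in> ?C" using a C by blast
      have "a \<ominus> \<rho> (K +> a) \<in> K"
        using quotient_eq_iff_same_a_r_cos[OF K a rho(1)[OF c]] rho(2)[OF c] by simp
      then show ?thesis using c by blast
    qed
    show "e = e'" if h: "e \<in> \<rho> ` ?C" "e' \<in> \<rho> ` ?C" "e \<ominus> e' \<in> K" for e e'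
    proof -
      obtain c c' where cc: "c \<in> ?C" "c' \<in> ?C" "e = \<rho> c" "e' = \<rho> c'" using h by blast
      have "K +> \<rho> c = K +> \<rho> c'"
        using quotient_eq_iff_same_a_r_cos[OF K rho(1)[OF cc(1)] rho(1)[OF cc(2)]] h(3) cc by simp
      then have "c = c'" using rho(2)[OF cc(1)] rho(2)[OF cc(2)] by simp
      then show ?thesis using cc by simp
    qed
  qed
qed

text \<open>As the kernel lies in \<open>K\<close>, no two classes modulo \<open>K\<close> are
  merged, and the residue rings on both sides have the same size.\<close>

lemma (in surj_ring_hom) transversal_image:
  assumes K: "ideal K R" and ker: "\<And>r. r \<in> carrier R \<Longrightarrow> h r = \<zero>\<^bsub>S\<^esub> \<Longrightarrow> r \<in> K"
    and tE: "transversal R K E"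
  shows "transversal S (h ` K) (h ` E)" "card (h ` E) = card E"
proof -
  note E = transversalD[OF tE]
  have sep: "e = e'" if h: "e \<in> E" "e' \<in> E" "h e \<ominus>\<^bsub>S\<^esub> h e' \<in> h ` K" for e e'
  proof -
    have c: "e \<in> carrier R" "e' \<in> carrier R" using h E by auto
    obtain k where k: "k \<in> K" "h e \<ominus>\<^bsub>S\<^esub> h e' = h k" using h(3) by blast
    have kc: "k \<in> carrier R" using k R.ideal_carrier[OF K] by blast
    have "h ((e \<ominus>\<^bsub>R\<^esub> e') \<ominus>\<^bsub>R\<^esub> k) = \<zero>\<^bsub>S\<^esub>" using c kc k(2) by (simp add: h_diff)
    then have "(e \<ominus>\<^bsub>R\<^esub> e') \<ominus>\<^bsub>R\<^esub> k \<in> K" using ker c kc by simp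
    then have "((e \<ominus>\<^bsub>R\<^esub> e') \<ominus>\<^bsub>R\<^esub> k) \<oplus>\<^bsub>R\<^esub> k \<in> K" using k(1) R.ideal_add_closed[OF K] by blast
    moreover have "((e \<ominus>\<^bsub>R\<^esub> e') \<ominus>\<^bsub>R\<^esub> k) \<oplus>\<^bsub>R\<^esub> k = e \<ominus>\<^bsub>R\<^esub> e'" using c kc by (simp add: a_minus_def R.a_assoc R.l_neg)
    ultimately show ?thesis using E(4) h by simp
  qed
  show "transversal S (h ` K) (h ` E)"
  proof (rule transversalI)
    show "finite (h ` E)" "h ` E \<subseteq> carrier S" using E(1,2) by auto
    show "e = e'" if "e \<in> h ` E" "e' \<in> h ` E" "e \<ominus>\<^bsub>S\<^esub> e' \<in> h ` K" for e e' using that sep by blast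
    fix x assume x: "x \<in> carrier S"
    obtain a where a: "a \<in> carrier R" "x = h a" using x by (rule lift)
    obtain e where e: "e \<in> E" "a \<ominus>\<^bsub>R\<^esub> e \<in> K" using E(3)[OF a(1)] by blast
    have "x \<ominus>\<^bsub>S\<^esub> h e = h (a \<ominus>\<^bsub>R\<^esub> e)" using a e E(2) by (simp add: h_diff subset_iff)
    then show "\<exists>e\<in>h ` E. x \<ominus>\<^bsub>S\<^esub> e \<in> h ` K" using e by blast
  qed
  have "inj_on h E"
  proof (rule inj_onI)
    fix e e' assume e: "e \<in> E" "e' \<in> E" "h e = h e'"
    have "h \<zero>\<^bsub>R\<^esub> \<in> h ` K" using R.ideal_zero_closed[OF K] by (rule imageI)
    moreover have "h e' \<in> carrier S" using e E by auto
    ultimately have "h e \<ominus>\<^bsub>S\<^esub> h e' \<in> h ` K" using e(3) by (simp add: a_minus_def S.r_neg)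
    then show "e = e'" using sep e by blast
  qed
  then show "card (h ` E) = card E" by (rule card_image)
qed

lemma (in cring) reduced_local_red_ring:
  assumes noeth: "noetherian_ring R" and dim1: "krull_dim_eq R 1" and max_m: "maximalideal m R"
    and local: "\<And>m'. maximalideal m' R \<Longrightarrow> m' = m" and fin: "finite (carrier (R Quot m))"
  shows "reduced_local_ring (red_ring R) (((+>) (nilradical R)) ` m)"
proof -
  define \<pi> where "\<pi> = (+>) (nilradical R)"
  interpret H: surj_ring_hom R "red_ring R" \<pi> unfolding \<pi>_def by (rule surj_hom_red_ring)
  have ker: "r \<in> nilradical R" if "r \<in> carrier R" "\<pi> r = \<zero>\<^bsub>red_ring R\<^esub>" for r
    using red_ring_hom_zero that unfolding \<pi>_def by blast
  have idm: "ideal m R" using max_m by (rule maximalideal.axioms(1))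
  have Nm: "nilradical R \<subseteq> m" by (rule nilradical_subset_prime[OF maximalideal_prime[OF max_m]])
  have one_m: "\<one> \<notin> m" by (rule maximalideal_one_notin[OF max_m])
  have proper_sub: "K \<subseteq> m" if "ideal K R" "\<one> \<notin> K" for K
    using exists_maximalideal_superset[OF that] local by metis
  have one_im: "\<one>\<^bsub>red_ring R\<^esub> \<notin> \<pi> ` m"
  proof
    assume "\<one>\<^bsub>red_ring R\<^esub> \<in> \<pi> ` m"
    then obtain x where x: "x \<in> m" "\<pi> x = \<one>\<^bsub>red_ring R\<^esub>" by auto
    have xc: "x \<in> carrier R" using x ideal_carrier[OF idm] by blast
    have "\<pi> (\<one> \<ominus> x) = \<pi> \<one> \<ominus>\<^bsub>red_ring R\<^esub> \<pi> x" using H.h_diff[OF one_closed xc] .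
    also have "\<dots> = \<zero>\<^bsub>red_ring R\<^esub>" using x(2) by (simp add: a_minus_def H.S.r_neg)
    finally have "\<one> \<ominus> x \<in> m" using ker[of "\<one> \<ominus> x"] xc Nm by auto
    then have "(\<one> \<ominus> x) \<oplus> x \<in> m" using x ideal_add_closed[OF idm] by blast
    moreover have "(\<one> \<ominus> x) \<oplus> x = \<one>" using xc by algebra
    ultimately show False using one_m by simp
  qed
  have uniq: "M = \<pi> ` m" if M: "maximalideal M (red_ring R)" for M
  proof -
    have idM: "ideal M (red_ring R)" using M by (rule maximalideal.axioms(1))
    have "\<one> \<notin> {r \<in> carrier R. \<pi> r \<in> M}" using H.S.maximalideal_one_notin[OF M] by simp
    then have "{r \<in> carrier R. \<pi> r \<in> M} \<subseteq> m" by (rule proper_sub[OF H.vimage_ideal[OF idM]])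
    then have "\<pi> ` {r \<in> carrier R. \<pi> r \<in> M} \<subseteq> \<pi> ` m" by (rule image_mono)
    then have "M \<subseteq> \<pi> ` m" using H.image_vimage[OF idM] by simp
    then have "\<pi> ` m = M \<or> \<pi> ` m = carrier (red_ring R)"
      using maximalideal.I_maximal[OF M H.image_ideal[OF idm]] H.S.ideal_carrier[OF H.image_ideal[OF idm]] by blast
    then show ?thesis using one_im H.S.one_closed by blast
  qed
  have red: "x = \<zero>\<^bsub>red_ring R\<^esub>" if x: "x \<in> carrier (red_ring R)" "x \<otimes>\<^bsub>red_ring R\<^esub> x = \<zero>\<^bsub>red_ring R\<^esub>" for x
  proof -
    obtain a where a: "a \<in> carrier R" "x = \<pi> a" using x(1) by (rule H.lift)
    have "\<pi> (a \<otimes> a) = \<zero>\<^bsub>red_ring R\<^esub>" using a x(2) by simp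
    then have "a \<otimes> a \<in> nilradical R" using ker[of "a \<otimes> a"] a by simp
    then obtain k :: nat where "(a \<otimes> a) [^] k = \<zero>" unfolding nilradical_def by blast
    then have "a [^] (k + k) = \<zero>" using a(1) by (simp add: nat_pow_distrib nat_pow_mult)
    then have "a \<in> nilradical R" unfolding nilradical_def using a(1) by blast
    then have "nilradical R +> a = nilradical R"       using a_coset_join2[OF a(1) additive_subgroup.a_subgroup[OF ideal.axioms(1)[OF nilradical_ideal]]] by simp
    then show ?thesis using a(2) by (simp add: \<pi>_def red_ring_def FactRing_def)
  qed
  \<comment> \<open>The reduced ring is nonzero, so it has some maximal ideal, and by
    \<open>uniq\<close> that ideal is the image of \<open>m\<close>.\<close>
  have maxi: "maximalideal (\<pi> ` m) (red_ring R)"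
  proof -
    have "\<one>\<^bsub>red_ring R\<^esub> \<notin> {\<zero>\<^bsub>red_ring R\<^esub>}"
      using one_im H.S.ideal_zero_closed[OF H.image_ideal[OF idm]] by auto
    then obtain M where "maximalideal M (red_ring R)" using H.S.exists_maximalideal_superset[OF H.S.zeroideal] by blast
    then show ?thesis using uniq by metis
  qed
  have nochain: "\<not> prime_chain (red_ring R) (Suc 1)"
    using H.vimage_prime_chain[of "Suc 1"] dim1 unfolding krull_dim_eq_def by auto
  \<comment> \<open>If the image were zero, \<open>m\<close> would consist of nilpotents and lie in
    \<open>P 0\<close>, and the chain P 0 \<subset> P 1 \<subseteq> m would collapse.\<close>
  have nonzero: "\<pi> ` m \<noteq> {\<zero>\<^bsub>red_ring R\<^esub>}"
  proof
    assume e: "\<pi> ` m = {\<zero>\<^bsub>red_ring R\<^esub>}"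
    obtain P where P: "\<And>i. i \<le> 1 \<Longrightarrow> primeideal (P i) R" "P 0 \<subset> P (Suc 0)"
      using dim1 unfolding krull_dim_eq_def prime_chain_def by (metis less_one)
    have id1: "ideal (P 1) R" using P(1)[of 1] primeideal.axioms(1) by blast
    have "\<one> \<notin> P 1" using P(1)[of 1] ideal.one_imp_carrier[OF id1] primeideal.I_notcarr by fastforce
    then have "P 1 \<subseteq> m" using proper_sub id1 by blast
    moreover have "m \<subseteq> nilradical R" using ker e ideal_carrier[OF idm] by blast
    moreover have "nilradical R \<subseteq> P 0" using nilradical_subset_prime P(1)[of 0] by simp
    ultimately show False using P(2) by auto
  qed
  have cover: "finite_cover (red_ring R) (\<pi> ` m)"
  proof -
    obtain E where E: "transversal R m E" using residue_transversal[OF idm fin] by blast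
    have "r \<in> m" if "r \<in> carrier R" "\<pi> r = \<zero>\<^bsub>red_ring R\<^esub>" for r using ker[OF that] Nm by blast
    then have "transversal (red_ring R) (\<pi> ` m) (\<pi> ` E)" using H.transversal_image(1)[OF idm _ E] by blast
    then show ?thesis unfolding finite_cover_def transversal_def by blast
  qed
  show ?thesis unfolding \<pi>_def[symmetric]
  proof (intro reduced_local_ring.intro reduced_local_ring_axioms.intro)
    show "x = \<zero>\<^bsub>red_ring R\<^esub>" if "x \<in> carrier (red_ring R)" "x \<otimes>\<^bsub>red_ring R\<^esub> x = \<zero>\<^bsub>red_ring R\<^esub>" for x
      using that by (rule red)
    show "M = \<pi> ` m" if "maximalideal M (red_ring R)" for M using that by (rule uniq)
  qed (fact H.S.is_cring H.image_noetherian[OF noeth] maxi nochain nonzero cover)+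
qed

theorem theoremA:
  fixes R :: "('a, 'b) ring_scheme" and m :: "'a set"
  assumes noeth: "noetherian_cring R"
    and dim1: "krull_dim_eq R 1"
    and max_m: "maximalideal m R"
    and local: "\<forall>m'. maximalideal m' R \<longrightarrow> m' = m"
    and fin_res: "finite (carrier (R Quot m))"
  shows "finite (Max_ideals (integral_closure (red_ring R))) \<and>
    (let q = card (carrier (R Quot m));
         M = card (Max_ideals (integral_closure (red_ring R)));
         N = nat \<lceil>-1 + log (real q) (real q + (real q - 1) * real M)\<rceil>
     in 0 < N \<and> (\<forall>I. ideal I R \<longrightarrow> has_n_gen_reduction R N I) \<and>
        (\<forall>n>0. (\<forall>I. ideal I R \<longrightarrow> has_n_gen_reduction R n I) \<longrightarrow> N \<le> n))"
proof -
  interpret cring R using noeth by (simp add: noetherian_cring_def)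
  have nr: "noetherian_ring R" using noeth by (rule noetherian_cring_imp_noetherian_ring)
  define \<pi> where "\<pi> = (+>\<^bsub>R\<^esub>) (nilradical R)"
  interpret H: surj_ring_hom R "red_ring R" \<pi> unfolding \<pi>_def by (rule surj_hom_red_ring)
  interpret A: reduced_local_ring "red_ring R" "\<pi> ` m"
    unfolding \<pi>_def using local by (intro reduced_local_red_ring nr dim1 max_m fin_res) blast
  have idm: "ideal m R" using max_m by (rule maximalideal.axioms(1))
  have ker: "r \<in> nilradical R" if "r \<in> carrier R" "\<pi> r = \<zero>\<^bsub>red_ring R\<^esub>" for r
    using red_ring_hom_zero that unfolding \<pi>_def by blast
  have kerm: "r \<in> m" if "r \<in> carrier R" "\<pi> r = \<zero>\<^bsub>red_ring R\<^esub>" for r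
    using ker[OF that] nilradical_subset_prime[OF maximalideal_prime[OF max_m]] by blast
  obtain E where E: "transversal R m E" "card E = card (carrier (R Quot m))"
    using residue_transversal[OF idm fin_res] by blast
  have T: "transversal (red_ring R) (\<pi> ` m) (\<pi> ` E)" "card (\<pi> ` E) = card E"
    using H.transversal_image[OF idm _ E(1)] kerm by blast+
  define q where "q = card (carrier (R Quot m))"
  define M where "M = card (Max_ideals (integral_closure (red_ring R)))"
  define N where "N = nat \<lceil>-1 + log (real q) (real q + (real q - 1) * real M)\<rceil>"
  have cardE: "card (\<pi> ` E) = q" using T(2) E(2) by (simp add: q_def)
  have "2 \<le> card (\<pi> ` E)" by (rule A.transversal_card_ge_2[OF T(1)])
  then have q2: "q \<ge> 2" unfolding cardE .
  have M1: "M \<ge> 1" unfolding M_def using A.MaxB_nonempty A.finite_MaxB by (simp add: Suc_le_eq card_gt_0_iff)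
  note N = ceiling_log_geometric[OF q2 M1, folded N_def]
  have upper: "has_n_gen_reduction R N I" if I: "ideal I R" for I
  proof -
    have "card (Max_ideals (integral_closure (red_ring R))) \<le> (\<Sum>i=1..N. card (\<pi> ` E) ^ i)"
      using N(2) unfolding cardE M_def .
    then obtain U \<mu> where U: "finite U" "card U \<le> N" "U \<subseteq> \<pi> ` I"
      "ideal_pow (red_ring R) (\<pi> ` I) (Suc \<mu>) \<subseteq> ideal_prod (red_ring R) (Idl\<^bsub>red_ring R\<^esub> U) (ideal_pow (red_ring R) (\<pi> ` I) \<mu>)"
      using A.has_n_gen_reduction_all[OF T(1) H.image_ideal[OF I]] by blast
    show ?thesis
    proof (rule H.reduction_lift[OF nr I _ U])
      show "\<exists>c::nat. r [^]\<^bsub>R\<^esub> c = \<zero>\<^bsub>R\<^esub>" if "r \<in> carrier R" "\<pi> r = \<zero>\<^bsub>red_ring R\<^esub>" for r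
        using ker[OF that] unfolding nilradical_def by blast
    qed
  qed
  have lower: "N \<le> n" if all: "\<forall>I. ideal I R \<longrightarrow> has_n_gen_reduction R n I" for n
  proof (rule ccontr)
    assume "\<not> N \<le> n"
    then have "(\<Sum>i\<le>n. card (\<pi> ` E) ^ i) \<le> card (Max_ideals (integral_closure (red_ring R)))"
      using N(3)[of n] unfolding cardE M_def by simp
    then obtain K where "ideal K (red_ring R)" "\<not> has_n_gen_reduction (red_ring R) n K"
      using A.exists_ideal_without_reduction[OF T(1)] by blast
    then show False using H.no_reduction_lift all by blast
  qed
  show ?thesis
    unfolding Let_def q_def[symmetric] M_def[symmetric] N_def[symmetric]
    using A.finite_MaxB N(1) upper lower by blast
qed

end
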